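(* Let $p\in\mathcal{B}_M(\mathbb{R}^n)$. Suppose $T$ is a Calderón-Zygmund operator and $\Phi=\{\phi_\alpha\}_{\alpha\in\mathcal{A}}$ is a family of measurable real-valued functions indexed by an arbitrary set $\mathcal{A}$. If the maximally modulated singular integral operator $T^\Phi$ is of weak type $(r,r)$ for all $r\in(1,\infty)$, then $T^\Phi$ extends to a bounded operator on the variable Lebesgue space $L^{p(\cdot)}(\mathbb{R}^n)$.
   Context: Let $\mathcal{M}$ be the set of all Lebesgue measurable complex-valued functions on $\mathbb{R}^n$; functions equal a.e. are identified, and $|E|$ denotes the Lebesgue measure of $E$. Variable Lebesgue space: for a measurable a.e. finite function $p:\mathbb{R}^n\to[1,\infty]$, $L^{p(\cdot)}(\mathbb{R}^n)$ is the set of all $f\in\mathcal{M}$ such that $I_{p(\cdot)}(f/\lambda):=\int_{\mathbb{R}^n}|f(x)/\lambda|^{p(x)}\,dx<\infty$ for some $\lambda>0$, with norm $\|f\|_{p(\cdot)}:=\inf\{\lambda>0:I_{p(\cdot)}(f/\lambda)\le1\}$. Hardy-Littlewood maximal operator: $(Mf)(x):=\sup_{Q\ni x}\frac{1}{|Q|}\int_Q|f(y)|\,dy$ for $f\in L^1_{\rm loc}(\mathbb{R}^n)$, the supremum being over all cubes $Q$ containing $x$ with sides parallel to the coordinate axes. $\mathcal{B}_M(\mathbb{R}^n)$ is the set of all measurable functions $p:\mathbb{R}^n\to[1,\infty]$ such that $1<\operatorname{ess\,inf}_{x\in\mathbb{R}^n}p(x)$, $\operatorname{ess\,sup}_{x\in\mathbb{R}^n}p(x)<\infty$,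 and $M$ is bounded on $L^{p(\cdot)}(\mathbb{R}^n)$, i.e. $\|Mf\|_{p(\cdot)}\le C\|f\|_{p(\cdot)}$ for all $f\in L^{p(\cdot)}(\mathbb{R}^n)$ with some constant $C$. Calderón-Zygmund operator: $L_0^\infty(\mathbb{R}^n)$ is the set of bounded functions with compact support. A Calderón-Zygmund operator is a linear operator $T$ bounded on $L^2(\mathbb{R}^n)$ such that for every $f\in L_0^\infty(\mathbb{R}^n)$, $(Tf)(x)=\int_{\mathbb{R}^n}K(x,y)f(y)\,dy$ for a.e. $x\in\mathbb{R}^n\setminus\operatorname{supp}f$, where the kernel $K:\mathbb{R}^n\times\mathbb{R}^n\setminus\{(x,x):x\in\mathbb{R}^n\}\to\mathbb{C}$ satisfies $|K(x,y)|\le c_0|x-y|^{-n}$ for $x\ne y$ and $|K(x,y)-K(x,y')|+|K(y,x)-K(y',x)|\le c_0|y-y'|^\tau|x-y|^{-n-\tau}$ for $|x-y|>2|y-y'|$, with positive constants $c_0,\tau$ independent of $x,y,y'\in\mathbb{R}^n$. Maximally modulated operator: for $\alpha\in\mathcal{A}$ let $(\mathcal{M}^{\phi_\alpha}f)(x):=e^{-i\phi_\alpha(x)}f(x)$, $x\in\mathbb{R}^n$; for $f\in L_0^\infty(\mathbb{R}^n)$, $(T^\Phi f)(x):=\sup_{\alpha\in\mathcal{A}}|T(\mathcal{M}^{\phi_\alpha}f)(x)|$, $x\in\mathbb{R}^n$. Weak type: for $1\le r<\infty$, a sublinear operator $A:L^r(\mathbb{R}^n)\to\mathcal{M}$ is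 of weak type $(r,r)$ if $|\{x\in\mathbb{R}^n:|(Af)(x)|>\lambda\}|\le\frac{C^r}{\lambda^r}\int_{\mathbb{R}^n}|f(y)|^r\,dy$ for all $f\in L^r(\mathbb{R}^n)$ and $\lambda>0$, where $C$ is a positive constant independent of $f$ and $\lambda$. The same notation is used for an operator defined on a dense subspace and for its bounded extension to the whole space. An operator $A$ defined on a linear subspace $D$ of $\mathcal{M}$ is nonnegative sublinear if $0\le A(f+g)\le Af+Ag$ and $A(\lambda f)=|\lambda|Af$ a.e. on $\mathbb{R}^n$ for all $f,g\in D$, $\lambda\in\mathbb{C}$. The bounded extension of $T^\Phi$ is a nonnegative sublinear operator on $L^{p(\cdot)}(\mathbb{R}^n)$ extending $T^\Phi$ whose value at each $f\in L^{p(\cdot)}(\mathbb{R}^n)$ has norm at most $C\|f\|_{p(\cdot)}$, with a constant $C>0$ independent of $f$. *)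

theory Defs
  imports
    "HOL-Analysis.Analysis"
    "HOL-Probability.Essential_Supremum"
    "HOL-Library.Complex_Order"
begin

text \<open>
  Classes of a.e. equal functions are represented by functions: a function space is a set of
  functions closed under a.e. equality, and an operator acts on functions but is required to
  respect a.e. equality. The order on the complex numbers is the one of the library theory \<open>Complex_Order\<close>, so
  \<open>0 \<le> z\<close> says that \<open>z\<close> is real and nonnegative.
\<close>

type_synonym 'n cfun = "real^'n \<Rightarrow> complex"

abbreviation meas_funs :: "('n::finite) cfun set"
  where "meas_funs \<equiv> borel_measurable lebesgue"

definition Lspace :: "real \<Rightarrow> ('n::finite) cfun set"
  where "Lspace r = {f \<in> meas_funs. (\<integral>\<^sup>+x. ennreal (cmod (f x) powr r) \<partial>lebesgue) < \<infinity>}"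

text \<open>The exponent is allowed to be infinite only on a null set wherever this is used, so the
  value of \<open>real_of_ereal \<infinity>\<close> is irrelevant.\<close>

definition modular :: "(real^'n \<Rightarrow> ereal) \<Rightarrow> ('n::finite) cfun \<Rightarrow> ennreal"
  where "modular p f = (\<integral>\<^sup>+x. ennreal (cmod (f x) powr real_of_ereal (p x)) \<partial>lebesgue)"

definition var_Lspace :: "(real^'n \<Rightarrow> ereal) \<Rightarrow> ('n::finite) cfun set"
  where "var_Lspace p =
    {f \<in> meas_funs. \<exists>l::real. 0 < l \<and> modular p (\<lambda>x. f x / of_real l) < \<infinity>}"

text \<open>Only meaningful for members of \<open>var_Lspace p\<close>; for other functions the set may be empty.\<close>

definition var_norm :: "(real^'n \<Rightarrow> ereal) \<Rightarrow> ('n::finite) cfun \<Rightarrow> real"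
  where "var_norm p f = Inf {l. 0 < l \<and> modular p (\<lambda>x. f x / of_real l) \<le> 1}"

text \<open>As elements of the function spaces are classes, the support is the complement of the largest
  open set on which the function vanishes a.e.\<close>

definition ess_support :: "('n::finite) cfun \<Rightarrow> (real^'n) set"
  where "ess_support f =
    {x. \<forall>U. open U \<and> x \<in> U \<longrightarrow> \<not> (AE y in lebesgue. y \<in> U \<longrightarrow> f y = 0)}"

definition L0inf :: "('n::finite) cfun set"
  where "L0inf =
    {f \<in> meas_funs. (\<exists>B. AE x in lebesgue. cmod (f x) \<le> B) \<and> compact (ess_support f)}"

definition ae_operator :: "('n::finite) cfun set \<Rightarrow> ('n cfun \<Rightarrow> 'n cfun) \<Rightarrow> bool"
  where "ae_operator D S \<longleftrightarrow>
    (\<forall>f\<in>D. S f \<in> meas_funs) \<and>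
    (\<forall>f\<in>D. \<forall>g\<in>D. (AE x in lebesgue. f x = g x) \<longrightarrow> (AE x in lebesgue. S f x = S g x))"

definition linear_operator :: "('n::finite) cfun set \<Rightarrow> ('n cfun \<Rightarrow> 'n cfun) \<Rightarrow> bool"
  where "linear_operator D S \<longleftrightarrow> ae_operator D S \<and>
    (\<forall>f\<in>D. \<forall>g\<in>D. AE x in lebesgue. S (\<lambda>y. f y + g y) x = S f x + S g x) \<and>
    (\<forall>f\<in>D. \<forall>c::complex. AE x in lebesgue. S (\<lambda>y. c * f y) x = c * S f x)"

definition sublinear_operator :: "('n::finite) cfun set \<Rightarrow> ('n cfun \<Rightarrow> 'n cfun) \<Rightarrow> bool"
  where "sublinear_operator D S \<longleftrightarrow> ae_operator D S \<and>
    (\<forall>f\<in>D. \<forall>g\<in>D. AE x in lebesgue.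
        cmod (S (\<lambda>y. f y + g y) x) \<le> cmod (S f x) + cmod (S g x)) \<and>
    (\<forall>f\<in>D. \<forall>c::complex. AE x in lebesgue.
        cmod (S (\<lambda>y. c * f y) x) = cmod c * cmod (S f x))"

definition nonneg_sublinear_operator ::
    "('n::finite) cfun set \<Rightarrow> ('n cfun \<Rightarrow> 'n cfun) \<Rightarrow> bool"
  where "nonneg_sublinear_operator D S \<longleftrightarrow> ae_operator D S \<and>
    (\<forall>f\<in>D. \<forall>g\<in>D. AE x in lebesgue.
        0 \<le> S (\<lambda>y. f y + g y) x \<and> S (\<lambda>y. f y + g y) x \<le> S f x + S g x) \<and>
    (\<forall>f\<in>D. \<forall>c::complex. AE x in lebesgue.
        S (\<lambda>y. c * f y) x = of_real (cmod c) * S f x)"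

definition weak_type :: "real \<Rightarrow> (('n::finite) cfun \<Rightarrow> 'n cfun) \<Rightarrow> bool"
  where "weak_type r S \<longleftrightarrow> sublinear_operator (Lspace r) S \<and>
    (\<exists>C>0. \<forall>f\<in>Lspace r. \<forall>l>0.
        emeasure lebesgue {x. cmod (S f x) > l}
          \<le> ennreal (C powr r / l powr r) * (\<integral>\<^sup>+y. ennreal (cmod (f y) powr r) \<partial>lebesgue))"

definition var_bounded :: "(real^'n \<Rightarrow> ereal) \<Rightarrow> (('n::finite) cfun \<Rightarrow> 'n cfun) \<Rightarrow> bool"
  where "var_bounded p S \<longleftrightarrow>
    (\<exists>C>0. \<forall>f\<in>var_Lspace p. S f \<in> var_Lspace p \<and> var_norm p (S f) \<le> C * var_norm p f)"

definition cubes :: "(real^'n::finite) set set"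
  where "cubes = {cbox a b |a b. \<exists>l>0. \<forall>i. b $ i - a $ i = l}"

definition HL_max :: "('n::finite) cfun \<Rightarrow> real^'n \<Rightarrow> ennreal"
  where "HL_max f x =
    (SUP Q \<in> {Q \<in> cubes. x \<in> Q}.
       (\<integral>\<^sup>+y\<in>Q. ennreal (cmod (f y)) \<partial>lebesgue) / emeasure lebesgue Q)"

text \<open>The essential infimum is the limes inferior along the a.e. filter, dually to \<open>esssup\<close>.
  Boundedness of the maximal operator includes that its values are a.e. finite, hence \<open>enn2real\<close>
  loses nothing.\<close>

definition B_M :: "(real^'n::finite \<Rightarrow> ereal) set"
  where "B_M = {p \<in> borel_measurable lebesgue.
    (\<forall>x. 1 \<le> p x) \<and>
    1 < Liminf (ae_filter lebesgue) p \<and>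
    esssup lebesgue p < \<infinity> \<and>
    (\<forall>f\<in>var_Lspace p. AE x in lebesgue. HL_max f x < \<infinity>) \<and>
    var_bounded p (\<lambda>f x. complex_of_real (enn2real (HL_max f x)))}"

definition CZ_kernel :: "(real^'n::finite \<Rightarrow> real^'n \<Rightarrow> complex) \<Rightarrow> bool"
  where "CZ_kernel K \<longleftrightarrow> (\<exists>c0>0. \<exists>\<tau>>0.
    (\<forall>x y. x \<noteq> y \<longrightarrow> cmod (K x y) \<le> c0 * norm (x - y) powr (- real CARD('n))) \<and>
    (\<forall>x y y'. norm (x - y) > 2 * norm (y - y') \<longrightarrow>
       cmod (K x y - K x y') + cmod (K y x - K y' x)
         \<le> c0 * norm (y - y') powr \<tau> * norm (x - y) powr (- real CARD('n) - \<tau>)))"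

text \<open>The values of \<open>K\<close> on the diagonal do not matter: the integral is only taken for \<open>x\<close>
  outside the support of \<open>f\<close>.\<close>

definition CZ_operator :: "(('n::finite) cfun \<Rightarrow> 'n cfun) \<Rightarrow> bool"
  where "CZ_operator T \<longleftrightarrow>
    linear_operator (Lspace 2) T \<and>
    (\<exists>C>0. \<forall>f\<in>Lspace 2.
       (\<integral>\<^sup>+x. ennreal (cmod (T f x) powr 2) \<partial>lebesgue)
         \<le> ennreal (C\<^sup>2) * (\<integral>\<^sup>+x. ennreal (cmod (f x) powr 2) \<partial>lebesgue)) \<and>
    (\<exists>K. CZ_kernel K \<and>
       (\<forall>f\<in>L0inf. AE x in lebesgue. x \<notin> ess_support f \<longrightarrow>
          T f x = (\<integral>y. K x y * f y \<partial>lebesgue)))"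

text \<open>
  The functions \<open>T g\<close> are only determined up to null sets, so for an uncountable index set the
  pointwise supremum of a family \<open>\<bar>T g\<^sub>\<alpha>\<bar>\<close> depends on the choice of representatives. The
  supremum of a family of classes is its least upper bound with respect to the a.e. order. It
  always exists, is unique a.e., and is the pointwise supremum for countable index sets; see the
  lemmas below.
\<close>

definition is_ae_Sup :: "'a measure \<Rightarrow> 'i set \<Rightarrow> ('i \<Rightarrow> 'a \<Rightarrow> ennreal) \<Rightarrow> ('a \<Rightarrow> ennreal) \<Rightarrow> bool"
  where "is_ae_Sup M I F S \<longleftrightarrow>
    S \<in> borel_measurable M \<and>
    (\<forall>i\<in>I. AE x in M. F i x \<le> S x) \<and>
    (\<forall>G\<in>borel_measurable M. (\<forall>i\<in>I. AE x in M. F i x \<le> G x) \<longrightarrow> (AE x in M. S x \<le> G x))"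

definition ae_Sup :: "'a measure \<Rightarrow> 'i set \<Rightarrow> ('i \<Rightarrow> 'a \<Rightarrow> ennreal) \<Rightarrow> 'a \<Rightarrow> ennreal"
  where "ae_Sup M I F = (SOME S. is_ae_Sup M I F S)"

definition modulate :: "(real^'n \<Rightarrow> real) \<Rightarrow> ('n::finite) cfun \<Rightarrow> 'n cfun"
  where "modulate \<phi> f = (\<lambda>x. exp (- \<i> * of_real (\<phi> x)) * f x)"

definition max_modulated ::
    "(('n::finite) cfun \<Rightarrow> 'n cfun) \<Rightarrow> 'i set \<Rightarrow> ('i \<Rightarrow> real^'n \<Rightarrow> real) \<Rightarrow> 'n cfun \<Rightarrow> real^'n \<Rightarrow> ennreal"
  where "max_modulated T I \<Phi> f =
    ae_Sup lebesgue I (\<lambda>\<alpha> x. ennreal (cmod (T (modulate (\<Phi> \<alpha>) f) x)))"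

definition extends_max_modulated ::
    "(('n::finite) cfun \<Rightarrow> 'n cfun) \<Rightarrow> 'i set \<Rightarrow> ('i \<Rightarrow> real^'n \<Rightarrow> real) \<Rightarrow> ('n cfun \<Rightarrow> 'n cfun) \<Rightarrow> bool"
  where "extends_max_modulated T I \<Phi> S \<longleftrightarrow>
    (\<forall>f\<in>L0inf. AE x in lebesgue.
       max_modulated T I \<Phi> f x < \<infinity> \<and> S f x = of_real (enn2real (max_modulated T I \<Phi> f x)))"

lemma is_ae_Sup_unique:
  assumes "is_ae_Sup M I F S" "is_ae_Sup M I F S'"
  shows "AE x in M. S x = S' x"
proof -
  have "AE x in M. S x \<le> S' x" "AE x in M. S' x \<le> S x"
    using assms unfolding is_ae_Sup_def by blast+
  then show ?thesis by eventually_elim simp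
qed

lemma is_ae_Sup_countable:
  assumes "countable I" and [measurable]: "\<And>i. i \<in> I \<Longrightarrow> F i \<in> borel_measurable M"
  shows "is_ae_Sup M I F (\<lambda>x. SUP i\<in>I. F i x)"
  unfolding is_ae_Sup_def
proof (intro conjI ballI impI)
  show "(\<lambda>x. SUP i\<in>I. F i x) \<in> borel_measurable M"
    using assms by (intro borel_measurable_SUP)
next
  fix i assume "i \<in> I"
  then show "AE x in M. F i x \<le> (SUP i\<in>I. F i x)"
    by (intro always_eventually allI SUP_upper)
next
  fix G assume "\<forall>i\<in>I. AE x in M. F i x \<le> G x"
  then have "AE x in M. \<forall>i\<in>I. F i x \<le> G x"
    by (simp add: AE_ball_countable[OF \<open>countable I\<close>])
  then show "AE x in M. (SUP i\<in>I. F i x) \<le> G x"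
    by eventually_elim (auto intro: SUP_least)
qed

lemma inverse_one_plus_le_iff: "inverse (1 + b) \<le> inverse (1 + a) \<longleftrightarrow> a \<le> b" for a b :: ennreal
proof (cases a; cases b)
  fix r s :: real
  assume r: "a = ennreal r" "0 \<le> r" and s: "b = ennreal s" "0 \<le> s"
  then have "inverse (1 + a) = ennreal (inverse (1 + r))" "inverse (1 + b) = ennreal (inverse (1 + s))"
    by (simp_all flip: ennreal_1 ennreal_plus add: inverse_ennreal)
  then show ?thesis using r s by (simp add: ennreal_le_iff)
qed (auto simp: top_unique)

lemma is_ae_Sup_exists:
  fixes F :: "'i \<Rightarrow> 'a::euclidean_space \<Rightarrow> ennreal"
  assumes F: "\<And>i. i \<in> I \<Longrightarrow> F i \<in> borel_measurable lebesgue"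
  shows "\<exists>S. is_ae_Sup lebesgue I F S"
proof -
  obtain h' :: "'a \<Rightarrow> real" where h': "h' \<in> borel_measurable lborel" "\<And>x. 0 < h' x"
      "\<And>x. h' x \<le> 1"
      "integrable lborel h'"
    by (rule sigma_finite_measure.obtain_positive_integrable_function[OF sigma_finite_lborel])
       (rule that)
  define h where "h x = ennreal (h' x)" for x
  have hm: "h \<in> borel_measurable lborel"
    unfolding h_def[abs_def] by (rule measurable_compose[OF h'(1) measurable_ennreal])
  have [measurable]: "h \<in> borel_measurable lebesgue"
    by (rule measurable_completion[OF hm])
  have "(\<integral>\<^sup>+x. h x \<partial>lborel) = ennreal (integral\<^sup>L lborel h')"
    unfolding h_def by (rule nn_integral_eq_integral[OF h'(4)]) (simp add: h'(2) less_imp_le)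
  then have hfin: "(\<integral>\<^sup>+x. h x \<partial>lebesgue) < \<infinity>"
    by (simp add: nn_integral_completion)
  define J where "J C = (\<integral>\<^sup>+x. h x * inverse (1 + (SUP i\<in>C. F i x)) \<partial>lebesgue)" for C
  have meas: "(\<lambda>x. SUP i\<in>C. F i x) \<in> borel_measurable lebesgue"
    if "countable C" "C \<subseteq> I" for C
    using that F by (intro borel_measurable_SUP) auto
  have J_anti: "J C' \<le> J C" if "C \<subseteq> C'" for C C'
    unfolding J_def
    by (intro nn_integral_mono mult_left_mono; simp add: inverse_one_plus_le_iff;
          rule SUP_subset_mono[OF that order_refl])
  define CC where "CC = {C. countable C \<and> C \<subseteq> I}"
  have "J ` CC \<noteq> {}" unfolding CC_def by auto
  from ennreal_Inf_countable_INF[OF this] obtain u :: "nat \<Rightarrow> ennreal"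
    where u: "range u \<subseteq> J ` CC" "Inf (J ` CC) = Inf (range u)" by blast
  have "\<exists>D\<in>CC. u n = J D" for n using subsetD[OF u(1) rangeI[of u n]] by blast
  then obtain c where c: "\<And>n. c n \<in> CC" "\<And>n::nat. u n = J (c n)" by metis
  define C where "C = (\<Union>n. c n)"
  have C: "countable C" "C \<subseteq> I" using c(1) by (auto simp: C_def CC_def)
  have JC: "J C \<le> J D" if "D \<in> CC" for D
  proof -
    have "J C \<le> Inf (range u)"
      by (rule INF_greatest) (simp add: c(2) C_def UN_upper J_anti)
    also have "\<dots> \<le> J D" unfolding u(2)[symmetric] using that by (rule INF_lower)
    finally show ?thesis .
  qed
  have Jfin: "J C < \<infinity>"
  proof -
    have "inverse (1 + a) \<le> (1::ennreal)" for a
      using inverse_one_plus_le_iff[of a 0] by simp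
    then have "J C \<le> (\<integral>\<^sup>+x. h x \<partial>lebesgue)"
      unfolding J_def by (intro nn_integral_mono) (rule order_trans[OF mult_left_mono[OF _ zero_le, of _ 1]], auto)
    then show ?thesis using hfin by simp
  qed
  have ub: "AE x in lebesgue. F i x \<le> (SUP i\<in>C. F i x)" if i: "i \<in> I" for i
  proof -
    let ?C = "insert i C"
    have C': "countable ?C" "?C \<subseteq> I" using C i by auto
    have [measurable]: "(\<lambda>x. SUP i\<in>C. F i x) \<in> borel_measurable lebesgue"
      "(\<lambda>x. SUP i\<in>?C. F i x) \<in> borel_measurable lebesgue"
      using meas[OF C] meas[OF C'] by auto
    let ?g = "\<lambda>x. h x * inverse (1 + (SUP i\<in>C. F i x))"
    let ?g' = "\<lambda>x. h x * inverse (1 + (SUP i\<in>?C. F i x))"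
    have gm: "?g \<in> borel_measurable lebesgue" "?g' \<in> borel_measurable lebesgue"
      by measurable
    have le: "?g' x \<le> ?g x" for x
      by (intro mult_left_mono; simp only: inverse_one_plus_le_iff zero_le; intro SUP_subset_mono; blast)
    have eq: "J ?C = J C"
      using JC[of ?C] J_anti[of C ?C] C' by (auto simp: CC_def intro: antisym)
    have "(\<integral>\<^sup>+x. ?g x - ?g' x \<partial>lebesgue) = J C - J ?C"
      unfolding J_def
      by (rule nn_integral_diff[OF gm]) (use le Jfin eq in \<open>simp_all only: J_def infinity_ennreal_def,
        auto\<close>)
    then have "(\<integral>\<^sup>+x. ?g x - ?g' x \<partial>lebesgue) = 0" using eq Jfin by simp
    then have "AE x in lebesgue. ?g x - ?g' x = 0"
      using nn_integral_0_iff_AE[OF borel_measurable_minus_ennreal[OF gm]] by blast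
    then show ?thesis
    proof eventually_elim
      case (elim x)
      have h0: "h x \<noteq> 0" "h x \<noteq> \<infinity>" using h'(2)[of x] by (auto simp: h_def)
      have "?g x \<le> ?g' x"
        using elim le[of x] by (simp only: diff_eq_0_iff_ennreal)
      with le[of x] have "?g x = ?g' x" by (rule antisym[rotated])
      then have "inverse (1 + (SUP i\<in>C. F i x)) = inverse (1 + (SUP i\<in>?C. F i x))"
        unfolding ennreal_mult_cancel_left using h0 by auto
      then have "(SUP i\<in>?C. F i x) \<le> (SUP i\<in>C. F i x)"
        by (metis inverse_one_plus_le_iff order_refl)
      moreover have "F i x \<le> (SUP i\<in>?C. F i x)" by (rule SUP_upper) simp
      ultimately show ?case by (rule order_trans[rotated])
    qed
  qed
  have "is_ae_Sup lebesgue C F (\<lambda>x. SUP i\<in>C. F i x)"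
    using C F by (intro is_ae_Sup_countable) auto
  then have "is_ae_Sup lebesgue I F (\<lambda>x. SUP i\<in>C. F i x)"
    using ub C unfolding is_ae_Sup_def by blast
  then show ?thesis by blast
qed

lemma is_ae_Sup_ae_Sup:
  fixes F :: "'i \<Rightarrow> 'a::euclidean_space \<Rightarrow> ennreal"
  assumes "\<And>i. i \<in> I \<Longrightarrow> F i \<in> borel_measurable lebesgue"
  shows "is_ae_Sup lebesgue I F (ae_Sup lebesgue I F)"
  unfolding ae_Sup_def by (rule someI_ex[OF is_ae_Sup_exists[OF assms]])

end

theory Submission
  imports Defs
begin

text \<open>
  Idea of the proof. Everything is driven by the modular
  \<open>\<rho>(f) = \<integral> \<bar>f(x)\<bar>\<^bsup>p(x)\<^esup> dx\<close>; boundedness of \<open>M\<close> is used in the form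
  \<open>\<rho>(f) \<le> 1 \<Longrightarrow> \<rho>(Mf / B) \<le> 1\<close>. Neither the boundedness of \<open>M\<close> on the dual space nor the
  openness of the condition \<open>p \<in> B_M\<close> is needed.

  First, the Rubio de Francia iteration dominates \<open>\<bar>f\<bar>\<close> by a Muckenhoupt \<open>A\<^sub>1\<close> weight \<open>w\<close> of
  comparable size. The reverse Hoelder inequality for \<open>w\<close>, together with the weak type \<open>(r,r)\<close> for one
  \<open>r > 1\<close> close to 1 and the regularity of the kernel, shows that on a dyadic cube which meets
  \<open>{w \<le> a t}\<close> the function \<open>g = T\<^sup>\<Phi> f\<close> differs from a constant by more than \<open>t/2\<close> only on a small
  fraction of the cube.

  Second, families of sets \<open>G\<^sub>k\<close> carrying the heights \<open>2\<^sup>k\<close> are measured by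
  \<open>\<Sum>\<^sub>k \<integral>\<^bsub>G\<^sub>k\<^esub> (2\<^sup>k / \<lambda>)\<^bsup>p(x)\<^esup> dx\<close>. As the heights grow geometrically, this sum is comparable with the
  modular of the supremum of the \<open>2\<^sup>k 1\<^bsub>G\<^sub>k\<^esub>\<close>, to which \<open>M\<close> applies. It follows that subsets of dyadic
  cubes of relative density at most \<open>1/2\<close> carry a definite fraction less than the cubes, and, by
  iterating over Calderon-Zygmund cubes, that subsets of small density carry little. This
  \<open>A\<^sub>\<infinity>\<close> property makes the good-\<open>\<lambda>\<close> argument for the level sets \<open>{g > 2\<^sup>k}\<close> work in the
  variable exponent space and bounds \<open>g\<close> by \<open>w\<close>. The operator is finally extended along approximating
  sequences that converge at a geometric rate.
\<close>

section \<open>Dyadic cubes\<close>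

text \<open>The weak type (r,r) with r > 1 asks for r-th power means of f near a cube, and these
  could be estimated directly only if M were bounded for the exponent p/r, which is where openness
  of the condition on p would enter. The weight \<open>w\<close> avoids this: its r-th power means
  are comparable with its means, and these with its values. A second obstacle is that the modular is
  not homogeneous and that, p being variable, the measure of a level set does not determine its
  contribution. All estimates are therefore normalised: modular at most 1 at height l implies
  modular at most 1 at height c l, and gains and losses are recorded in the factor c. Passing from
  sets to their cubes costs a fixed factor, each refinement of the density gains one, and
  sufficiently many refinements outweigh the cost. This fixes the order of the choices: the number
  of refinements, the proportion \<open>e\<close> of the exceptional sets, then the smallness
  \<open>a\<close> of the weight. The absorption argument needs a finite quantity to start from, so
  only finitely many heights are kept at a time; the lowest has no level below it and is controlled
  by a weak type with exponent below ess inf p.\<close>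

definition dcube :: "int \<Rightarrow> real^'n \<Rightarrow> (real^'n) set"
  where "dcube k x = {y. \<forall>i. \<lfloor>y $ i / 2 powi k\<rfloor> = \<lfloor>x $ i / 2 powi k\<rfloor>}"

abbreviation dcubes :: "(real^'n) set set"
  where "dcubes \<equiv> range (\<lambda>(k, x). dcube k x)"

lemma self_in_dcube: "x \<in> dcube k x"
  by (simp add: dcube_def)

lemma dcube_eq: "y \<in> dcube k x \<Longrightarrow> dcube k y = dcube k x"
  by (simp add: dcube_def)

text \<open>The integer part of z / 2^l is that of z / 2^k divided by 2^(l - k) with rounding down,
  so the finer index determines the coarser one.\<close>

lemma dcube_mono:
  assumes "k \<le> l" shows "dcube k x \<subseteq> dcube l x"
proof
  fix y assume y: "y \<in> dcube k x"
  have "\<lfloor>z / 2 powi l\<rfloor> = \<lfloor>z / 2 powi k\<rfloor> div 2 ^ nat (l - k)" for z :: real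
  proof -
    have "(2::real) powi l = 2 powi k * real_of_int (2 ^ nat (l - k))"
      using assms by (simp flip: power_int_add power_int_of_nat)
    then show ?thesis
      using floor_divide_real_eq_div[of "2 ^ nat (l - k)" "z / 2 powi k"] by simp
  qed
  then show "y \<in> dcube l x" using y by (simp add: dcube_def)
qed

lemma mem_dcubesE:
  assumes "Q \<in> dcubes" "y \<in> Q"
  obtains k where "Q = dcube k y"
  using assms dcube_eq by fastforce

lemma dcubes_nested:
  assumes "Q \<in> dcubes" "R \<in> dcubes" "x \<in> Q" "x \<in> R"
  shows "Q \<subseteq> R \<or> R \<subseteq> Q"
proof -
  obtain k where "Q = dcube k x" using assms mem_dcubesE by metis
  moreover obtain l where "R = dcube l x" using assms mem_dcubesE by metis
  ultimately show ?thesis using dcube_mono[of k l x] dcube_mono[of l k x] by (meson linear)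
qed

definition dcorner :: "int \<Rightarrow> real^'n \<Rightarrow> real^'n"
  where "dcorner k x = (\<chi> i. 2 powi k * of_int \<lfloor>x $ i / 2 powi k\<rfloor>)"

lemma mem_dcube_iff:
  "y \<in> dcube k x \<longleftrightarrow> (\<forall>i. dcorner k x $ i \<le> y $ i \<and> y $ i < dcorner k x $ i + 2 powi k)"
proof -
  have "\<lfloor>a / 2 powi k\<rfloor> = m \<longleftrightarrow> 2 powi k * of_int m \<le> a \<and> a < 2 powi k * of_int m + 2 powi k" for a :: real and m
    by (subst floor_eq_iff) (simp add: field_simps)
  then show ?thesis by (simp add: dcube_def dcorner_def)
qed

lemma dcube_subset_cbox: "dcube k x \<subseteq> cbox (dcorner k x) (dcorner k x + (\<chi> i. 2 powi k))"
  by (auto simp: mem_dcube_iff mem_box_cart less_imp_le)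

lemma box_subset_dcube: "box (dcorner k x) (dcorner k x + (\<chi> i. 2 powi k)) \<subseteq> dcube k x"
  by (auto simp: mem_dcube_iff mem_box_cart less_imp_le)

lemma content_cube:
  fixes a b :: "real^'n"
  assumes "\<And>i. b $ i - a $ i = l" "l > 0"
  shows "emeasure lborel (cbox a b) = ennreal (l ^ CARD('n))"
proof -
  have "(\<Prod>i\<in>UNIV. b $ i - a $ i) = l ^ CARD('n)" using assms by simp
  moreover have "cbox a b \<noteq> {}" using assms
    by (auto simp: interval_ne_empty_cart) (metis diff_ge_0_iff_ge less_imp_le)
  ultimately have "measure lborel (cbox a b) = l ^ CARD('n)" by (simp add: content_cbox_cart)
  then show ?thesis by (metis emeasure_eq_ennreal_measure emeasure_lborel_cbox_finite less_irrefl infinity_ennreal_def)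
qed

lemma dcube_borel: "(dcube k x :: (real^'n) set) \<in> sets borel"
proof -
  have "dcube k x = (\<Inter>i. {y :: real^'n. \<lfloor>y $ i / 2 powi k\<rfloor> = \<lfloor>x $ i / 2 powi k\<rfloor>})"
    by (simp add: dcube_def Collect_all_eq)
  also have "\<dots> \<in> sets borel"
  proof (intro sets.countable_INT'')
    fix i
    have "(\<lambda>y :: real^'n. \<lfloor>y $ i / 2 powi k\<rfloor>) \<in> measurable borel (count_space UNIV)"
      by measurable
    from measurable_sets[OF this, of "{\<lfloor>x $ i / 2 powi k\<rfloor>}"]
    show "{y :: real^'n. \<lfloor>y $ i / 2 powi k\<rfloor> = \<lfloor>x $ i / 2 powi k\<rfloor>} \<in> sets borel"
      by (simp add: vimage_def)
  qed auto
  finally show ?thesis .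
qed

lemma dcube_sets[measurable, simp]: "dcube k x \<in> sets lebesgue"
  by (metis dcube_borel sets_lborel sets_completionI_sets)

lemma emeasure_cbox_dcube:
  "emeasure lebesgue (cbox (dcorner k x) (dcorner k x + (\<chi> i. 2 powi k)) :: (real^'n) set)
     = ennreal ((2 powi k) ^ CARD('n))"
  using content_cube[of "dcorner k x + (\<chi> i. 2 powi k)" "dcorner k x" "2 powi k"] by simp

lemma emeasure_dcube:
  "emeasure lebesgue (dcube k x :: (real^'n) set) = ennreal ((2 powi k) ^ CARD('n))"
proof (rule antisym)
  let ?a = "dcorner k x" and ?b = "dcorner k x + (\<chi> i. 2 powi k)"
  show "emeasure lebesgue (dcube k x) \<le> ennreal ((2 powi k) ^ CARD('n))"
    unfolding emeasure_cbox_dcube[of k x, symmetric] by (rule emeasure_mono[OF dcube_subset_cbox]) simp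
  have "emeasure lborel (box ?a ?b) = emeasure lborel (cbox ?a ?b)"
    by (simp add: emeasure_lborel_box_eq emeasure_lborel_cbox_eq)
  then have "ennreal ((2 powi k) ^ CARD('n)) = emeasure lebesgue (box ?a ?b)"
    using emeasure_cbox_dcube[of k x] by simp
  also have "\<dots> \<le> emeasure lebesgue (dcube k x)"
    by (rule emeasure_mono[OF box_subset_dcube]) simp
  finally show "ennreal ((2 powi k) ^ CARD('n)) \<le> emeasure lebesgue (dcube k x)" .
qed

lemma emeasure_dcube_parent:
  "emeasure lebesgue (dcube (k + 1) x :: (real^'n) set) = 2 ^ CARD('n) * emeasure lebesgue (dcube k x)"
  by (simp add: emeasure_dcube power_int_add power_mult_distrib mult.commute ennreal_mult' flip: ennreal_power)

text \<open>The indexing of \<open>dcubes\<close> by points is far from injective; the scale and the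
  vector of integer parts already determine the cube.\<close>

lemma countable_dcubes: "countable (dcubes :: (real^'n) set set)"
proof -
  have c: "countable (UNIV :: ('n \<Rightarrow> int) set)"
    using countable_PiE[of "UNIV :: 'n set" "\<lambda>_. UNIV :: int set"] by (simp add: PiE_UNIV_domain)
  have "countable ((UNIV :: int set) \<times> (UNIV :: ('n \<Rightarrow> int) set))"
    by (rule countable_SIGMA[OF _ c]) simp
  then have "countable ((\<lambda>(k, m). {y :: real^'n. \<forall>i. \<lfloor>y $ i / 2 powi k\<rfloor> = m i}) ` (UNIV \<times> UNIV))"
    by (rule countable_image)
  moreover have "dcubes \<subseteq> (\<lambda>(k, m). {y :: real^'n. \<forall>i. \<lfloor>y $ i / 2 powi k\<rfloor> = m i}) ` (UNIV \<times> UNIV)"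
  proof
    fix Q :: "(real^'n) set" assume "Q \<in> dcubes"
    then obtain k x where "Q = dcube k x" by auto
    then show "Q \<in> (\<lambda>(k, m). {y. \<forall>i. \<lfloor>y $ i / 2 powi k\<rfloor> = m i}) ` (UNIV \<times> UNIV)"
      by (intro image_eqI[of _ _ "(k, \<lambda>i. \<lfloor>x $ i / 2 powi k\<rfloor>)"]) (simp_all add: dcube_def)
  qed
  ultimately show ?thesis by (rule countable_subset[rotated])
qed

lemma small_dcube_in_open:
  fixes U :: "(real^'n) set"
  assumes "open U" "x \<in> U"
  obtains k where "k \<le> 0" "dcube k x \<subseteq> U"
proof -
  obtain e where e: "e > 0" "ball x e \<subseteq> U" using assms open_contains_ball by blast
  define n where "n = real CARD('n)"
  have n: "n > 0" by (simp add: n_def)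
  \<comment> \<open>Side below e / n, because the Euclidean norm is at most the sum of the n
    coordinates.\<close>
  obtain j :: nat where j: "(1/2) ^ j < e / n"
    using real_arch_pow_inv[of "e / n" "1/2"] e n by auto
  have pj: "(2::real) powi (- int j) = (1/2) ^ j" by (simp add: power_int_minus power_one_over inverse_eq_divide)
  have "dcube (- int j) x \<subseteq> U"
  proof
    fix y assume y: "y \<in> dcube (- int j) x"
    have "\<bar>(y - x) $ i\<bar> \<le> (1/2) ^ j" for i
      using y[unfolded mem_dcube_iff, rule_format, of i] self_in_dcube[of x "- int j", unfolded mem_dcube_iff, rule_format, of i]
      by (simp add: pj) linarith
    then have "norm (y - x) \<le> (\<Sum>i\<in>(UNIV::'n set). (1/2) ^ j)"
      by (intro order_trans[OF norm_le_l1_cart] sum_mono) auto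
    also have "\<dots> < e" using j n by (simp add: n_def field_simps)
    finally show "y \<in> U" using e by (auto simp: dist_norm norm_minus_commute)
  qed
  then show thesis using that[of "- int j"] by simp
qed

lemma powi2_unbounded: "\<exists>k::int. (c::real) < 2 powi k"
proof -
  obtain n where "c < 2 ^ n" using real_arch_pow[of 2 c] by auto
  then have "c < 2 powi (int n)" by simp
  then show ?thesis by blast
qed

section \<open>Maximal dyadic cubes\<close>

definition maximal_in :: "'a set set \<Rightarrow> 'a set set"
  where "maximal_in \<G> = {Q \<in> \<G>. \<forall>R\<in>\<G>. Q \<subseteq> R \<longrightarrow> R = Q}"

text \<open>By comparison of volumes. Two descriptions of one cube thus have the same scale, and a
  cube never equals its parent.\<close>

lemma dcube_scale_unique:
  "(dcube k x :: (real^'n) set) \<subseteq> dcube l y \<Longrightarrow> k \<le> l"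
proof -
  assume "dcube k x \<subseteq> dcube l y"
  then have "emeasure lebesgue (dcube k x) \<le> emeasure lebesgue (dcube l y)"
    by (intro emeasure_mono) auto
  then have "((2::real) powi k) ^ CARD('n) \<le> (2 powi l) ^ CARD('n)"
    by (simp add: emeasure_dcube)
  then have "(2::real) powi k \<le> 2 powi l" by (simp add: power_mono_iff)
  then show "k \<le> l" by (meson not_le one_less_numeral_iff power_int_strict_increasing semiring_norm(76))
qed

text \<open>The dyadic cubes containing a fixed point x of Q form the chain
  \<open>dcube l x\<close>. The scales of the members of the family above Q lie between that of Q
  and K, and the largest of them gives R.\<close>

lemma maximal_in_dcubes_cover:
  assumes G: "\<G> \<subseteq> (dcubes :: (real^'n) set set)" and V: "\<And>k x. dcube k x \<in> \<G> \<Longrightarrow> k \<le> K"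
    and Q: "Q \<in> \<G>"
  obtains R where "R \<in> maximal_in \<G>" "Q \<subseteq> R"
proof -
  obtain k x where kx: "Q = dcube k x" using Q G by auto
  define S where "S = {l. k \<le> l \<and> dcube l x \<in> \<G>}"
  have "S \<subseteq> {k..K}" using V by (auto simp: S_def)
  then have fin: "finite S" by (rule finite_subset) simp
  have ne: "k \<in> S" using Q kx by (simp add: S_def)
  define m where "m = Max S"
  have m: "m \<in> S" using fin ne unfolding m_def by (intro Max_in) auto
  have "R = dcube m x" if R: "R \<in> \<G>" "dcube m x \<subseteq> R" for R
  proof -
    have "x \<in> R" using R(2) self_in_dcube[of x m] by (rule subsetD)
    obtain l where l: "R = dcube l x"
      by (rule mem_dcubesE[OF subsetD[OF G R(1)] \<open>x \<in> R\<close>])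
    have "m \<le> l" using R(2) unfolding l by (rule dcube_scale_unique)
    then have "l \<in> S" using m R l by (simp add: S_def)
    then have "l \<le> m" using fin by (simp add: m_def)
    then show ?thesis using \<open>m \<le> l\<close> l by simp
  qed
  then have "dcube m x \<in> maximal_in \<G>" using m by (simp add: maximal_in_def S_def)
  moreover have "Q \<subseteq> dcube m x" using m kx by (simp add: S_def dcube_mono)
  ultimately show thesis using that by blast
qed

lemma maximal_in_dcubes_disjoint:
  assumes "\<G> \<subseteq> dcubes"
  shows "disjoint (maximal_in \<G>)"
proof (rule disjointI)
  fix Q R assume QR: "Q \<in> maximal_in \<G>" "R \<in> maximal_in \<G>" "Q \<noteq> R"
  show "Q \<inter> R = {}"
  proof (rule ccontr)
    assume "Q \<inter> R \<noteq> {}"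
    then obtain x where "x \<in> Q" "x \<in> R" by blast
    then have "Q \<subseteq> R \<or> R \<subseteq> Q" using dcubes_nested[of Q R x] QR assms by (auto simp: maximal_in_def)
    then show False using QR by (auto simp: maximal_in_def)
  qed
qed

lemma countable_dcubes_subset: "\<M> \<subseteq> (dcubes :: (real^'n) set set) \<Longrightarrow> countable \<M>"
  using countable_dcubes countable_subset by blast

lemma dcubes_sets: "Q \<in> dcubes \<Longrightarrow> Q \<in> sets lebesgue" by auto

lemma Union_dcubes_sets: "\<M> \<subseteq> (dcubes :: (real^'n) set set) \<Longrightarrow> \<Union>\<M> \<in> sets lebesgue"
  using countable_dcubes_subset[of \<M>] by (intro sets.countable_Union) auto

section \<open>Integrals over countable disjoint unions\<close>

lemma superlevel_sets:
  fixes g :: "'a \<Rightarrow> real"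
  assumes [measurable]: "g \<in> borel_measurable M" shows "{x \<in> space M. t < g x} \<in> sets M"
  by measurable

text \<open>Countable additivity of the measure with density v.\<close>

lemma set_nn_integral_disjoint_Union:
  assumes "countable \<M>" "disjoint \<M>" "\<M> \<subseteq> sets M" "v \<in> borel_measurable M"
  shows "(\<integral>\<^sup>+x\<in>\<Union>\<M>. v x \<partial>M) = (\<integral>\<^sup>+Q. (\<integral>\<^sup>+x\<in>Q. v x \<partial>M) \<partial>count_space \<M>)"
proof -
  have "emeasure (density M v) (\<Union>Q\<in>\<M>. Q) = (\<integral>\<^sup>+Q. emeasure (density M v) Q \<partial>count_space \<M>)"
    using assms by (intro emeasure_UN_countable) (auto simp: disjoint_family_on_def disjoint_def)
  also have "\<dots> = (\<integral>\<^sup>+Q. (\<integral>\<^sup>+x\<in>Q. v x \<partial>M) \<partial>count_space \<M>)"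
    using assms by (intro nn_integral_cong) (auto simp: emeasure_density)
  finally show ?thesis using assms by (simp add: emeasure_density sets.countable_Union)
qed

lemma set_nn_integral_Union_mono:
  assumes "countable \<M>" "disjoint \<M>" "\<M> \<subseteq> sets M" "v \<in> borel_measurable M" "v' \<in> borel_measurable M"
    and "\<And>Q. Q \<in> \<M> \<Longrightarrow> (\<integral>\<^sup>+x\<in>Q. v x \<partial>M) \<le> (\<integral>\<^sup>+x\<in>Q. v' x \<partial>M)"
  shows "(\<integral>\<^sup>+x\<in>\<Union>\<M>. v x \<partial>M) \<le> (\<integral>\<^sup>+x\<in>\<Union>\<M>. v' x \<partial>M)"
  unfolding set_nn_integral_disjoint_Union[OF assms(1-4)] set_nn_integral_disjoint_Union[OF assms(1-3,5)]
  using assms(6) by (subst nn_integral_mono) simp_all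

section \<open>Calderon-Zygmund decomposition\<close>

declare emeasure_completion [simp del]

lemma dcube_in_dcubes[simp]: "dcube k x \<in> dcubes"
  by (rule image_eqI[of _ _ "(k, x)"]) simp_all

text \<open>A one-sided Lebesgue differentiation theorem, obtained by covering \<open>S\<close> by dyadic cubes inside an open
  set of almost the same measure.\<close>

lemma dyadic_density_null:
  fixes u :: "real^'n \<Rightarrow> ennreal"
  assumes u[measurable]: "u \<in> borel_measurable lebesgue" and S[measurable]: "S \<in> sets lebesgue"
    and fin: "emeasure lebesgue S < \<infinity>" and l: "0 \<le> l" "l < m"
    and ge: "\<And>x. x \<in> S \<Longrightarrow> ennreal m \<le> u x"
    and avg: "\<And>x k. x \<in> S \<Longrightarrow> (\<integral>\<^sup>+y\<in>dcube k x. u y \<partial>lebesgue) \<le> ennreal l * emeasure lebesgue (dcube k x)"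
  shows "emeasure lebesgue S = 0"
proof -
  have main: "ennreal m * emeasure lebesgue S \<le> ennreal l * (emeasure lebesgue S + ennreal e)" if e: "e > 0" for e
  proof -
    obtain U where U: "open U" "S \<subseteq> U" "U - S \<in> lmeasurable" "emeasure lebesgue (U - S) < ennreal e"
      using sets_lebesgue_outer_open[OF S e] by blast
    define \<G> where "\<G> = {dcube k x |k x. x \<in> S \<and> k \<le> 0 \<and> dcube k x \<subseteq> U}"
    have G: "\<G> \<subseteq> dcubes" unfolding \<G>_def by auto
    have K: "k \<le> 0" if kx: "dcube k x \<in> \<G>" for k x
    proof -
      obtain k' x' where "dcube k x = dcube k' x'" "k' \<le> 0" using kx unfolding \<G>_def by blast
      then show ?thesis using dcube_scale_unique[of k x k' x'] by simp
    qed
    let ?M = "maximal_in \<G>"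
    have M: "?M \<subseteq> dcubes" "?M \<subseteq> \<G>" using G by (auto simp: maximal_in_def)
    note cM = countable_dcubes_subset[OF M(1)] maximal_in_dcubes_disjoint[OF G]
    have sM: "?M \<subseteq> sets lebesgue" using M(1) dcubes_sets by blast
    have SM: "S \<subseteq> \<Union>?M"
    proof
      fix x assume x: "x \<in> S"
      then obtain k where k: "k \<le> 0" "dcube k x \<subseteq> U" using small_dcube_in_open[OF U(1)] U(2) by blast
      then have "dcube k x \<in> \<G>" using x unfolding \<G>_def by blast
      then obtain R where "R \<in> ?M" "dcube k x \<subseteq> R"
        using maximal_in_dcubes_cover[OF G, of 0] K by blast
      then show "x \<in> \<Union>?M" using self_in_dcube by blast
    qed
    have UM: "\<Union>?M \<subseteq> U" using M(2) unfolding \<G>_def by blast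
    have [measurable]: "\<Union>?M \<in> sets lebesgue" by (rule Union_dcubes_sets[OF M(1)])
    have "ennreal m * emeasure lebesgue S = (\<integral>\<^sup>+x\<in>S. ennreal m \<partial>lebesgue)"
      by (simp add: nn_integral_cmult_indicator)
    also have "\<dots> \<le> (\<integral>\<^sup>+x\<in>\<Union>?M. u x \<partial>lebesgue)"
      using ge SM by (intro nn_integral_mono) (auto simp: indicator_def)
    also have "\<dots> \<le> (\<integral>\<^sup>+x\<in>\<Union>?M. ennreal l \<partial>lebesgue)"
    proof (rule set_nn_integral_Union_mono[OF cM sM u])
      fix Q assume "Q \<in> ?M"
      then obtain k x where "Q = dcube k x" "x \<in> S" using M(2) unfolding \<G>_def by blast
      then show "(\<integral>\<^sup>+x\<in>Q. u x \<partial>lebesgue) \<le> (\<integral>\<^sup>+x\<in>Q. ennreal l \<partial>lebesgue)"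
        using avg by (simp add: nn_integral_cmult_indicator)
    qed simp
    also have "\<dots> = ennreal l * emeasure lebesgue (\<Union>?M)"
      by (simp add: nn_integral_cmult_indicator)
    also have "\<dots> \<le> ennreal l * emeasure lebesgue (S \<union> (U - S))"
      using UM U by (intro mult_left_mono emeasure_mono) auto
    also have "\<dots> \<le> ennreal l * (emeasure lebesgue S + emeasure lebesgue (U - S))"
      using U by (intro mult_left_mono emeasure_subadditive) auto
    also have "\<dots> \<le> ennreal l * (emeasure lebesgue S + ennreal e)"
      using U by (intro mult_left_mono add_left_mono) auto
    finally show ?thesis .
  qed
  obtain s where s: "emeasure lebesgue S = ennreal s" "s \<ge> 0"
    using fin by (cases "emeasure lebesgue S") auto
  show ?thesis
  proof (rule ccontr)
    assume "emeasure lebesgue S \<noteq> 0"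
    then have "s > 0" using s by (metis ennreal_0 less_eq_real_def)
    \<comment> \<open>Chosen so that l e < (m - l) s, which contradicts the covering estimate; l + 1
      instead of l allows l = 0.\<close>
    define e where "e = (m - l) * s / (l + 1)"
    have "e > 0" using \<open>s > 0\<close> l by (simp add: e_def)
    have "ennreal (m * s) \<le> ennreal (l * (s + e))"
      using main[OF \<open>e > 0\<close>] s \<open>e > 0\<close> l by (simp add: ennreal_mult' flip: ennreal_plus)
    then have "m * s \<le> l * (s + e)" using \<open>s > 0\<close> \<open>e > 0\<close> l by (simp add: ennreal_le_iff)
    moreover have "l * e < (m - l) * s"
      using \<open>s > 0\<close> l by (simp add: e_def field_simps)
    ultimately show False by (simp add: algebra_simps)
  qed
qed

text \<open>The exceptional set is a countable union of pieces \<open>S i j\<close> of finite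
  measure on which u exceeds l by a fixed amount; each of them is null by the preceding
  lemma.\<close>

lemma dyadic_density:
  fixes u :: "real^'n \<Rightarrow> ennreal"
  assumes u[measurable]: "u \<in> borel_measurable lebesgue" and N[measurable]: "N \<in> sets lebesgue"
    and l: "0 \<le> l"
    and avg: "\<And>x k. x \<in> N \<Longrightarrow> (\<integral>\<^sup>+y\<in>dcube k x. u y \<partial>lebesgue) \<le> ennreal l * emeasure lebesgue (dcube k x)"
  shows "AE x in lebesgue. x \<in> N \<longrightarrow> u x \<le> ennreal l"
proof -
  define S where "S i j = {x \<in> N. ennreal (l + 1 / real (Suc i)) \<le> u x} \<inter> cball 0 (real j)" for i j :: nat
  have [measurable]: "S i j \<in> sets lebesgue" for i j
    unfolding S_def by (intro sets.Int) (measurable, simp)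
  have "emeasure lebesgue (S i j) = 0" for i j
  proof (rule dyadic_density_null[OF u])
    have "emeasure lebesgue (S i j) \<le> emeasure lebesgue (cball 0 (real j) :: (real^'n) set)"
      by (intro emeasure_mono) (auto simp: S_def)
    also have "\<dots> < \<infinity>" using lmeasurable_cball[of 0 "real j"] by (simp add: fmeasurable_def)
    finally show "emeasure lebesgue (S i j) < \<infinity>" .
    show "l < l + 1 / real (Suc i)" by simp
  qed (use l avg in \<open>auto simp: S_def\<close>)
  then have "AE x in lebesgue. x \<notin> S i j" for i j
    by (simp add: AE_iff_null null_sets_def)
  then have "AE x in lebesgue. \<forall>i j. x \<notin> S i j" by (simp add: AE_all_countable)
  then show ?thesis
  proof eventually_elim
    case (elim x)
    show ?case
    proof (rule impI, rule ccontr)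
      assume x: "x \<in> N" "\<not> u x \<le> ennreal l"
      obtain j where "norm x \<le> real j" using real_arch_simple by blast
      moreover obtain i where "ennreal (l + 1 / real (Suc i)) \<le> u x"
      proof (cases "u x")
        case (real r)
        then have "l < r" using x l by (auto simp: ennreal_le_iff not_le)
        then obtain i where "inverse (real (Suc i)) < r - l" using reals_Archimedean[of "r - l"] by auto
        then show thesis using real that[of i] by (simp add: inverse_eq_divide)
      next
        case top then show thesis using that[of 0] by simp
      qed
      ultimately have "x \<in> S i j" using x by (simp add: S_def)
      then show False using elim by blast
    qed
  qed
qed

text \<open>For integrable u and l > 0 the union of these cubes is the set where the dyadic maximal
  function of u exceeds l. The measure of the cube is multiplied out, which avoids division in
  \<open>ennreal\<close>.\<close>

definition cz :: "(real^'n \<Rightarrow> ennreal) \<Rightarrow> real \<Rightarrow> (real^'n) set set"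
  where "cz u l = maximal_in {Q \<in> dcubes. ennreal l * emeasure lebesgue Q < (\<integral>\<^sup>+x\<in>Q. u x \<partial>lebesgue)}"

lemma cz_dcubes: "cz u l \<subseteq> dcubes" by (auto simp: cz_def maximal_in_def)
lemma cz_disjoint: "disjoint (cz u l)" unfolding cz_def by (rule maximal_in_dcubes_disjoint) auto
lemma cz_countable: "countable (cz u l)" by (rule countable_dcubes_subset[OF cz_dcubes])
lemma cz_sets: "cz u l \<subseteq> sets lebesgue" using cz_dcubes dcubes_sets by blast
lemma cz_Union_sets[measurable]: "\<Union>(cz u l) \<in> sets lebesgue" by (rule Union_dcubes_sets[OF cz_dcubes])

lemma cz_lower: "Q \<in> cz u l \<Longrightarrow> ennreal l * emeasure lebesgue Q < (\<integral>\<^sup>+x\<in>Q. u x \<partial>lebesgue)"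
  by (simp add: cz_def maximal_in_def)

text \<open>Maximality of Q excludes its dyadic parent, whose average is therefore at most l and
  whose measure is 2^n times that of Q.\<close>

lemma cz_upper:
  fixes u :: "real^'n \<Rightarrow> ennreal"
  assumes "Q \<in> cz u l"
  shows "(\<integral>\<^sup>+x\<in>Q. u x \<partial>lebesgue) \<le> 2 ^ CARD('n) * ennreal l * emeasure lebesgue Q"
proof -
  have "Q \<in> dcubes" using assms cz_dcubes by (rule subsetD[rotated])
  then obtain k x where Q: "Q = dcube k x" by auto
  have sub: "dcube k x \<subseteq> dcube (k + 1) x" by (rule dcube_mono) simp
  have "dcube (k + 1) x \<noteq> dcube k x" using dcube_scale_unique[of "k + 1" x k x] by auto
  then have "\<not> ennreal l * emeasure lebesgue (dcube (k + 1) x) < (\<integral>\<^sup>+x\<in>dcube (k + 1) x. u x \<partial>lebesgue)"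
  proof (rule contrapos_nn)
    assume big: "ennreal l * emeasure lebesgue (dcube (k + 1) x) < (\<integral>\<^sup>+x\<in>dcube (k + 1) x. u x \<partial>lebesgue)"
    have "\<forall>R\<in>{Q \<in> dcubes. ennreal l * emeasure lebesgue Q < (\<integral>\<^sup>+x\<in>Q. u x \<partial>lebesgue)}. Q \<subseteq> R \<longrightarrow> R = Q"
      using assms unfolding cz_def maximal_in_def by (elim CollectE conjE)
    from bspec[OF this, of "dcube (k + 1) x"] big sub
    show "dcube (k + 1) x = dcube k x" unfolding Q by (simp only: mem_Collect_eq dcube_in_dcubes simp_thms)
  qed
  then have "(\<integral>\<^sup>+x\<in>dcube (k + 1) x. u x \<partial>lebesgue) \<le> 2 ^ CARD('n) * ennreal l * emeasure lebesgue Q"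
    unfolding not_less Q emeasure_dcube_parent by (simp add: ac_simps)
  moreover have "(\<integral>\<^sup>+x\<in>Q. u x \<partial>lebesgue) \<le> (\<integral>\<^sup>+x\<in>dcube (k + 1) x. u x \<partial>lebesgue)"
    using sub by (intro nn_integral_mono) (auto simp: Q indicator_def)
  ultimately show ?thesis by (rule order_trans[rotated])
qed

text \<open>A cube with average above l has measure below the integral of u divided by l. The scales
  of the competing cubes are thus bounded above, and maximal ones exist.\<close>

lemma cz_cover:
  fixes u :: "real^'n \<Rightarrow> ennreal"
  assumes fin: "(\<integral>\<^sup>+x. u x \<partial>lebesgue) < \<infinity>" and l: "0 < l"
    and R: "R \<in> dcubes" "ennreal l * emeasure lebesgue R < (\<integral>\<^sup>+x\<in>R. u x \<partial>lebesgue)"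
  obtains Q where "Q \<in> cz u l" "R \<subseteq> Q"
proof -
  let ?G = "{Q \<in> dcubes. ennreal l * emeasure lebesgue Q < (\<integral>\<^sup>+x\<in>Q. u x \<partial>lebesgue)}"
  obtain I where I: "(\<integral>\<^sup>+x. u x \<partial>lebesgue) = ennreal I" "I \<ge> 0"
    using fin by (cases "\<integral>\<^sup>+x. u x \<partial>lebesgue") auto
  obtain K0 where K0: "I / l < 2 powi K0" using powi2_unbounded by blast
  \<comment> \<open>Nonnegative, so that a larger cube has side at least 1 and hence side at most
    its volume.\<close>
  define K where "K = max 0 K0"
  have K: "I / l < 2 powi K" "0 \<le> K"
    using K0 power_int_increasing[of K0 K "2::real"] by (auto simp: K_def)
  have "k \<le> K" if k: "dcube k x \<in> ?G" for k and x :: "real^'n"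
  proof (rule ccontr)
    assume "\<not> k \<le> K"
    then have "(2::real) powi K \<le> 2 powi k" by (intro power_int_increasing) auto
    moreover have "1 \<le> (2::real) powi k" using \<open>\<not> k \<le> K\<close> K by simp
    then have "(2::real) powi k \<le> (2 powi k) ^ CARD('n)" by (intro self_le_power) auto
    ultimately have "I < l * (2 powi k) ^ CARD('n)" using K l by (simp add: field_simps) (smt (verit) mult_left_mono)
    have "ennreal (l * (2 powi k) ^ CARD('n)) < (\<integral>\<^sup>+x\<in>dcube k x. u x \<partial>lebesgue)"
      using k l by (simp add: emeasure_dcube ennreal_mult')
    also have "\<dots> \<le> ennreal I"
      unfolding I(1)[symmetric] by (intro nn_integral_mono) (auto simp: indicator_def)
    finally have "l * (2 powi k) ^ CARD('n) < I" using I l by (simp add: ennreal_less_iff)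
    then show False using \<open>I < l * (2 powi k) ^ CARD('n)\<close> by simp
  qed
  note K' = this
  have G: "?G \<subseteq> dcubes" by (rule Collect_restrict)
  have RG: "R \<in> ?G" using R by (intro CollectI conjI)
  show thesis
    by (rule maximal_in_dcubes_cover[OF G _ RG, folded cz_def], erule K', rule that)
qed

text \<open>No dyadic cube through a point outside the union has average above l, so the
  differentiation theorem applies on the complement.\<close>

lemma cz_AE_le:
  fixes u :: "real^'n \<Rightarrow> ennreal"
  assumes u: "u \<in> borel_measurable lebesgue"
    and fin: "(\<integral>\<^sup>+x. u x \<partial>lebesgue) < \<infinity>" and l: "0 < l"
  shows "AE x in lebesgue. x \<notin> \<Union>(cz u l) \<longrightarrow> u x \<le> ennreal l"
proof -
  have "AE x in lebesgue. x \<in> - \<Union>(cz u l) \<longrightarrow> u x \<le> ennreal l"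
  proof (rule dyadic_density[OF u])
    fix x k assume x: "x \<in> - \<Union>(cz u l)"
    show "(\<integral>\<^sup>+y\<in>dcube k x. u y \<partial>lebesgue) \<le> ennreal l * emeasure lebesgue (dcube k x)"
    proof (rule ccontr)
      assume "\<not> ?thesis"
      then have "ennreal l * emeasure lebesgue (dcube k x) < (\<integral>\<^sup>+y\<in>dcube k x. u y \<partial>lebesgue)"
        by (simp only: not_le)
      then obtain Q where "Q \<in> cz u l" "dcube k x \<subseteq> Q"
        using cz_cover[OF fin l, of "dcube k x"] by (metis rangeI case_prod_conv)
      then show False using x self_in_dcube[of x k] by blast
    qed
  qed (use l cz_Union_sets[of u l] in \<open>simp_all add: Compl_in_sets_lebesgue del: Union_iff\<close>)
  then show ?thesis by simp
qed

section \<open>Reverse Hoelder inequality for Muckenhoupt weights\<close>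

text \<open>The condition M w \<le> c w a.e., with the averages multiplied out and a single null set
  for all cubes. The weight is finite everywhere and may vanish.\<close>

definition A1 :: "real \<Rightarrow> (real^'n \<Rightarrow> real) \<Rightarrow> bool"
  where "A1 c w \<longleftrightarrow> w \<in> borel_measurable lebesgue \<and> (\<forall>x. 0 \<le> w x) \<and>
    (AE x in lebesgue. \<forall>Q\<in>cubes. x \<in> Q \<longrightarrow>
       (\<integral>\<^sup>+y\<in>Q. ennreal (w y) \<partial>lebesgue) \<le> ennreal (c * w x) * emeasure lebesgue Q)"

text \<open>A half-open dyadic cube and its closure have the same measure. This carries conditions
  stated for the closed cubes in \<open>cubes\<close> over to dyadic ones.\<close>

lemma dcube_in_cube:
  obtains Q where "Q \<in> cubes" "dcube k x \<subseteq> Q" "emeasure lebesgue Q = emeasure lebesgue (dcube k x)"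
proof (rule that)
  show "cbox (dcorner k x) (dcorner k x + (\<chi> i. 2 powi k)) \<in> cubes"
    unfolding cubes_def by (rule CollectI, intro exI conjI, rule refl) (auto intro: exI[of _ "2 powi k"])
qed (simp_all only: dcube_subset_cbox emeasure_cbox_dcube emeasure_dcube)

lemma A1_dcube:
  fixes w :: "real^'n \<Rightarrow> real"
  assumes "A1 c w"
  shows "AE x in lebesgue. \<forall>R\<in>dcubes. x \<in> R \<longrightarrow>
    (\<integral>\<^sup>+y\<in>R. ennreal (w y) \<partial>lebesgue) \<le> ennreal (c * w x) * emeasure lebesgue R"
proof -
  have "AE x in lebesgue. \<forall>Q\<in>cubes. x \<in> Q \<longrightarrow>
       (\<integral>\<^sup>+y\<in>Q. ennreal (w y) \<partial>lebesgue) \<le> ennreal (c * w x) * emeasure lebesgue Q"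
    using assms by (simp add: A1_def)
  then show ?thesis
  proof eventually_elim
    case (elim x)
    show ?case
    proof (intro ballI impI)
      fix R :: "(real^'n) set" assume R: "R \<in> dcubes" "x \<in> R"
      then obtain k z where kz: "R = dcube k z" by auto
      obtain Q where Q: "Q \<in> cubes" "dcube k z \<subseteq> Q" "emeasure lebesgue Q = emeasure lebesgue (dcube k z)"
        by (rule dcube_in_cube)
      have "(\<integral>\<^sup>+y\<in>R. ennreal (w y) \<partial>lebesgue) \<le> (\<integral>\<^sup>+y\<in>Q. ennreal (w y) \<partial>lebesgue)"
        using Q by (intro nn_integral_mono) (auto simp: kz indicator_def)
      also have "\<dots> \<le> ennreal (c * w x) * emeasure lebesgue Q"
        using bspec[OF elim Q(1)] Q(2) R(2) kz by (simp only: subsetD simp_thms)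
      finally show "(\<integral>\<^sup>+y\<in>R. ennreal (w y) \<partial>lebesgue) \<le> ennreal (c * w x) * emeasure lebesgue R"
        using Q kz by simp
    qed
  qed
qed

lemma dcube_measure_obtain:
  fixes R :: "(real^'n) set"
  assumes "R \<in> dcubes"
  obtains r where "emeasure lebesgue R = ennreal r" "0 < r"
proof -
  obtain k z where "R = dcube k z" using assms by auto
  then show thesis using that[of "(2 powi k) ^ CARD('n)"] by (simp add: emeasure_dcube)
qed

lemma set_nn_integral_cmult_const:
  "A \<in> sets M \<Longrightarrow> (\<integral>\<^sup>+x\<in>A. c \<partial>M) = c * emeasure M A"
  by (simp add: nn_integral_cmult_indicator)

lemma set_nn_integral_mono_set:
  "A \<subseteq> B \<Longrightarrow> (\<integral>\<^sup>+x\<in>A. f x \<partial>M) \<le> (\<integral>\<^sup>+x\<in>B. f x \<partial>M)"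
  by (intro nn_integral_mono) (auto simp: indicator_def)

lemma set_nn_integral_split:
  assumes [measurable]: "f \<in> borel_measurable M" "A \<in> sets M" "B \<in> sets M"
  shows "(\<integral>\<^sup>+x\<in>A. f x \<partial>M) = (\<integral>\<^sup>+x\<in>A \<inter> B. f x \<partial>M) + (\<integral>\<^sup>+x\<in>A - B. f x \<partial>M)"
proof -
  have "(\<integral>\<^sup>+x\<in>A. f x \<partial>M) = (\<integral>\<^sup>+x. f x * indicator (A \<inter> B) x + f x * indicator (A - B) x \<partial>M)"
    by (intro nn_integral_cong) (auto simp: indicator_def)
  then show ?thesis by (simp add: nn_integral_add)
qed

text \<open>A selected cube must meet Q0, since u vanishes elsewhere, and cannot contain Q0, since
  its average would then be at most s \<le> l. Nestedness leaves only the claim.\<close>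

lemma cz_local:
  fixes u :: "real^'n \<Rightarrow> ennreal"
  assumes Q0: "Q0 \<in> dcubes" and le: "(\<integral>\<^sup>+x. u x \<partial>lebesgue) \<le> ennreal s * emeasure lebesgue Q0"
    and supp: "\<And>x. x \<notin> Q0 \<Longrightarrow> u x = 0" and s: "0 \<le> s" "s \<le> l" and R: "R \<in> cz u l"
  shows "R \<subseteq> Q0"
proof -
  have RD: "R \<in> dcubes" using R cz_dcubes by (rule subsetD[rotated])
  have big: "ennreal l * emeasure lebesgue R < (\<integral>\<^sup>+x\<in>R. u x \<partial>lebesgue)" by (rule cz_lower[OF R])
  have "R \<inter> Q0 \<noteq> {}"
  proof
    assume "R \<inter> Q0 = {}"
    then have "u x * indicator R x = 0" for x using supp by (auto simp: indicator_def)
    then show False using big by (simp only: nn_integral_0_iff_AE nn_integral_const mult_zero_left not_less_zero)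
  qed
  then consider "R \<subseteq> Q0" | "Q0 \<subseteq> R" using dcubes_nested[OF RD Q0] by auto
  then show ?thesis
  proof cases
    case 2
    have "(\<integral>\<^sup>+x\<in>R. u x \<partial>lebesgue) \<le> (\<integral>\<^sup>+x. u x \<partial>lebesgue)"
      by (intro nn_integral_mono) (auto simp: indicator_def)
    also have "\<dots> \<le> ennreal s * emeasure lebesgue R"
      by (rule order_trans[OF le mult_left_mono[OF emeasure_mono[OF 2 dcubes_sets[OF RD]]]]) simp
    also have "\<dots> \<le> ennreal l * emeasure lebesgue R" using s by (intro mult_right_mono ennreal_leI) auto
    finally show ?thesis using big by simp
  qed
qed

text \<open>The average over R' exceeds m \<ge> l, so R' lies in some selected cube of level l; by
  disjointness this is the one it meets.\<close>

lemma cz_levels: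
  fixes u :: "real^'n \<Rightarrow> ennreal"
  assumes fin: "(\<integral>\<^sup>+x. u x \<partial>lebesgue) < \<infinity>" and l: "0 < l" "l \<le> m"
    and R: "R \<in> cz u l" and R': "R' \<in> cz u m" and meet: "R \<inter> R' \<noteq> {}"
  shows "R' \<subseteq> R"
proof -
  have R'D: "R' \<in> dcubes" using R' cz_dcubes by (rule subsetD[rotated])
  have "ennreal l * emeasure lebesgue R' \<le> ennreal m * emeasure lebesgue R'"
    using l by (intro mult_right_mono ennreal_leI) auto
  also have "\<dots> < (\<integral>\<^sup>+x\<in>R'. u x \<partial>lebesgue)" by (rule cz_lower[OF R'])
  finally obtain S where S: "S \<in> cz u l" "R' \<subseteq> S"
    by (rule cz_cover[OF fin l(1) R'D])
  then have "S \<inter> R \<noteq> {}" using meet by blast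
  then have "S = R" using cz_disjoint[of u l] S R by (auto simp: disjoint_def)
  then show ?thesis using S by simp
qed

lemma suminf_ennreal_geometric:
  assumes "0 \<le> a" "0 \<le> q" "q < 1"
  shows "(\<Sum>i. ennreal (a * q ^ i)) = ennreal (a / (1 - q))"
proof -
  have "(\<lambda>i. a * q ^ i) sums (a * (1 / (1 - q)))"
    using assms by (intro sums_mult geometric_sums) simp
  then show ?thesis using assms by (intro suminf_ennreal_eq) auto
qed

text \<open>On a Calderon-Zygmund cube \<open>R\<close> the weight is at least \<open>1/c\<close> times its average, and at most half of
  \<open>R\<close> belongs to the next level, so a fixed proportion of the mass of \<open>R\<close> stays outside.\<close>

lemma A1_level_decay:
  fixes w :: "real^'n \<Rightarrow> real"
  assumes A1: "A1 c w" and c: "1 \<le> c" and Q0: "Q0 \<in> dcubes" and s: "0 < s"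
    and avg: "(\<integral>\<^sup>+y\<in>Q0. ennreal (w y) \<partial>lebesgue) \<le> ennreal s * emeasure lebesgue Q0"
    and l: "s \<le> l"
  defines "u \<equiv> \<lambda>y. ennreal (w y) * indicator Q0 y"
  shows "(\<integral>\<^sup>+y\<in>\<Union>(cz u (2 * 2 ^ CARD('n) * l)). u y \<partial>lebesgue)
     \<le> ennreal (1 - 1 / (2 * c)) * (\<integral>\<^sup>+y\<in>\<Union>(cz u l). u y \<partial>lebesgue)"
proof -
  \<comment> \<open>On a cube R of level l the average is at most 2^n l, so the cubes of level m
    inside R fill at most half of R.\<close>
  define m where "m = 2 * 2 ^ CARD('n) * l"
  have l0: "0 < l" using s l by simp
  have "1 * l \<le> m" unfolding m_def using l0 one_le_power[of "2::real" "CARD('n)"] by (intro mult_right_mono) linarith+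
  then have lm: "l \<le> m" "0 < m" using l0 by auto
  have [measurable]: "w \<in> borel_measurable lebesgue" and w0: "\<And>x. 0 \<le> w x" using A1 by (auto simp: A1_def)
  have Q0s[measurable]: "Q0 \<in> sets lebesgue" using Q0 dcubes_sets by blast
  have u[measurable]: "u \<in> borel_measurable lebesgue" unfolding u_def by measurable
  have uint: "(\<integral>\<^sup>+y. u y \<partial>lebesgue) \<le> ennreal s * emeasure lebesgue Q0" using avg by (simp add: u_def)
  obtain q where q: "emeasure lebesgue Q0 = ennreal q" "0 < q" using dcube_measure_obtain[OF Q0] by blast
  have ufin: "(\<integral>\<^sup>+y. u y \<partial>lebesgue) < \<infinity>"
    using uint q by (simp add: ennreal_mult_less_top le_less_trans[OF uint])
  let ?O = "\<Union>(cz u m)"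
  have Os[measurable]: "?O \<in> sets lebesgue" by (rule cz_Union_sets)
  have "?O \<subseteq> \<Union>(cz u l)"
  proof
    fix x assume "x \<in> ?O"
    then obtain R' where R': "R' \<in> cz u m" "x \<in> R'" by blast
    have R'D: "R' \<in> dcubes" using R'(1) cz_dcubes by (rule subsetD[rotated])
    have "ennreal l * emeasure lebesgue R' \<le> ennreal m * emeasure lebesgue R'"
      using lm by (intro mult_right_mono ennreal_leI) auto
    also have "\<dots> < (\<integral>\<^sup>+x\<in>R'. u x \<partial>lebesgue)" by (rule cz_lower[OF R'(1)])
    finally obtain S where "S \<in> cz u l" "R' \<subseteq> S" by (rule cz_cover[OF ufin l0 R'D])
    then show "x \<in> \<Union>(cz u l)" using R' by blast
  qed
  then have "(\<integral>\<^sup>+y\<in>?O. u y \<partial>lebesgue) = (\<integral>\<^sup>+y\<in>\<Union>(cz u l). (u y * indicator ?O y) \<partial>lebesgue)"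
    by (intro nn_integral_cong) (auto simp: indicator_def)
  also have "\<dots> \<le> (\<integral>\<^sup>+y\<in>\<Union>(cz u l). (ennreal (1 - 1 / (2 * c)) * u y) \<partial>lebesgue)"
  proof (rule set_nn_integral_Union_mono[OF cz_countable cz_disjoint cz_sets])
    fix R assume R: "R \<in> cz u l"
    have RD: "R \<in> dcubes" using R cz_dcubes by (rule subsetD[rotated])
    have [measurable]: "R \<in> sets lebesgue" by (rule dcubes_sets[OF RD])
    have RQ: "R \<subseteq> Q0"
      by (rule cz_local[OF Q0 uint _ _ l R]) (use s in \<open>auto simp: u_def\<close>)
    obtain r where r: "emeasure lebesgue R = ennreal r" "0 < r" using dcube_measure_obtain[OF RD] by blast
    define a where "a = enn2real (\<integral>\<^sup>+y\<in>R. u y \<partial>lebesgue)"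
    have "(\<integral>\<^sup>+y\<in>R. u y \<partial>lebesgue) \<le> (\<integral>\<^sup>+y. u y \<partial>lebesgue)"
      by (intro nn_integral_mono) (auto simp: indicator_def)
    then have a: "(\<integral>\<^sup>+y\<in>R. u y \<partial>lebesgue) = ennreal a" "0 \<le> a"
      using ufin by (auto simp: a_def)
    have "ennreal m * emeasure lebesgue (R \<inter> ?O) \<le> ennreal a"
    proof -
      define N where "N = {R' \<in> cz u m. R' \<inter> R \<noteq> {}}"
      have NR: "R' \<subseteq> R" if "R' \<in> N" for R'
        using cz_levels[OF ufin l0 lm(1) R, of R'] that by (auto simp: N_def)
      have NU: "R \<inter> ?O = \<Union>N" using NR by (auto simp: N_def)
      have N: "countable N" "disjoint N" "N \<subseteq> sets lebesgue"
        using countable_subset[OF _ cz_countable[of u m], of N] cz_disjoint[of u m] cz_sets[of u m]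
        by (auto simp: N_def disjoint_def)
      have "ennreal m * emeasure lebesgue (R \<inter> ?O) = (\<integral>\<^sup>+y\<in>\<Union>N. ennreal m \<partial>lebesgue)"
        unfolding NU[symmetric] by (rule set_nn_integral_cmult_const[symmetric]) measurable
      also have "\<dots> \<le> (\<integral>\<^sup>+y\<in>\<Union>N. u y \<partial>lebesgue)"
      proof (rule set_nn_integral_Union_mono[OF N _ u])
        fix R' assume R': "R' \<in> N"
        then have "R' \<in> cz u m" by (simp add: N_def)
        from cz_lower[OF this] show "(\<integral>\<^sup>+y\<in>R'. ennreal m \<partial>lebesgue) \<le> (\<integral>\<^sup>+y\<in>R'. u y \<partial>lebesgue)"
          using R' N by (subst set_nn_integral_cmult_const) auto
      qed simp
      also have "\<dots> \<le> (\<integral>\<^sup>+y\<in>R. u y \<partial>lebesgue)"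
        unfolding NU[symmetric] by (rule set_nn_integral_mono_set) auto
      finally show ?thesis using a by simp
    qed
    moreover have "ennreal a \<le> ennreal (2 ^ CARD('n) * l * r)"
      using cz_upper[OF R] a r l0 by (simp add: ennreal_mult' flip: ennreal_power)
    ultimately have *: "ennreal m * emeasure lebesgue (R \<inter> ?O) \<le> ennreal (2 ^ CARD('n) * l * r)"
      by (rule order_trans)
    have "emeasure lebesgue (R \<inter> ?O) \<le> ennreal r" using r emeasure_mono[of "R \<inter> ?O" R lebesgue] by auto
    then obtain t where t: "emeasure lebesgue (R \<inter> ?O) = ennreal t" "0 \<le> t"
      by (cases "emeasure lebesgue (R \<inter> ?O)") (auto simp: top_unique)
    have "m * t \<le> 2 ^ CARD('n) * l * r"
      using * t lm r l0 by (simp add: ennreal_le_iff flip: ennreal_mult')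
    then have tr: "t \<le> r / 2" using l0 by (simp add: m_def field_simps)
    have "emeasure lebesgue (R - ?O) = ennreal (r - t)"
    proof -
      have "emeasure lebesgue (R - R \<inter> ?O) = emeasure lebesgue R - emeasure lebesgue (R \<inter> ?O)"
        using t by (intro emeasure_Diff) auto
      then show ?thesis using r t by (simp add: Diff_Int_distrib2 Diff_Int ennreal_minus)
    qed
    then have half: "ennreal (r / 2) \<le> emeasure lebesgue (R - ?O)" using tr by (simp add: ennreal_leI)
    have "AE y in lebesgue. ennreal (a / (c * r)) * indicator (R - ?O) y \<le> u y * indicator (R - ?O) y"
      using A1_dcube[OF A1]
    proof eventually_elim
      case (elim y)
      show ?case
      proof (cases "y \<in> R")
        case True
        have "(\<integral>\<^sup>+y\<in>R. u y \<partial>lebesgue) = (\<integral>\<^sup>+y\<in>R. ennreal (w y) \<partial>lebesgue)"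
          using RQ by (intro nn_integral_cong) (auto simp: u_def indicator_def)
        also have "\<dots> \<le> ennreal (c * w y) * ennreal r" using bspec[OF elim RD] True r(1) by simp
        finally have "a \<le> c * w y * r" using a r c w0 by (simp add: ennreal_le_iff flip: ennreal_mult')
        then have "a / (c * r) \<le> w y" using c r by (simp add: field_simps)
        then show ?thesis using True RQ by (auto simp: u_def indicator_def intro: ennreal_leI)
      qed simp
    qed
    then have "(\<integral>\<^sup>+y\<in>R - ?O. ennreal (a / (c * r)) \<partial>lebesgue) \<le> (\<integral>\<^sup>+y\<in>R - ?O. u y \<partial>lebesgue)"
      by (rule nn_integral_mono_AE)
    then have "ennreal (a / (c * r)) * emeasure lebesgue (R - ?O) \<le> (\<integral>\<^sup>+y\<in>R - ?O. u y \<partial>lebesgue)"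
      by (subst (asm) set_nn_integral_cmult_const) auto
    then have "ennreal (a / (c * r)) * ennreal (r / 2) \<le> (\<integral>\<^sup>+y\<in>R - ?O. u y \<partial>lebesgue)"
      by (rule order_trans[rotated]) (intro mult_left_mono half, simp)
    moreover have "ennreal (a / (c * r)) * ennreal (r / 2) = ennreal (a / (2 * c))"
      using a r c by (simp add: ennreal_mult'[symmetric])
    ultimately have low: "ennreal (a / (2 * c)) \<le> (\<integral>\<^sup>+y\<in>R - ?O. u y \<partial>lebesgue)" by simp
    have split: "ennreal a = (\<integral>\<^sup>+y\<in>R \<inter> ?O. u y \<partial>lebesgue) + (\<integral>\<^sup>+y\<in>R - ?O. u y \<partial>lebesgue)"
      unfolding a(1)[symmetric] by (rule set_nn_integral_split) auto
    obtain e f where ef: "(\<integral>\<^sup>+y\<in>R \<inter> ?O. u y \<partial>lebesgue) = ennreal e" "0 \<le> e"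
       "(\<integral>\<^sup>+y\<in>R - ?O. u y \<partial>lebesgue) = ennreal f" "0 \<le> f"
      using split by (cases "\<integral>\<^sup>+y\<in>R \<inter> ?O. u y \<partial>lebesgue"; cases "\<integral>\<^sup>+y\<in>R - ?O. u y \<partial>lebesgue") auto
    have "a = e + f" using split ef a by (simp flip: ennreal_plus)
    moreover have "a / (2 * c) \<le> f" using low ef by (simp add: ennreal_le_iff)
    ultimately have "e \<le> (1 - 1 / (2 * c)) * a" by (simp add: algebra_simps)
    then have "(\<integral>\<^sup>+y\<in>R \<inter> ?O. u y \<partial>lebesgue) \<le> ennreal (1 - 1 / (2 * c)) * ennreal a"
      using ef a c by (simp add: ennreal_leI flip: ennreal_mult')
    also have "\<dots> = (\<integral>\<^sup>+y\<in>R. (ennreal (1 - 1 / (2 * c)) * u y) \<partial>lebesgue)"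
      unfolding a(1)[symmetric] by (simp add: mult.assoc nn_integral_cmult)
    also have "(\<integral>\<^sup>+y\<in>R \<inter> ?O. u y \<partial>lebesgue) = (\<integral>\<^sup>+y\<in>R. (u y * indicator ?O y) \<partial>lebesgue)"
      by (intro nn_integral_cong) (auto simp: indicator_def)
    finally show "(\<integral>\<^sup>+y\<in>R. (u y * indicator ?O y) \<partial>lebesgue) \<le> (\<integral>\<^sup>+y\<in>R. (ennreal (1 - 1 / (2 * c)) * u y) \<partial>lebesgue)" .
  qed measurable
  also have "\<dots> = ennreal (1 - 1 / (2 * c)) * (\<integral>\<^sup>+y\<in>\<Union>(cz u l). u y \<partial>lebesgue)"
    by (simp add: mult.assoc nn_integral_cmult)
  finally show ?thesis unfolding m_def .
qed

text \<open>A layer cake argument: the mass of w on the cubes of height b^i s decays like th^i.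
  Since b^\<delta> = 1 / sqrt th, weighting it with the \<delta>-th power of the next height leaves
  a geometric series with ratio q = sqrt th.\<close>

lemma A1_reverse_Hoelder:
  assumes c: "1 \<le> c"
  obtains \<delta> C :: real where "0 < \<delta>" "0 < C"
    "\<And>(w :: real^'n \<Rightarrow> real) Q s. A1 c w \<Longrightarrow> Q \<in> dcubes \<Longrightarrow> 0 < s \<Longrightarrow>
       (\<integral>\<^sup>+y\<in>Q. ennreal (w y) \<partial>lebesgue) \<le> ennreal s * emeasure lebesgue Q \<Longrightarrow>
       (\<integral>\<^sup>+y\<in>Q. ennreal (w y powr (1 + \<delta>)) \<partial>lebesgue) \<le> ennreal (C * s powr (1 + \<delta>)) * emeasure lebesgue Q"
proof -
  define th where "th = 1 - 1 / (2 * c)"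
  have th: "0 < th" "th < 1" using c by (auto simp: th_def field_simps)
  define q where "q = sqrt th"
  have q: "0 < q" "q < 1" "q * q = th" using th by (auto simp: q_def)
  define b :: real where "b = 2 * 2 ^ CARD('n)"
  have "(1::real) < 2 * 1" by simp
  also have "\<dots> \<le> b" unfolding b_def by (intro mult_left_mono) auto
  finally have b: "1 < b" .
  define \<delta> where "\<delta> = log b (1 / q)"
  have d0: "0 < \<delta>" using b q by (simp add: \<delta>_def)
  have bd: "b powr \<delta> = 1 / q" using b q by (simp add: \<delta>_def)
  \<comment> \<open>The summand 1 accounts for the part where w \<le> s. The other is the geometric
    series, with an extra 1 / q because the cubes of height i are weighted with height i +
    1.\<close>
  define C where "C = 1 + 1 / (q * (1 - q))"
  have C: "0 < C" using q by (simp add: C_def add_pos_pos)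
  show thesis
  proof (rule that[OF d0 C])
    fix w :: "real^'n \<Rightarrow> real" and Q s
    assume A1: "A1 c w" and Q: "Q \<in> dcubes" and s: "0 < s"
      and avg: "(\<integral>\<^sup>+y\<in>Q. ennreal (w y) \<partial>lebesgue) \<le> ennreal s * emeasure lebesgue Q"
    have [measurable]: "w \<in> borel_measurable lebesgue" and w0: "\<And>x. 0 \<le> w x" using A1 by (auto simp: A1_def)
    have Qs[measurable]: "Q \<in> sets lebesgue" using Q dcubes_sets by blast
    define u where "u y = ennreal (w y) * indicator Q y" for y
    have u[measurable]: "u \<in> borel_measurable lebesgue" unfolding u_def by measurable
    obtain r where r: "emeasure lebesgue Q = ennreal r" "0 < r" using dcube_measure_obtain[OF Q] by blast
    have uint: "(\<integral>\<^sup>+y. u y \<partial>lebesgue) \<le> ennreal (s * r)" using avg r s by (simp add: u_def ennreal_mult')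
    then have ufin: "(\<integral>\<^sup>+y. u y \<partial>lebesgue) < \<infinity>" by (rule le_less_trans) simp
    define l where "l i = b ^ i * s" for i :: nat
    have l0: "0 < l i" "s \<le> l i" for i
      using b s one_le_power[of b i] by (auto simp: l_def)
    define \<Omega> where "\<Omega> i = \<Union>(cz u (l i))" for i
    have [measurable]: "\<Omega> i \<in> sets lebesgue" for i unfolding \<Omega>_def by (rule cz_Union_sets)
    have decay: "(\<integral>\<^sup>+y\<in>\<Omega> i. u y \<partial>lebesgue) \<le> ennreal (th ^ i * (s * r))" for i
    proof (induction i)
      case 0
      have "(\<integral>\<^sup>+y\<in>\<Omega> 0. u y \<partial>lebesgue) \<le> (\<integral>\<^sup>+y. u y \<partial>lebesgue)"
        by (intro nn_integral_mono) (auto simp: indicator_def)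
      then show ?case using uint by simp
    next
      case (Suc i)
      have "l (Suc i) = 2 * 2 ^ CARD('n) * l i" by (simp add: l_def b_def)
      then have "(\<integral>\<^sup>+y\<in>\<Omega> (Suc i). u y \<partial>lebesgue) \<le> ennreal th * (\<integral>\<^sup>+y\<in>\<Omega> i. u y \<partial>lebesgue)"
        using A1_level_decay[OF A1 c Q s avg l0(2)[of i]] by (simp add: \<Omega>_def u_def[abs_def] th_def)
      also have "\<dots> \<le> ennreal th * ennreal (th ^ i * (s * r))" by (intro mult_left_mono Suc) simp
      also have "\<dots> = ennreal (th ^ Suc i * (s * r))" using th s r by (simp add: ennreal_mult'[symmetric] mult.assoc)
      finally show ?case .
    qed
    have "AE y in lebesgue. \<forall>i. y \<notin> \<Omega> i \<longrightarrow> u y \<le> ennreal (l i)"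
      unfolding AE_all_countable \<Omega>_def using cz_AE_le[OF u ufin l0(1)] by blast
    then have "AE y in lebesgue. ennreal (w y powr (1 + \<delta>)) * indicator Q y \<le>
       ennreal (s powr \<delta>) * u y + (\<Sum>i. ennreal (l (Suc i) powr \<delta>) * (u y * indicator (\<Omega> i) y))"
      (is "AE y in lebesgue. ?L y \<le> ?A y + (\<Sum>i. ?B i y)")
    proof eventually_elim
      case (elim y)
      show ?case
      proof (cases "y \<in> Q")
        case True
        have wl: "ennreal (w y powr (1 + \<delta>)) \<le> ennreal (t powr \<delta>) * u y" if "w y \<le> t" for t
        proof -
          have "w y powr (1 + \<delta>) \<le> t powr \<delta> * w y"
            using that w0[of y] d0 by (cases "w y = 0") (auto simp: powr_add mult.commute intro!: mult_right_mono powr_mono2)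
          then show ?thesis using True w0[of y] by (simp add: u_def ennreal_leI flip: ennreal_mult')
        qed
        obtain i where i: "w y / s < b ^ i" using real_arch_pow[OF b] by blast
        then have ex: "w y \<le> l i" using s by (simp add: l_def field_simps)
        \<comment> \<open>The first height that bounds w y. If it is not the lowest one, w y exceeds
          the preceding height, so y lies in the \<Omega> of that height.\<close>
        define j where "j = (LEAST j. w y \<le> l j)"
        have j: "w y \<le> l j" "\<And>i. i < j \<Longrightarrow> \<not> w y \<le> l i"
          using LeastI[of "\<lambda>j. w y \<le> l j", OF ex] not_less_Least by (auto simp: j_def)
        show ?thesis
        proof (cases j)
          case 0
          then have "ennreal (w y powr (1 + \<delta>)) \<le> ennreal (s powr \<delta>) * u y" using wl j(1) by (simp add: l_def)
          then show ?thesis using True by (auto intro: add_increasing2)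
        next
          case (Suc i)
          then have "\<not> u y \<le> ennreal (l i)" using j(2)[of i] l0(1)[of i] w0[of y] True by (simp add: u_def)
          then have "y \<in> \<Omega> i" using elim by blast
          then have "?L y \<le> ?B i y" using wl[OF j(1)] Suc True by simp
          also have "\<dots> \<le> (\<Sum>i. ?B i y)" using sum_le_suminf[OF summableI, of "{i}" "\<lambda>i. ?B i y"] by simp
          finally show ?thesis by (rule add_increasing[OF zero_le])
        qed
      qed simp
    qed
    then have "(\<integral>\<^sup>+y. ?L y \<partial>lebesgue) \<le> (\<integral>\<^sup>+y. ?A y + (\<Sum>i. ?B i y) \<partial>lebesgue)"
      by (rule nn_integral_mono_AE)
    also have "\<dots> = ennreal (s powr \<delta>) * (\<integral>\<^sup>+y. u y \<partial>lebesgue) + (\<Sum>i. ennreal (l (Suc i) powr \<delta>) * (\<integral>\<^sup>+y\<in>\<Omega> i. u y \<partial>lebesgue))"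
      by (simp add: nn_integral_add nn_integral_cmult nn_integral_suminf)
    also have "\<dots> \<le> ennreal (s powr \<delta>) * ennreal (s * r) + (\<Sum>i. ennreal (s powr \<delta> * (s * r) / q * q ^ i))"
    proof (intro add_mono mult_left_mono uint suminf_le summableI)
      fix i
      have "ennreal (l (Suc i) powr \<delta>) * (\<integral>\<^sup>+y\<in>\<Omega> i. u y \<partial>lebesgue) \<le> ennreal (l (Suc i) powr \<delta>) * ennreal (th ^ i * (s * r))"
        by (intro mult_left_mono decay) simp
      also have "\<dots> = ennreal (l (Suc i) powr \<delta> * (th ^ i * (s * r)))"
        by (rule ennreal_mult'[OF powr_ge_zero, symmetric])
      also have "l (Suc i) powr \<delta> * (th ^ i * (s * r)) = s powr \<delta> * (s * r) / q * q ^ i"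
      proof -
        have A: "l (Suc i) powr \<delta> = (1 / q) ^ Suc i * s powr \<delta>"
        proof -
          have "(b ^ Suc i) powr \<delta> = (b powr \<delta>) ^ Suc i"
          proof -
            have "(b ^ Suc i) powr \<delta> = (b powr real (Suc i)) powr \<delta>" using b by (subst powr_realpow) auto
            also have "\<dots> = (b powr \<delta>) powr real (Suc i)" by (simp only: powr_powr mult.commute)
            also have "\<dots> = (b powr \<delta>) ^ Suc i" using b by (intro powr_realpow) simp
            finally show ?thesis .
          qed
          then show ?thesis using b s by (simp add: l_def powr_mult bd)
        qed
        show ?thesis unfolding A
          using q by (simp add: q(3)[symmetric] power_mult_distrib field_simps)
      qed
      finally show "ennreal (l (Suc i) powr \<delta>) * (\<integral>\<^sup>+y\<in>\<Omega> i. u y \<partial>lebesgue) \<le> ennreal (s powr \<delta> * (s * r) / q * q ^ i)" .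
    qed simp
    also have "(\<Sum>i. ennreal (s powr \<delta> * (s * r) / q * q ^ i)) = ennreal (s powr \<delta> * (s * r) / q / (1 - q))"
      using q s r by (intro suminf_ennreal_geometric) auto
    also have "ennreal (s powr \<delta>) * ennreal (s * r) + \<dots> = ennreal (s powr \<delta> * (s * r) + s powr \<delta> * (s * r) / q / (1 - q))"
      using s r q by (simp add: ennreal_mult'[symmetric] ennreal_plus)
    also have "s powr \<delta> * (s * r) + s powr \<delta> * (s * r) / q / (1 - q) = C * s powr (1 + \<delta>) * r"
      using s by (simp add: C_def powr_add algebra_simps)
    also have "ennreal (C * s powr (1 + \<delta>) * r) = ennreal (C * s powr (1 + \<delta>)) * emeasure lebesgue Q"
      using r C by (simp add: ennreal_mult')
    finally show "(\<integral>\<^sup>+y\<in>Q. ennreal (w y powr (1 + \<delta>)) \<partial>lebesgue) \<le> ennreal (C * s powr (1 + \<delta>)) * emeasure lebesgue Q" .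
  qed
qed

section \<open>Variable exponents and the Rubio de Francia iteration\<close>

text \<open>Removing the largest index b leaves indices at most b - 1, whose powers sum to at most
  2^b; this drives the induction.\<close>

lemma sum_powi2_le:
  assumes "finite J"
  shows "(\<forall>k\<in>J. k \<le> M) \<longrightarrow> (\<Sum>k\<in>J. (2::real) powi k) \<le> 2 * 2 powi M"
  using assms
proof (induction J arbitrary: M rule: finite_linorder_max_induct)
  case empty then show ?case by simp
next
  case (insert b A)
  have "(\<Sum>k\<in>A. (2::real) powi k) \<le> 2 * 2 powi (b - 1)" using insert.IH[of "b - 1"] insert.hyps by auto
  also have "\<dots> = 2 powi b" using power_int_add_1'[of "2::real" "b - 1"] by simp
  finally have "(\<Sum>k\<in>insert b A. (2::real) powi k) \<le> 2 * 2 powi b" using insert.hyps by auto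
  moreover have "b \<le> M \<Longrightarrow> (2::real) powi b \<le> 2 powi M" by (intro power_int_increasing) auto
  ultimately show ?case by auto
qed

text \<open>With s the sum of the b k, each power splits as b k times its (r - 1)-th power, and the
  latter is at most s^(r - 1).\<close>

lemma sum_powr_le_powr_sum:
  fixes b :: "'i \<Rightarrow> real"
  assumes "finite J" "\<And>k. k \<in> J \<Longrightarrow> 0 \<le> b k" "1 \<le> r"
  shows "(\<Sum>k\<in>J. b k powr r) \<le> (\<Sum>k\<in>J. b k) powr r"
proof (cases "(\<Sum>k\<in>J. b k) = 0")
  case True
  then have "\<forall>k\<in>J. b k = 0" using assms by (simp add: sum_nonneg_eq_0_iff)
  then show ?thesis by simp
next
  case False
  let ?s = "\<Sum>k\<in>J. b k"
  have s: "0 < ?s" using False sum_nonneg[of J b] assms by force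
  have "(\<Sum>k\<in>J. b k powr r) \<le> (\<Sum>k\<in>J. b k * ?s powr (r - 1))"
  proof (rule sum_mono)
    fix k assume k: "k \<in> J"
    have "b k \<le> ?s" using k assms by (intro member_le_sum) auto
    then have "b k powr (r - 1) \<le> ?s powr (r - 1)" using k assms by (intro powr_mono2) auto
    then have "b k * b k powr (r - 1) \<le> b k * ?s powr (r - 1)" using k assms by (intro mult_left_mono) auto
    moreover have "b k * b k powr (r - 1) = b k powr r"
      using k assms by (cases "b k = 0") (auto simp: powr_diff)
    ultimately show "b k powr r \<le> b k * ?s powr (r - 1)" by simp
  qed
  also have "\<dots> = ?s * ?s powr (r - 1)" by (rule sum_distrib_right[symmetric])
  also have "\<dots> = ?s powr r" using s by (simp add: powr_diff)
  finally show ?thesis .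
qed

section \<open>Density of a set in the Calderon-Zygmund cubes of its indicator\<close>

lemma set_nn_integral_indicator:
  assumes "E \<in> sets M" "Q \<in> sets M"
  shows "(\<integral>\<^sup>+x\<in>Q. indicator E x \<partial>M) = emeasure M (E \<inter> Q)"
  using assms by (simp add: indicator_inter_arith[symmetric])

lemma cz_weak_type:
  fixes u :: "real^'n \<Rightarrow> ennreal"
  assumes u: "u \<in> borel_measurable lebesgue" and N: "N \<subseteq> cz u l"
  shows "ennreal l * emeasure lebesgue (\<Union>N) \<le> (\<integral>\<^sup>+x\<in>\<Union>N. u x \<partial>lebesgue)"
proof -
  have N': "countable N" "disjoint N" "N \<subseteq> sets lebesgue"
    using countable_subset[OF N cz_countable] pairwise_subset[OF cz_disjoint N] N cz_sets[of u l] by auto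
  then have "ennreal l * emeasure lebesgue (\<Union>N) = (\<integral>\<^sup>+x\<in>\<Union>N. ennreal l \<partial>lebesgue)"
    by (intro set_nn_integral_cmult_const[symmetric] sets.countable_Union) auto
  also have "\<dots> \<le> (\<integral>\<^sup>+x\<in>\<Union>N. u x \<partial>lebesgue)"
  proof (rule set_nn_integral_Union_mono[OF N' _ u])
    fix R assume R: "R \<in> N"
    then have "R \<in> cz u l" using N by blast
    from cz_lower[OF this] show "(\<integral>\<^sup>+y\<in>R. ennreal l \<partial>lebesgue) \<le> (\<integral>\<^sup>+y\<in>R. u y \<partial>lebesgue)"
      using R N' by (subst set_nn_integral_cmult_const) auto
  qed simp
  finally show ?thesis .
qed

text \<open>If R lay in no cube of the family, the cubes of the family that meet R would lie inside
  R and cover E \<inter> R. Then E would have density at most e \<le> b in R, contrary to the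
  selection of R.\<close>

lemma cz_indicator_within:
  fixes E :: "(real^'n) set"
  assumes E[measurable]: "E \<in> sets lebesgue" and M: "\<M> \<subseteq> dcubes" "disjoint \<M>"
    and EM: "E \<subseteq> \<Union>\<M>" and dens: "\<And>Q. Q \<in> \<M> \<Longrightarrow> emeasure lebesgue (E \<inter> Q) \<le> ennreal e * emeasure lebesgue Q"
    and e: "e \<le> b" and R: "R \<in> cz (indicator E) b"
  obtains Q where "Q \<in> \<M>" "R \<subseteq> Q"
proof (rule ccontr)
  assume "\<not> thesis"
  then have no: "\<And>Q. Q \<in> \<M> \<Longrightarrow> \<not> R \<subseteq> Q" using that by blast
  have RD: "R \<in> dcubes" using R cz_dcubes by (rule subsetD[rotated])
  have Rs[measurable]: "R \<in> sets lebesgue" by (rule dcubes_sets[OF RD])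
  define N where "N = {Q \<in> \<M>. Q \<inter> R \<noteq> {}}"
  have NR: "Q \<subseteq> R" if Q: "Q \<in> N" for Q
  proof -
    obtain x where x: "x \<in> Q" "x \<in> R" using Q by (auto simp: N_def)
    have "Q \<in> \<M>" "Q \<in> dcubes" using Q M by (auto simp: N_def)
    then show ?thesis using dcubes_nested[OF _ RD x] no by metis
  qed
  have N: "N \<subseteq> \<M>" by (auto simp: N_def)
  have ND: "N \<subseteq> dcubes" using N M by blast
  have N': "countable N" "disjoint N" "N \<subseteq> sets lebesgue"
    using countable_dcubes_subset[OF ND] pairwise_subset[OF M(2) N] ND dcubes_sets by auto
  have [measurable]: "\<Union>N \<in> sets lebesgue" by (rule Union_dcubes_sets[OF ND])
  have "(\<integral>\<^sup>+x\<in>R. indicator E x \<partial>lebesgue) \<le> (\<integral>\<^sup>+x\<in>\<Union>N. indicator E x \<partial>lebesgue)"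
    using EM by (intro nn_integral_mono) (auto simp: indicator_def N_def)
  also have "\<dots> \<le> (\<integral>\<^sup>+x\<in>\<Union>N. ennreal e \<partial>lebesgue)"
  proof (rule set_nn_integral_Union_mono[OF N'])
    fix Q assume Q: "Q \<in> N"
    then have "Q \<in> sets lebesgue" using N' by blast
    then show "(\<integral>\<^sup>+x\<in>Q. indicator E x \<partial>lebesgue) \<le> (\<integral>\<^sup>+x\<in>Q. ennreal e \<partial>lebesgue)"
      using dens[of Q] Q N by (subst set_nn_integral_indicator set_nn_integral_cmult_const; auto)+
  qed simp_all
  also have "\<dots> = ennreal e * emeasure lebesgue (\<Union>N)" by (rule set_nn_integral_cmult_const) simp
  also have "\<dots> \<le> ennreal b * emeasure lebesgue R"
    using NR e by (intro mult_mono ennreal_leI emeasure_mono) auto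
  finally show False using cz_lower[OF R] by simp
qed

text \<open>The selected cubes that meet Q lie inside Q, and each contains E with density above b,
  so together they have at most 1 / b times the measure of E \<inter> Q. Replacing E by its cubes
  thus raises the density by at most the factor 1 / b.\<close>

lemma cz_indicator_density:
  fixes E :: "(real^'n) set"
  assumes E[measurable]: "E \<in> sets lebesgue" and M: "\<M> \<subseteq> dcubes" "disjoint \<M>"
    and EM: "E \<subseteq> \<Union>\<M>" and dens: "\<And>Q. Q \<in> \<M> \<Longrightarrow> emeasure lebesgue (E \<inter> Q) \<le> ennreal (b * e) * emeasure lebesgue Q"
    and e: "e \<le> 1" and b: "0 < b" and Q: "Q \<in> \<M>"
  shows "emeasure lebesgue (\<Union>(cz (indicator E) b) \<inter> Q) \<le> ennreal e * emeasure lebesgue Q"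
proof -
  define N where "N = {R \<in> cz (indicator E) b. R \<inter> Q \<noteq> {}}"
  have be: "b * e \<le> b" using e b by simp
  have NQ: "R \<subseteq> Q" if R: "R \<in> N" for R
  proof -
    have "R \<in> cz (indicator E) b" using R by (simp add: N_def)
    from cz_indicator_within[OF E M EM dens be this]
    obtain Q' where Q': "Q' \<in> \<M>" "R \<subseteq> Q'" by metis
    then have "Q' \<inter> Q \<noteq> {}" using R by (auto simp: N_def)
    then show ?thesis using Q' Q M(2) by (auto simp: disjoint_def)
  qed
  have Qs: "Q \<in> sets lebesgue" using Q M dcubes_sets by blast
  have NU: "\<Union>(cz (indicator E) b) \<inter> Q = \<Union>N" using NQ by (auto simp: N_def)
  have Ns: "\<Union>N \<in> sets lebesgue" using Qs unfolding NU[symmetric] by measurable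
  have "ennreal b * emeasure lebesgue (\<Union>N) \<le> (\<integral>\<^sup>+x\<in>\<Union>N. indicator E x \<partial>lebesgue)"
    by (rule cz_weak_type) (auto simp: N_def)
  also have "\<dots> = emeasure lebesgue (E \<inter> \<Union>N)" using Ns by (rule set_nn_integral_indicator[OF E])
  also have "\<dots> \<le> emeasure lebesgue (E \<inter> Q)"
    using NQ Qs by (intro emeasure_mono) (auto, measurable)
  also have "\<dots> \<le> ennreal b * (ennreal e * emeasure lebesgue Q)"
    using dens[OF Q] b by (simp add: ennreal_mult' mult.assoc)
  finally have "ennreal b * emeasure lebesgue (\<Union>N) \<le> ennreal b * (ennreal e * emeasure lebesgue Q)" .
  then show ?thesis unfolding NU using b by (simp add: ennreal_mult_le_mult_iff)
qed

section \<open>Modulars with a bounded exponent\<close>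

definition rho :: "(real^'n \<Rightarrow> real) \<Rightarrow> (real^'n \<Rightarrow> real) \<Rightarrow> ennreal"
  where "rho P f = (\<integral>\<^sup>+x. ennreal (f x powr P x) \<partial>lebesgue)"

text \<open>The exponent is real valued and its bounds hold at every point; an exponent from
  \<open>B_M\<close> is brought into this form by a change on a null set.\<close>

locale bounded_exponent =
  fixes P :: "real^'n \<Rightarrow> real" and pm pp :: real
  assumes P_meas[measurable]: "P \<in> borel_measurable lebesgue"
    and pm: "1 < pm" and P_low: "\<And>x. pm \<le> P x" and P_up: "\<And>x. P x \<le> pp"
begin

lemma P_ge_1: "1 \<le> P x" "0 < P x" using P_low[of x] pm by auto
lemma pp_ge_1: "1 \<le> pp" "0 < pp" using P_ge_1[of 0] P_up[of 0] by auto

lemma rho_mono_AE: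
  assumes "AE x in lebesgue. 0 \<le> f x \<and> f x \<le> g x"
  shows "rho P f \<le> rho P g"
  unfolding rho_def
proof (rule nn_integral_mono_AE)
  show "AE x in lebesgue. ennreal (f x powr P x) \<le> ennreal (g x powr P x)"
    using assms
  proof eventually_elim
    case (elim x) then show ?case using P_ge_1[of x] by (intro ennreal_leI powr_mono2) auto
  qed
qed

text \<open>This and the next lemma replace homogeneity: as 1 \<le> P x \<le> pp, a factor t \<le> 1
  comes out with gain at least t, a factor t \<ge> 1 with loss at most t^pp.\<close>

lemma powr_P_scale_le:
  assumes "0 \<le> t" "t \<le> 1" "0 \<le> a" shows "(t * a) powr P x \<le> t * a powr P x"
proof -
  have "t powr P x \<le> t" using assms P_ge_1[of x] powr_le_one_le[of t "P x"] by (cases "t = 0") auto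
  then show ?thesis using assms by (simp add: powr_mult mult_right_mono)
qed

lemma powr_P_scale_ge:
  assumes "1 \<le> t" "0 \<le> a" shows "(t * a) powr P x \<le> t powr pp * a powr P x"
  using assms P_up[of x] by (simp add: powr_mult mult_right_mono powr_mono)

lemma rho_scale_le:
  assumes [measurable]: "f \<in> borel_measurable lebesgue" and "0 \<le> t" "t \<le> 1" "\<And>x. 0 \<le> f x"
  shows "rho P (\<lambda>x. t * f x) \<le> ennreal t * rho P f"
proof -
  have "rho P (\<lambda>x. t * f x) \<le> (\<integral>\<^sup>+x. ennreal t * ennreal (f x powr P x) \<partial>lebesgue)"
    unfolding rho_def using assms by (intro nn_integral_mono) (simp add: powr_P_scale_le ennreal_leI flip: ennreal_mult')
  also have "\<dots> = ennreal t * rho P f" unfolding rho_def by (rule nn_integral_cmult) measurable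
  finally show ?thesis .
qed

end

text \<open>Here h stands for M f. Boundedness of M is expressed on the unit ball of the modular,
  with the averages multiplied out.\<close>

locale maximal_exponent = bounded_exponent P pm pp
  for P :: "real^'n \<Rightarrow> real" and pm pp +
  fixes B :: real
  assumes B: "1 \<le> B"
    and max_bound: "\<And>f. f \<in> borel_measurable lebesgue \<Longrightarrow> (\<And>x. 0 \<le> f x) \<Longrightarrow> rho P f \<le> 1 \<Longrightarrow>
      \<exists>h\<in>borel_measurable lebesgue. (\<forall>x. 0 \<le> h x) \<and> rho P (\<lambda>x. h x / B) \<le> 1 \<and>
        (AE x in lebesgue. \<forall>Q\<in>cubes. x \<in> Q \<longrightarrow>
           (\<integral>\<^sup>+y\<in>Q. ennreal (f y) \<partial>lebesgue) \<le> ennreal (h x) * emeasure lebesgue Q)"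
begin

text \<open>Iterating the passage from f to h / B gives functions \<open>g j\<close> of modular at
  most 1, and w is their sum with weights 4^(-j). Averages of \<open>g j\<close> over cubes are at
  most B times \<open>g (Suc j)\<close>, so averaging w shifts the series by one index, at the cost
  4 B. Each weight is used as 2^(-j) times 2^(-j): one factor makes the modulars summable, the other
  sums the series.\<close>

lemma Rubio_de_Francia:
  assumes f: "f \<in> borel_measurable lebesgue" "\<And>x. 0 \<le> f x" "rho P f \<le> 1"
  obtains w where "A1 (4 * B) w" "AE x in lebesgue. f x \<le> w x" "rho P (\<lambda>x. w x / 4) \<le> 1"
proof -
  define ok where "ok f \<longleftrightarrow> f \<in> borel_measurable lebesgue \<and> (\<forall>x. 0 \<le> f x) \<and> rho P f \<le> 1" for f :: "real^'n \<Rightarrow> real"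
  define nxt where "nxt f h \<longleftrightarrow> (AE x in lebesgue. \<forall>Q\<in>cubes. x \<in> Q \<longrightarrow>
           (\<integral>\<^sup>+y\<in>Q. ennreal (f y) \<partial>lebesgue) \<le> ennreal (B * h x) * emeasure lebesgue Q)" for f h :: "real^'n \<Rightarrow> real"
  have "\<forall>f. ok f \<longrightarrow> (\<exists>h. ok h \<and> nxt f h)"
  proof (intro allI impI)
    fix f assume "ok f"
    then obtain h where h: "h \<in> borel_measurable lebesgue" "\<forall>x. 0 \<le> h x" "rho P (\<lambda>x. h x / B) \<le> 1"
      "AE x in lebesgue. \<forall>Q\<in>cubes. x \<in> Q \<longrightarrow>
           (\<integral>\<^sup>+y\<in>Q. ennreal (f y) \<partial>lebesgue) \<le> ennreal (h x) * emeasure lebesgue Q"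
      using max_bound[of f] unfolding ok_def by blast
    have "ok (\<lambda>x. h x / B)" "nxt f (\<lambda>x. h x / B)" using h B by (auto simp: ok_def nxt_def)
    then show "\<exists>h. ok h \<and> nxt f h" by blast
  qed
  then obtain H where H: "\<And>f. ok f \<Longrightarrow> ok (H f) \<and> nxt f (H f)" by metis
  define g where "g j = (H ^^ j) f" for j
  have ok: "ok (g j)" for j by (induction j) (use f H in \<open>auto simp: g_def ok_def[of f]\<close>)
  have nxt: "nxt (g j) (g (Suc j))" for j using H[OF ok[of j]] by (simp add: g_def)
  have gm[measurable]: "g j \<in> borel_measurable lebesgue" and g0: "0 \<le> g j x" and grho: "rho P (g j) \<le> 1" for j x
    using ok[of j] by (auto simp: ok_def)
  define W where "W x = (\<Sum>j. ennreal ((1/4) ^ j * g j x))" for x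
  have [measurable]: "W \<in> borel_measurable lebesgue" unfolding W_def by measurable
  \<comment> \<open>\<open>V\<close> replaces a triangle inequality: \<open>W \<le> 2 s\<close> with \<open>s = sup\<^sub>j 2\<^sup>-\<^sup>j g\<^sub>j\<close>, and \<open>s\<^bsup>P\<^esup> \<le> V\<close>.\<close>
  define V where "V x = (\<Sum>j. ennreal ((1/2) ^ j) * ennreal (g j x powr P x))" for x
  have Vm[measurable]: "V \<in> borel_measurable lebesgue" unfolding V_def by measurable
  have "(\<integral>\<^sup>+x. V x \<partial>lebesgue) = (\<Sum>j. ennreal ((1/2) ^ j) * rho P (g j))"
    unfolding V_def rho_def by (simp add: nn_integral_suminf nn_integral_cmult)
  also have "\<dots> \<le> (\<Sum>j. ennreal ((1/2) ^ j) * 1)"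
    by (intro suminf_le mult_left_mono grho summableI) simp
  also have "\<dots> = (\<Sum>j. ennreal (1 * (1/2) ^ j))" by (simp only: mult_1 mult_1_right)
  also have "\<dots> = ennreal (1 / (1 - 1/2))" by (rule suminf_ennreal_geometric) auto
  also have "\<dots> = ennreal 2" by simp
  finally have V2: "(\<integral>\<^sup>+x. V x \<partial>lebesgue) \<le> ennreal 2" .
  have Vfin: "AE x in lebesgue. V x \<noteq> \<infinity>"
    by (rule nn_integral_noteq_infinite[OF Vm]) (use V2 in \<open>auto simp: top_unique\<close>)
  \<comment> \<open>W is finite a.e., so the conversion alters it on a null set only and makes the
    weight finite everywhere.\<close>
  define w where "w x = enn2real (W x)" for x
  have wm[measurable]: "w \<in> borel_measurable lebesgue" unfolding w_def by measurable
  have W: "AE x in lebesgue. W x = ennreal (w x) \<and> ennreal ((w x / 4) powr P x) \<le> ennreal (1/2) * V x"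
    using Vfin
  proof eventually_elim
    case (elim x)
    then obtain v where v: "V x = ennreal v" "0 \<le> v" by (cases "V x") auto
    have gb: "(1/2) ^ j * g j x \<le> v powr (1 / P x)" for j
    proof -
      have "ennreal ((1/2) ^ j * g j x powr P x) \<le> V x"
        unfolding V_def using sum_le_suminf[OF summableI, of "{j}" "\<lambda>j. ennreal ((1/2) ^ j) * ennreal (g j x powr P x)"]
        by (simp add: ennreal_mult')
      then have "(1/2) ^ j * g j x powr P x \<le> v" using v by simp
      then have "((1/2) ^ j * g j x) powr P x \<le> v"
        using powr_P_scale_le[of "(1/2) ^ j" "g j x" x] g0[of j x] by (simp add: power_le_one)
      then have "(((1/2) ^ j * g j x) powr P x) powr (1 / P x) \<le> v powr (1 / P x)"
        using P_ge_1[of x] by (intro powr_mono2) auto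
      then show ?thesis using P_ge_1[of x] g0[of j x] by (simp add: powr_powr)
    qed
    have "W x \<le> (\<Sum>j. ennreal (v powr (1 / P x) * (1/2) ^ j))"
      unfolding W_def
    proof (intro suminf_le summableI ennreal_leI)
      fix j
      have eq: "(1/4) ^ j * g j x = ((1/2) ^ j * g j x) * (1/2) ^ j"
        using power_mult_distrib[of "1/2::real" "1/2" j] by (simp add: ac_simps)
      show "(1/4) ^ j * g j x \<le> v powr (1 / P x) * (1/2) ^ j"
        unfolding eq by (rule mult_right_mono[OF gb]) simp
    qed
    also have "\<dots> = ennreal (2 * v powr (1 / P x))" by (subst suminf_ennreal_geometric) auto
    finally have Wle: "W x \<le> ennreal (2 * v powr (1 / P x))" .
    then have "W x < \<infinity>" by (rule le_less_trans) simp
    then have Ww: "W x = ennreal (w x)" by (simp add: w_def)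
    have w0: "0 \<le> w x" by (simp add: w_def)
    have "w x / 2 \<le> v powr (1 / P x)" using Wle Ww w0 by simp
    then have "(w x / 2) powr P x \<le> (v powr (1 / P x)) powr P x" using w0 P_ge_1[of x] by (intro powr_mono2) auto
    also have "\<dots> = v" using v P_ge_1[of x] by (simp add: powr_powr)
    finally have "(w x / 4) powr P x \<le> 1/2 * v"
      using powr_P_scale_le[of "1/2" "w x / 2" x] w0 by simp
    then have "ennreal ((w x / 4) powr P x) \<le> ennreal (1/2) * V x"
      using v by (simp add: ennreal_mult'[symmetric] ennreal_leI del: ennreal_half)
    then show ?case using Ww by simp
  qed
  show thesis
  proof (rule that)
    have "rho P (\<lambda>x. w x / 4) \<le> (\<integral>\<^sup>+x. ennreal (1/2) * V x \<partial>lebesgue)"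
      unfolding rho_def by (rule nn_integral_mono_AE) (use W in auto)
    also have "\<dots> = ennreal (1/2) * (\<integral>\<^sup>+x. V x \<partial>lebesgue)" by (rule nn_integral_cmult) simp
    also have "\<dots> \<le> ennreal (1/2) * ennreal 2" by (intro mult_left_mono V2) simp
    also have "\<dots> = 1" by (subst ennreal_mult'[symmetric]) auto
    finally show "rho P (\<lambda>x. w x / 4) \<le> 1" .
    show "AE x in lebesgue. f x \<le> w x" using W
    proof eventually_elim
      case (elim x)
      have "ennreal (f x) \<le> W x"
        unfolding W_def using sum_le_suminf[OF summableI, of "{0}" "\<lambda>j. ennreal ((1/4) ^ j * g j x)"] by (simp add: g_def)
      also have "\<dots> = ennreal (w x)" using elim by (rule conjunct1)
      finally show ?case by (simp add: w_def)
    qed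
    have "AE x in lebesgue. \<forall>j. \<forall>Q\<in>cubes. x \<in> Q \<longrightarrow>
           (\<integral>\<^sup>+y\<in>Q. ennreal (g j y) \<partial>lebesgue) \<le> ennreal (B * g (Suc j) x) * emeasure lebesgue Q"
      unfolding AE_all_countable using nxt by (simp add: nxt_def)
    then have "AE x in lebesgue. \<forall>Q\<in>cubes. x \<in> Q \<longrightarrow>
       (\<integral>\<^sup>+y\<in>Q. ennreal (w y) \<partial>lebesgue) \<le> ennreal (4 * B * w x) * emeasure lebesgue Q"
      using W
    proof eventually_elim
      case (elim x)
      show ?case
      proof (intro ballI impI)
        fix Q :: "(real^'n) set" assume Q: "Q \<in> cubes" "x \<in> Q"
        then have [measurable]: "Q \<in> sets lebesgue" by (auto simp: cubes_def)
        have "(\<integral>\<^sup>+y\<in>Q. ennreal (w y) \<partial>lebesgue) = (\<integral>\<^sup>+y\<in>Q. W y \<partial>lebesgue)"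
          by (rule nn_integral_cong_AE) (use W in auto)
        also have "\<dots> = (\<Sum>j. \<integral>\<^sup>+y. ennreal ((1/4) ^ j) * (ennreal (g j y) * indicator Q y) \<partial>lebesgue)"
        proof -
          have "W y * indicator Q y = (\<Sum>j. ennreal ((1/4) ^ j) * (ennreal (g j y) * indicator Q y))" for y
            unfolding W_def ennreal_suminf_multc[symmetric]
            by (rule arg_cong[where f = suminf], rule ext) (subst ennreal_mult', simp_all add: mult.assoc)
          then show ?thesis by (subst nn_integral_suminf[symmetric]) auto
        qed
        also have "\<dots> = (\<Sum>j. ennreal ((1/4) ^ j) * (\<integral>\<^sup>+y\<in>Q. ennreal (g j y) \<partial>lebesgue))"
          by (subst nn_integral_cmult) auto
        also have "\<dots> \<le> (\<Sum>j. ennreal ((1/4) ^ j) * (ennreal (B * g (Suc j) x) * emeasure lebesgue Q))"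
          using elim(1) Q by (intro suminf_le mult_left_mono summableI) auto
        also have "\<dots> = (\<Sum>j. ennreal (4 * B) * emeasure lebesgue Q * ennreal ((1/4) ^ Suc j * g (Suc j) x))"
        proof (rule arg_cong[where f = suminf], rule ext)
          fix j
          have "ennreal ((1/4) ^ j) * ennreal (B * g (Suc j) x) = ennreal (4 * B) * ennreal ((1/4) ^ Suc j * g (Suc j) x)"
            using B by (simp add: ennreal_mult'[symmetric]) (simp add: mult.left_commute)
          then show "ennreal ((1/4) ^ j) * (ennreal (B * g (Suc j) x) * emeasure lebesgue Q) = ennreal (4 * B) * emeasure lebesgue Q * ennreal ((1/4) ^ Suc j * g (Suc j) x)"
            by (simp add: mult.assoc[symmetric]) (simp add: ac_simps)
        qed
        also have "\<dots> = ennreal (4 * B) * emeasure lebesgue Q * (\<Sum>j. ennreal ((1/4) ^ Suc j * g (Suc j) x))"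
          by (rule ennreal_suminf_cmult)
        also have "\<dots> \<le> ennreal (4 * B) * emeasure lebesgue Q * W x"
          unfolding W_def by (intro mult_left_mono) (use suminf_offset[OF summableI, of "\<lambda>j. ennreal ((1/4) ^ j * g j x)" 1] in \<open>simp_all add: add_increasing\<close>)
        also have "\<dots> = ennreal (4 * B * w x) * emeasure lebesgue Q"
        proof -
          have "W x = ennreal (w x)" using elim by blast
          then have "ennreal (4 * B) * W x = ennreal (4 * B * w x)" using B by (simp only: ennreal_mult')
          then show ?thesis by (metis mult.assoc mult.commute)
        qed
        finally show "(\<integral>\<^sup>+y\<in>Q. ennreal (w y) \<partial>lebesgue) \<le> ennreal (4 * B * w x) * emeasure lebesgue Q" .
      qed
    qed
    then show "A1 (4 * B) w" by (auto simp: A1_def w_def)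
  qed
qed

section \<open>Families of level sets\<close>

text \<open>The geometric growth of the heights makes \<open>lvf\<close>, a sum of powers, comparable with the power of the
  sum \<open>usum\<close>.\<close>

definition usum :: "int set \<Rightarrow> (int \<Rightarrow> (real^'n) set) \<Rightarrow> real^'n \<Rightarrow> real"
  where "usum K G x = (\<Sum>k\<in>K. 2 powi k * indicator (G k) x)"

definition lvf :: "int set \<Rightarrow> (int \<Rightarrow> (real^'n) set) \<Rightarrow> real \<Rightarrow> real^'n \<Rightarrow> real"
  where "lvf K G l x = (\<Sum>k\<in>K. (2 powi k / l) powr P x * indicator (G k) x)"

definition lv :: "int set \<Rightarrow> (int \<Rightarrow> (real^'n) set) \<Rightarrow> real \<Rightarrow> ennreal"
  where "lv K G l = (\<integral>\<^sup>+x. ennreal (lvf K G l x) \<partial>lebesgue)"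

lemma lvf_nonneg: "0 \<le> lvf K G l x" unfolding lvf_def by (intro sum_nonneg) auto
lemma usum_nonneg: "0 \<le> usum K G x" unfolding usum_def by (intro sum_nonneg) auto

lemma usum_measurable:
  assumes [measurable]: "\<And>k. G k \<in> sets lebesgue"
  shows "usum K G \<in> borel_measurable lebesgue"
  unfolding usum_def[abs_def] by measurable

lemma lvf_measurable:
  assumes [measurable]: "\<And>k. G k \<in> sets lebesgue"
  shows "lvf K G l \<in> borel_measurable lebesgue"
  unfolding lvf_def[abs_def] by measurable

lemma usum_le:
  assumes "finite K" "\<And>k. k \<in> K \<Longrightarrow> x \<in> G k \<Longrightarrow> 2 powi k \<le> s" "0 \<le> s"
  shows "usum K G x \<le> 2 * s"
proof -
  let ?J = "{k \<in> K. x \<in> G k}"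
  have fin: "finite ?J" using assms by simp
  have eq: "usum K G x = (\<Sum>k\<in>?J. 2 powi k)"
    unfolding usum_def using assms(1) by (intro sum.mono_neutral_cong_right) (auto simp: indicator_def)
  show ?thesis
  proof (cases "?J = {}")
    case True then show ?thesis unfolding eq True using assms by simp
  next
    case False
    then have "usum K G x \<le> 2 * 2 powi Max ?J"
      unfolding eq using sum_powi2_le[OF fin, of "Max ?J"] fin by simp
    moreover have "Max ?J \<in> ?J" using False fin by (rule Max_in[rotated])
    ultimately show ?thesis using assms(2)[of "Max ?J"] by simp
  qed
qed

lemma lvf_le_usum:
  assumes "finite K" "0 < l" shows "lvf K G l x \<le> (usum K G x / l) powr P x"
proof -
  have "lvf K G l x = (\<Sum>k\<in>K. (2 powi k * indicator (G k) x / l) powr P x)"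
    unfolding lvf_def using P_ge_1(2)[of x] by (intro sum.cong) (auto simp: indicator_def)
  also have "\<dots> \<le> (\<Sum>k\<in>K. 2 powi k * indicator (G k) x / l) powr P x"
    using assms P_ge_1[of x] by (intro sum_powr_le_powr_sum) auto
  also have "(\<Sum>k\<in>K. 2 powi k * indicator (G k) x / l) = usum K G x / l"
    by (simp add: usum_def sum_divide_distrib)
  finally show ?thesis .
qed

text \<open>The largest term is at least half of the sum, and its power is one of the summands of
  \<open>lvf\<close>.\<close>

lemma usum_powr_le_lvf:
  assumes "finite K" "0 < l" shows "(usum K G x / (2 * l)) powr P x \<le> lvf K G l x"
proof (cases "usum K G x = 0")
  case True then show ?thesis by (simp add: lvf_nonneg)
next
  case False
  let ?J = "{k \<in> K. x \<in> G k}"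
  have fin: "finite ?J" using assms by simp
  have ne: "?J \<noteq> {}"
  proof
    assume "?J = {}"
    then have "usum K G x = 0" unfolding usum_def by (intro sum.neutral) (auto simp: indicator_def)
    then show False using False by simp
  qed
  have M: "Max ?J \<in> ?J" using ne fin by (rule Max_in[rotated])
  have "usum K G x \<le> 2 * 2 powi (Max ?J)"
    using assms(1) fin by (intro usum_le) (auto intro!: power_int_increasing Max_ge)
  then have "usum K G x / (2 * l) \<le> 2 powi (Max ?J) / l" using assms by (simp add: field_simps)
  then have "(usum K G x / (2 * l)) powr P x \<le> (2 powi (Max ?J) / l) powr P x"
    using assms P_ge_1[of x] usum_nonneg[of K G x] by (intro powr_mono2) auto
  also have "\<dots> = (2 powi (Max ?J) / l) powr P x * indicator (G (Max ?J)) x" using M by simp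
  also have "\<dots> \<le> lvf K G l x"
    unfolding lvf_def using M assms(1) by (intro member_le_sum[of "Max ?J"]) auto
  finally show ?thesis .
qed

lemma lv_le_rho: "finite K \<Longrightarrow> 0 < l \<Longrightarrow> lv K G l \<le> rho P (\<lambda>x. usum K G x / l)"
  unfolding lv_def rho_def by (intro nn_integral_mono ennreal_leI lvf_le_usum)

lemma rho_le_lv: "finite K \<Longrightarrow> 0 < l \<Longrightarrow> rho P (\<lambda>x. usum K G x / (2 * l)) \<le> lv K G l"
  unfolding lv_def rho_def by (intro nn_integral_mono ennreal_leI usum_powr_le_lvf)

lemma lv_mono_AE:
  assumes "K \<subseteq> K'" "finite K'" "AE x in lebesgue. \<forall>k\<in>K. x \<in> G k \<longrightarrow> x \<in> G' k"
  shows "lv K G l \<le> lv K' G' l"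
  unfolding lv_def
proof (rule nn_integral_mono_AE)
  show "AE x in lebesgue. ennreal (lvf K G l x) \<le> ennreal (lvf K' G' l x)"
    using assms(3)
  proof eventually_elim
    case (elim x)
    have "lvf K G l x \<le> lvf K G' l x"
      unfolding lvf_def using elim by (intro sum_mono mult_left_mono) (auto simp: indicator_def)
    also have "\<dots> \<le> lvf K' G' l x"
      unfolding lvf_def using assms by (intro sum_mono2) auto
    finally show ?case by (rule ennreal_leI)
  qed
qed

lemma lv_scale_up:
  assumes [measurable]: "\<And>k. G k \<in> sets lebesgue" and t: "0 < t" "t \<le> 1" and l: "0 < l"
  shows "lv K G (t * l) \<le> ennreal ((1 / t) powr pp) * lv K G l"
proof -
  note [measurable] = lvf_measurable[OF assms(1)]
  have "lvf K G (t * l) x \<le> (1 / t) powr pp * lvf K G l x" for x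
    unfolding lvf_def sum_distrib_left
  proof (rule sum_mono)
    fix k
    have "(1 / t * (2 powi k / l)) powr P x \<le> (1 / t) powr pp * (2 powi k / l) powr P x"
      using t l by (intro powr_P_scale_ge) auto
    then show "(2 powi k / (t * l)) powr P x * indicator (G k) x \<le> (1 / t) powr pp * ((2 powi k / l) powr P x * indicator (G k) x)"
      by (auto simp: indicator_def)
  qed
  then have "lv K G (t * l) \<le> (\<integral>\<^sup>+x. ennreal ((1 / t) powr pp) * ennreal (lvf K G l x) \<partial>lebesgue)"
    unfolding lv_def by (intro nn_integral_mono) (simp add: ennreal_leI lvf_nonneg flip: ennreal_mult')
  also have "\<dots> = ennreal ((1 / t) powr pp) * lv K G l"
    unfolding lv_def by (rule nn_integral_cmult) measurable
  finally show ?thesis .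
qed

lemma lv_scale_down:
  assumes [measurable]: "\<And>k. G k \<in> sets lebesgue" and t: "1 \<le> t" and l: "0 < l"
  shows "lv K G (t * l) \<le> ennreal (1 / t) * lv K G l"
proof -
  note [measurable] = lvf_measurable[OF assms(1)]
  have "lvf K G (t * l) x \<le> 1 / t * lvf K G l x" for x
    unfolding lvf_def sum_distrib_left
  proof (rule sum_mono)
    fix k
    have "(1 / t * (2 powi k / l)) powr P x \<le> 1 / t * (2 powi k / l) powr P x"
      using t l by (intro powr_P_scale_le) auto
    then show "(2 powi k / (t * l)) powr P x * indicator (G k) x \<le> 1 / t * ((2 powi k / l) powr P x * indicator (G k) x)"
      by (auto simp: indicator_def)
  qed
  then have "lv K G (t * l) \<le> (\<integral>\<^sup>+x. ennreal (1 / t) * ennreal (lvf K G l x) \<partial>lebesgue)"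
    unfolding lv_def using t by (intro nn_integral_mono) (simp add: ennreal_leI lvf_nonneg flip: ennreal_mult')
  also have "\<dots> = ennreal (1 / t) * lv K G l"
    unfolding lv_def by (rule nn_integral_cmult) measurable
  finally show ?thesis .
qed

lemma lv_antimono:
  assumes "\<And>k. G k \<in> sets lebesgue" "0 < l" "l \<le> l'"
  shows "lv K G l' \<le> lv K G l"
proof -
  have "lv K G (l' / l * l) \<le> ennreal (1 / (l' / l)) * lv K G l"
    using assms by (intro lv_scale_down) auto
  also have "\<dots> \<le> 1 * lv K G l" using assms by (intro mult_right_mono) (auto simp: ennreal_le_1)
  finally show ?thesis using assms by simp
qed

text \<open>Additivity in the sets is the advantage of \<open>lv\<close> over the modular of
  \<open>usum\<close>.\<close>

lemma lv_split:
  assumes [measurable]: "\<And>k. G k \<in> sets lebesgue" "\<And>k. E k \<in> sets lebesgue"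
  shows "lv K G l = lv K (\<lambda>k. G k \<inter> E k) l + lv K (\<lambda>k. G k - E k) l"
proof -
  have m: "G k \<inter> E k \<in> sets lebesgue" "G k - E k \<in> sets lebesgue" for k by auto
  note [measurable] = lvf_measurable[OF m(1)] lvf_measurable[OF m(2)]
  have "lvf K G l x = lvf K (\<lambda>k. G k \<inter> E k) l x + lvf K (\<lambda>k. G k - E k) l x" for x
    unfolding lvf_def sum.distrib[symmetric] by (intro sum.cong) (auto simp: indicator_def)
  then have "lv K G l = (\<integral>\<^sup>+x. ennreal (lvf K (\<lambda>k. G k \<inter> E k) l x) + ennreal (lvf K (\<lambda>k. G k - E k) l x) \<partial>lebesgue)"
    unfolding lv_def by (simp add: lvf_nonneg)
  also have "\<dots> = lv K (\<lambda>k. G k \<inter> E k) l + lv K (\<lambda>k. G k - E k) l"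
    unfolding lv_def by (rule nn_integral_add) measurable
  finally show ?thesis .
qed

text \<open>The function f, \<open>usum\<close> of F divided by 2 l, has modular at most 1. At a
  point of G k its average over a suitable cube is at least b 2^k / (2 l), hence so is h there. The
  constant collects a factor 2 from comparing \<open>lv\<close> with the modular, 2 from
  \<open>usum_le\<close>, and B / b.\<close>

lemma level_max:
  assumes K: "finite K" and F: "\<And>k. F k \<in> sets lebesgue"
    and b: "0 < b" and l: "0 < l"
    and dens: "\<And>k x. k \<in> K \<Longrightarrow> x \<in> G k \<Longrightarrow>
      \<exists>Q\<in>dcubes. x \<in> Q \<and> ennreal b * emeasure lebesgue Q \<le> emeasure lebesgue (F k \<inter> Q)"
    and F1: "lv K F l \<le> 1"
  shows "lv K G (4 * B / b * l) \<le> 1"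
proof -
  define f where "f x = usum K F x / (2 * l)" for x
  have f: "f \<in> borel_measurable lebesgue" "\<And>x. 0 \<le> f x"
    using usum_measurable[OF F, of K] l by (auto simp: f_def[abs_def] usum_nonneg)
  have "rho P f \<le> 1" using rho_le_lv[OF K l, of F] F1 unfolding f_def by (rule order_trans)
  then obtain h where h: "h \<in> borel_measurable lebesgue" "\<And>x. 0 \<le> h x" "rho P (\<lambda>x. h x / B) \<le> 1"
    and hQ: "AE x in lebesgue. \<forall>Q\<in>cubes. x \<in> Q \<longrightarrow>
           (\<integral>\<^sup>+y\<in>Q. ennreal (f y) \<partial>lebesgue) \<le> ennreal (h x) * emeasure lebesgue Q"
    using max_bound[OF f] by blast
  have "AE x in lebesgue. 0 \<le> usum K G x / (4 * B / b * l) \<and> usum K G x / (4 * B / b * l) \<le> h x / B"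
    using hQ
  proof eventually_elim
    case (elim x)
    have "2 powi k \<le> 2 * l * h x / b" if k: "k \<in> K" "x \<in> G k" for k
    proof -
      obtain Q where Q: "Q \<in> dcubes" "x \<in> Q" "ennreal b * emeasure lebesgue Q \<le> emeasure lebesgue (F k \<inter> Q)"
        using dens[OF k] by blast
      obtain i z where iz: "Q = dcube i z" using Q(1) by auto
      obtain Q' where Q': "Q' \<in> cubes" "Q \<subseteq> Q'" "emeasure lebesgue Q' = emeasure lebesgue Q"
        using dcube_in_cube[of i z] iz by metis
      obtain r where r: "emeasure lebesgue Q = ennreal r" "0 < r" using dcube_measure_obtain[OF Q(1)] by blast
      have Qs: "Q \<in> sets lebesgue" by (rule dcubes_sets[OF Q(1)])
      have "ennreal (2 powi k / (2 * l)) * (ennreal b * ennreal r) \<le> ennreal (2 powi k / (2 * l)) * emeasure lebesgue (F k \<inter> Q)"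
        using Q(3) r by (intro mult_left_mono) auto
      also have "\<dots> = (\<integral>\<^sup>+y\<in>F k \<inter> Q. ennreal (2 powi k / (2 * l)) \<partial>lebesgue)"
        using F Qs by (intro set_nn_integral_cmult_const[symmetric]) auto
      also have "\<dots> \<le> (\<integral>\<^sup>+y\<in>Q'. ennreal (f y) \<partial>lebesgue)"
      proof (rule nn_integral_mono)
        fix y
        have "2 powi k / (2 * l) \<le> f y" if "y \<in> F k"
        proof -
          have "2 powi k * indicator (F k) y \<le> usum K F y"
            unfolding usum_def using k K by (intro member_le_sum[of k]) auto
          then show ?thesis using that l by (simp add: f_def divide_right_mono)
        qed
        then show "ennreal (2 powi k / (2 * l)) * indicator (F k \<inter> Q) y \<le> ennreal (f y) * indicator Q' y"
          using Q'(2) by (auto simp: indicator_def intro: ennreal_leI)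
      qed
      also have "\<dots> \<le> ennreal (h x) * ennreal r"
        using bspec[OF elim Q'(1)] Q'(2,3) Q(2) r by auto
      also have "\<dots> = ennreal (h x * r)" using h(2) by (rule ennreal_mult'[symmetric])
      also have "ennreal (2 powi k / (2 * l)) * (ennreal b * ennreal r) = ennreal (2 powi k / (2 * l) * (b * r))"
        using b l by (subst ennreal_mult', simp)+ simp
      finally have "ennreal (2 powi k / (2 * l) * (b * r)) \<le> ennreal (h x * r)" .
      then have "2 powi k / (2 * l) * (b * r) \<le> h x * r" using h(2)[of x] r by (simp add: ennreal_le_iff)
      then show ?thesis using b l r by (simp add: field_simps)
    qed
    then have "usum K G x \<le> 2 * (2 * l * h x / b)" using K b l h(2)[of x] by (intro usum_le) auto
    then have "usum K G x / (4 * B / b * l) \<le> h x / B" using b l B by (simp add: field_simps)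
    then show ?case using usum_nonneg[of K G x] b l B by auto
  qed
  then have "rho P (\<lambda>x. usum K G x / (4 * B / b * l)) \<le> rho P (\<lambda>x. h x / B)" by (rule rho_mono_AE)
  moreover have "lv K G (4 * B / b * l) \<le> rho P (\<lambda>x. usum K G x / (4 * B / b * l))"
    using K b l B by (intro lv_le_rho) auto
  ultimately show ?thesis using h(3) by (meson order_trans)
qed

text \<open>If \<open>E\<^sub>k\<close> carried all but \<open>c0\<close> of the unit mass of the cubes, the complement would have so little mass that
  the maximal operator, which recovers the cubes from it, would give the cubes mass at most \<open>1/2\<close>.\<close>

definition c0 :: real where "c0 = (1 / (16 * B)) powr pp"
text \<open>Since theta^pp = 1 - c0, lowering the height by the factor theta increases
  \<open>lv\<close> by at most the factor 1 / (1 - c0), which turns mass 1 - c0 into mass 1.\<close>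

definition theta :: real where "theta = (1 - c0) powr (1 / pp)"

lemma c0: "0 < c0" "c0 \<le> 1/16"
proof -
  show "0 < c0" using B by (simp add: c0_def)
  have "c0 \<le> 1 / (16 * B)" unfolding c0_def using B pp_ge_1 by (intro powr_le_one_le) auto
  also have "\<dots> \<le> 1/16" using B by (simp add: field_simps)
  finally show "c0 \<le> 1/16" .
qed

lemma theta: "0 < theta" "theta < 1" "theta powr pp = 1 - c0"
proof -
  show "0 < theta" using c0 by (simp add: theta_def)
  show "theta powr pp = 1 - c0" using c0 pp_ge_1 by (simp add: theta_def powr_powr)
  have "(1 - c0) powr (1 / pp) < 1 powr (1 / pp)" using c0 pp_ge_1 by (intro powr_less_mono2) auto
  then show "theta < 1" by (simp add: theta_def)
qed

lemma level_step:
  assumes K: "finite K" and M: "\<And>k. \<M> k \<subseteq> dcubes"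
    and E[measurable]: "\<And>k. E k \<in> sets lebesgue"
    and EM: "AE x in lebesgue. \<forall>k\<in>K. x \<in> E k \<longrightarrow> x \<in> \<Union>(\<M> k)"
    and dens: "\<And>k Q. k \<in> K \<Longrightarrow> Q \<in> \<M> k \<Longrightarrow> emeasure lebesgue (E k \<inter> Q) \<le> ennreal (1/2) * emeasure lebesgue Q"
    and l: "0 < l" and le1: "lv K (\<lambda>k. \<Union>(\<M> k)) l \<le> 1"
  shows "lv K E (theta * l) \<le> 1"
proof (rule ccontr)
  assume "\<not> lv K E (theta * l) \<le> 1"
  then have gt: "1 < lv K E (theta * l)" by simp
  let ?G = "\<lambda>k. \<Union>(\<M> k)"
  let ?F = "\<lambda>k. ?G k - E k"
  have G[measurable]: "?G k \<in> sets lebesgue" for k by (rule Union_dcubes_sets[OF M])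
  have Fs: "?F k \<in> sets lebesgue" for k by auto
  have "ennreal (1 - c0) < lv K E l"
  proof (rule ccontr)
    assume "\<not> ?thesis"
    then have "lv K E l \<le> ennreal (1 - c0)" by simp
    then have "lv K E (theta * l) \<le> ennreal ((1 / theta) powr pp) * ennreal (1 - c0)"
      using lv_scale_up[OF E, of theta l K] theta l by (meson less_imp_le mult_left_mono order_trans zero_le)
    also have "\<dots> = ennreal ((1 / theta) powr pp * (1 - c0))" by (simp add: ennreal_mult')
    also have "(1 / theta) powr pp * (1 - c0) = 1"
      using theta c0 by (simp add: powr_divide)
    finally show False using gt by simp
  qed
  also have "lv K E l \<le> lv K (\<lambda>k. ?G k \<inter> E k) l"
    by (rule lv_mono_AE[OF order_refl K]) (use EM in auto)
  finally have big: "ennreal (1 - c0) < lv K (\<lambda>k. ?G k \<inter> E k) l" .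
  have split: "lv K ?G l = lv K (\<lambda>k. ?G k \<inter> E k) l + lv K ?F l" by (rule lv_split[OF G E])
  have F0: "lv K ?F l \<le> ennreal c0"
  proof -
    have "lv K (\<lambda>k. ?G k \<inter> E k) l + lv K ?F l \<le> 1" using split le1 by simp
    then obtain a b where ab: "lv K (\<lambda>k. ?G k \<inter> E k) l = ennreal a" "0 \<le> a" "lv K ?F l = ennreal b" "0 \<le> b"
      by (cases "lv K (\<lambda>k. ?G k \<inter> E k) l"; cases "lv K ?F l") (auto simp: top_unique)
    then have "a + b \<le> 1" using \<open>_ + _ \<le> 1\<close> by (simp flip: ennreal_plus add: ennreal_le_1)
    moreover have "1 - c0 < a" using big ab c0 by (simp add: ennreal_less_iff)
    ultimately show ?thesis using ab by (simp add: ennreal_leI)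
  qed
  \<comment> \<open>\<open>level_max\<close> with density 1/2 multiplies the height by 8 B, so that
    it leads from t l to l / 2; c0 is t^pp.\<close>
  define t where "t = 1 / (16 * B)"
  have t: "0 < t" "t \<le> 1" using B by (auto simp: t_def)
  have "lv K ?F (t * l) \<le> ennreal ((1 / t) powr pp) * ennreal c0"
    by (rule order_trans[OF lv_scale_up[OF Fs t l] mult_left_mono[OF F0]]) simp
  also have "\<dots> = ennreal ((1 / t) powr pp * c0)" by (simp add: ennreal_mult')
  also have "(1 / t) powr pp * c0 = 1"
    using B by (simp add: t_def c0_def powr_divide)
  finally have Ft: "lv K ?F (t * l) \<le> 1" by simp
  have "lv K ?G (4 * B / (1/2) * (t * l)) \<le> 1"
  proof (rule level_max[OF K Fs _ _ _ Ft])
    fix k x assume k: "k \<in> K" and "x \<in> \<Union>(\<M> k)"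
    then obtain Q where Q: "Q \<in> \<M> k" "x \<in> Q" by blast
    have QD: "Q \<in> dcubes" using Q M by blast
    have [measurable]: "Q \<in> sets lebesgue" by (rule dcubes_sets[OF QD])
    obtain r where r: "emeasure lebesgue Q = ennreal r" "0 < r" using dcube_measure_obtain[OF QD] by blast
    have EQ: "emeasure lebesgue (E k \<inter> Q) \<le> ennreal (r / 2)"
      using dens[OF k Q(1)] r by (simp add: ennreal_mult'[symmetric] del: ennreal_half)
    have "Q = (?F k \<inter> Q) \<union> (E k \<inter> Q)" using Q by auto
    then have "emeasure lebesgue Q \<le> emeasure lebesgue (?F k \<inter> Q) + emeasure lebesgue (E k \<inter> Q)"
      using emeasure_subadditive[of "?F k \<inter> Q" lebesgue "E k \<inter> Q"] Fs by simp
    also have "\<dots> \<le> emeasure lebesgue (?F k \<inter> Q) + ennreal (r / 2)" by (intro add_left_mono EQ)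
    finally have "ennreal (r / 2) \<le> emeasure lebesgue (?F k \<inter> Q)"
      using r by (cases "emeasure lebesgue (?F k \<inter> Q)") (auto simp flip: ennreal_plus simp: ennreal_le_iff)
    then have "ennreal (1/2) * emeasure lebesgue Q \<le> emeasure lebesgue (?F k \<inter> Q)"
      using r by (simp add: ennreal_mult'[symmetric] del: ennreal_half)
    then show "\<exists>Q\<in>dcubes. x \<in> Q \<and> ennreal (1/2) * emeasure lebesgue Q \<le> emeasure lebesgue (?F k \<inter> Q)"
      using Q QD by blast
  qed (use t l in auto)
  moreover have "4 * B / (1/2) * (t * l) = l / 2" using B by (simp add: t_def)
  ultimately have "lv K ?G (l / 2) \<le> 1" by (simp only:)
  \<comment> \<open>Returning from height l / 2 to l gains a factor 2 because P \<ge> 1. The cubes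
    would then have mass at most 1/2, less than their part in E alone.\<close>
  then have "lv K ?G (2 * (l / 2)) \<le> ennreal (1/2) * 1"
    using lv_scale_down[OF G, of 2 "l/2" K] l by (meson half_gt_zero mult_left_mono one_le_numeral order_trans zero_le)
  then have "lv K ?G l \<le> ennreal (1/2)" by simp
  moreover have "ennreal (1 - c0) < lv K ?G l"
    unfolding split by (rule less_le_trans[OF big add_increasing2[OF zero_le order_refl]])
  ultimately have "ennreal (1 - c0) < ennreal (1/2)" by (meson less_le_trans)
  then have "1 - c0 < 1/2" using c0 by (simp add: ennreal_less_iff del: ennreal_half)
  then show False using c0 by simp
qed

text \<open>At this height the selected cubes contain E with density at most 2^n beta = 1/2, as
  \<open>level_step\<close> requires, while beta < 1 ensures that they cover E up to a null
  set.\<close>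

definition beta :: real where "beta = 1 / (2 * 2 ^ CARD('n))"

lemma beta: "0 < beta" "beta \<le> 1/2" "2 ^ CARD('n) * beta = 1/2"
  by (auto simp: beta_def field_simps)

lemma cz_beta_upper:
  assumes "E \<in> sets lebesgue" "Q \<in> cz (indicator E) beta"
  shows "emeasure lebesgue (E \<inter> Q) \<le> ennreal (1/2) * emeasure lebesgue (Q :: (real^'n) set)"
proof -
  have "Q \<in> sets lebesgue" using assms cz_sets by blast
  then have "emeasure lebesgue (E \<inter> Q) \<le> 2 ^ CARD('n) * ennreal beta * emeasure lebesgue Q"
    using cz_upper[OF assms(2)] assms(1) by (simp add: set_nn_integral_indicator)
  also have "2 ^ CARD('n) * ennreal beta = ennreal (2 ^ CARD('n) * beta)"
    using beta by (simp add: ennreal_mult' flip: ennreal_power)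
  finally show ?thesis unfolding beta .
qed

lemma cz_beta_cover:
  fixes E :: "(real^'n) set"
  assumes [measurable]: "E \<in> sets lebesgue" and fin: "emeasure lebesgue E < \<infinity>"
  shows "AE x in lebesgue. x \<in> E \<longrightarrow> x \<in> \<Union>(cz (indicator E) beta)"
proof -
  have "AE x in lebesgue. x \<notin> \<Union>(cz (indicator E) beta) \<longrightarrow> indicator E x \<le> ennreal beta"
    using fin beta by (intro cz_AE_le) auto
  then show ?thesis
  proof eventually_elim
    case (elim x)
    have "\<not> 1 \<le> ennreal beta" using beta by (simp add: ennreal_le_1 flip: ennreal_1)
    then show ?case using elim by (auto simp: indicator_def)
  qed
qed

text \<open>Density is traded for height. E is replaced by the union of its cubes at height beta,
  whose density in the original cubes is larger by at most 1 / beta, so the induction hypothesis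
  applies to this union. E itself has density at most 1/2 in the new cubes, which gains one more
  factor theta.\<close>

lemma level_iterate:
  assumes K: "finite K" and M: "\<And>k. \<M> k \<subseteq> dcubes" "\<And>k. disjoint (\<M> k)"
    and E[measurable]: "\<And>k. E k \<in> sets lebesgue"
    and fin: "\<And>k. emeasure lebesgue (E k) < \<infinity>"
    and EM: "\<And>k. E k \<subseteq> \<Union>(\<M> k)"
    and dens: "\<And>k Q. Q \<in> \<M> k \<Longrightarrow> emeasure lebesgue (E k \<inter> Q) \<le> ennreal (beta ^ m / 2) * emeasure lebesgue Q"
    and l: "0 < l" and le1: "lv K (\<lambda>k. \<Union>(\<M> k)) l \<le> 1"
  shows "lv K E (theta ^ Suc m * l) \<le> 1"
  using E fin EM dens
proof (induction m arbitrary: E)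
  case 0
  have EMae: "AE x in lebesgue. \<forall>k\<in>K. x \<in> E k \<longrightarrow> x \<in> \<Union>(\<M> k)" using 0(3) by (intro AE_I2) blast
  show ?case using level_step[OF K M(1) 0(1) EMae _ l le1] 0(4) by simp
next
  case (Suc m)
  note Es[measurable] = Suc.prems(1)
  let ?N = "\<lambda>k. cz (indicator (E k)) beta"
  let ?E = "\<lambda>k. \<Union>(?N k)"
  have dens': "emeasure lebesgue (E k \<inter> Q) \<le> ennreal (beta * (beta ^ m / 2)) * emeasure lebesgue Q" if "Q \<in> \<M> k" for k Q
    using Suc.prems(4)[OF that] by simp
  have bm: "beta ^ m / 2 \<le> 1" "beta * (beta ^ m / 2) \<le> beta"
    using beta power_le_one[of beta m] by (auto simp: mult_le_cancel_left1)
  have "lv K ?E (theta ^ Suc m * l) \<le> 1"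
  proof (rule Suc.IH)
    fix k
    show "?E k \<in> sets lebesgue" by (rule cz_Union_sets)
    have "ennreal beta * emeasure lebesgue (?E k) \<le> (\<integral>\<^sup>+x\<in>?E k. indicator (E k) x \<partial>lebesgue)"
      by (rule cz_weak_type) auto
    also have "\<dots> \<le> emeasure lebesgue (E k)"
      by (subst set_nn_integral_indicator) (auto intro!: emeasure_mono cz_Union_sets)
    also have "\<dots> < \<infinity>" by (rule Suc.prems(2))
    finally show "emeasure lebesgue (?E k) < \<infinity>" using beta by (auto simp: ennreal_mult_less_top)
    show "?E k \<subseteq> \<Union>(\<M> k)"
      using cz_indicator_within[OF Es M Suc.prems(3) dens' bm(2)] by blast
    fix Q assume "Q \<in> \<M> k"
    then show "emeasure lebesgue (?E k \<inter> Q) \<le> ennreal (beta ^ m / 2) * emeasure lebesgue Q"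
      by (intro cz_indicator_density[OF Es M Suc.prems(3) dens' bm(1) beta(1)])
  qed
  then have "lv K E (theta * (theta ^ Suc m * l)) \<le> 1"
  proof (rule level_step[OF K cz_dcubes Es, rotated -1])
    have "AE x in lebesgue. x \<in> E k \<longrightarrow> x \<in> ?E k" for k
      by (rule cz_beta_cover[OF Es Suc.prems(2)])
    then show "AE x in lebesgue. \<forall>k\<in>K. x \<in> E k \<longrightarrow> x \<in> ?E k"
      by (simp only: AE_ball_countable[OF countable_finite[OF K]]) simp
  qed (use theta l cz_beta_upper[OF Es] in auto)
  then show ?case by (simp add: mult.assoc)
qed

section \<open>Good-lambda inequality\<close>

lemma lvf_empty: "lvf {} G l x = 0" by (simp only: lvf_def sum.empty)

lemma lvf_insert:
  "finite K \<Longrightarrow> k \<notin> K \<Longrightarrow> lvf (insert k K) G l x = (2 powi k / l) powr P x * indicator (G k) x + lvf K G l x"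
  unfolding lvf_def by (rule sum.insert)

text \<open>The proportion e is fixed before g, w and a, so that a may later be chosen small in
  terms of e. The constant D is used only for finiteness and for a limit and therefore does not
  affect the final bound. Each G (k + 1) is divided into its part in {w > a 2^k} and the part E k,
  which has small density in the cubes of G k and hence modular at most 1 already at a much smaller
  height. This permits halving the height l until it reaches L.\<close>

lemma good_lambda:
  obtains e :: real where "0 < e"
    "\<And>g w :: real^'n \<Rightarrow> real. \<And>a r D. g \<in> borel_measurable lebesgue \<Longrightarrow> (\<And>x. 0 \<le> g x) \<Longrightarrow>
       w \<in> borel_measurable lebesgue \<Longrightarrow> (\<And>x. 0 \<le> w x) \<Longrightarrow> rho P (\<lambda>x. w x / 4) \<le> 1 \<Longrightarrow>
       0 < a \<Longrightarrow> a \<le> 1 \<Longrightarrow> 0 \<le> D \<Longrightarrow> r < pm \<Longrightarrow>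
       (\<And>t. 0 < t \<Longrightarrow> emeasure lebesgue {x. t < g x} \<le> ennreal (D / t powr r)) \<Longrightarrow>
       (\<And>k Q. Q \<in> dcubes \<Longrightarrow> \<not> (AE x in lebesgue. x \<in> Q \<longrightarrow> a * 2 powi k < w x) \<Longrightarrow>
          \<exists>c. emeasure lebesgue {x \<in> Q. 2 powi k / 2 < \<bar>g x - c\<bar>} \<le> ennreal e * emeasure lebesgue Q) \<Longrightarrow>
       rho P (\<lambda>x. g x / (96 / a)) \<le> 1"
proof -
  \<comment> \<open>Enough refinements to compensate the factor 4 B / beta of
    \<open>level_max\<close> and to gain 12 in addition: 2 for halving the height, 2 for the shift
    from k + 1 to k, and 3 for a modular of at most 1/3.\<close>
  obtain m0 where m0: "theta ^ m0 < beta / (48 * B)"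
    using real_arch_pow_inv[of "beta / (48 * B)" theta] beta B theta by auto
  define m where "m = Suc m0"
  have "theta ^ Suc m \<le> theta ^ m0"
    unfolding m_def using theta by (intro power_decreasing) auto
  then have "theta ^ Suc m * (4 * B / beta) \<le> beta / (48 * B) * (4 * B / beta)"
    using m0 beta B by (intro mult_right_mono) auto
  also have "\<dots> = 1 / 12" using beta(1) B by (simp add: field_simps)
  finally have m: "theta ^ Suc m * (4 * B / beta) \<le> 1 / 12" .
  define e where "e = beta ^ m / 2"
  have e: "0 < e" using beta by (simp add: e_def)
  have "beta ^ m \<le> beta ^ 1" unfolding m_def using beta by (intro power_decreasing) auto
  then have e4: "e \<le> 1/4" using beta by (simp add: e_def)
  show thesis
  proof (rule that[OF e])
    fix g w :: "real^'n \<Rightarrow> real" and a r D :: real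
    assume g[measurable]: "g \<in> borel_measurable lebesgue" and g0: "\<And>x. 0 \<le> g x"
      and w[measurable]: "w \<in> borel_measurable lebesgue" and w0: "\<And>x. 0 \<le> w x"
      and wrho: "rho P (\<lambda>x. w x / 4) \<le> 1"
      and a: "0 < a" "a \<le> 1" and D: "0 \<le> D" and r: "r < pm"
      and weak: "\<And>t. 0 < t \<Longrightarrow> emeasure lebesgue {x. t < g x} \<le> ennreal (D / t powr r)"
      and osc: "\<And>k Q. Q \<in> dcubes \<Longrightarrow> \<not> (AE x in lebesgue. x \<in> Q \<longrightarrow> a * 2 powi k < w x) \<Longrightarrow>
          \<exists>c. emeasure lebesgue {x \<in> Q. 2 powi k / 2 < \<bar>g x - c\<bar>} \<le> ennreal e * emeasure lebesgue Q"
    \<comment> \<open>The sets W k have modular at most 1 at height 8 / a and at most 1/3 at height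
      24 / a; the shift of the levels costs another factor 2.\<close>
    define L where "L = 48 / a"
    have L: "1 \<le> L" "0 < L" using a by (auto simp: L_def field_simps)
    define G where "G k = {x. 2 powi k < g x}" for k :: int
    have [measurable]: "{x. t < g x} \<in> sets lebesgue" "{x. t < w x} \<in> sets lebesgue" for t
      using superlevel_sets[OF g] superlevel_sets[OF w] by simp_all
    have Gs[measurable]: "G k \<in> sets lebesgue" for k unfolding G_def by measurable
    have Gfin: "emeasure lebesgue (G k) < \<infinity>" for k
      using weak[of "2 powi k"] unfolding G_def by (auto intro: le_less_trans)
    define W where "W k = {x. a * 2 powi k < w x}" for k :: int
    have Ws[measurable]: "W k \<in> sets lebesgue" for k unfolding W_def by measurable
    define \<M> where "\<M> k = cz (indicator (G k)) beta" for k
    define E where "E k = (G (k + 1) - W k) \<inter> \<Union>(\<M> k)" for k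
    have Ms[measurable]: "\<Union>(\<M> k) \<in> sets lebesgue" for k unfolding \<M>_def by (rule cz_Union_sets)
    have Es[measurable]: "E k \<in> sets lebesgue" for k unfolding E_def by measurable
    have Gsub: "G (k + 1) \<subseteq> G k" for k
      using power_int_strict_increasing[of k "k + 1" "2::real"] by (auto simp: G_def)
    have MD: "\<M> k \<subseteq> dcubes" "disjoint (\<M> k)" for k unfolding \<M>_def by (rule cz_dcubes cz_disjoint)+
    have GM: "AE x in lebesgue. x \<in> G k \<longrightarrow> x \<in> \<Union>(\<M> k)" for k
      unfolding \<M>_def by (rule cz_beta_cover[OF Gs Gfin])
    have Edens: "emeasure lebesgue (E k \<inter> Q) \<le> ennreal (beta ^ m / 2) * emeasure lebesgue Q" if Q: "Q \<in> \<M> k" for k Q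
    proof (cases "AE x in lebesgue. x \<in> Q \<longrightarrow> a * 2 powi k < w x")
      \<comment> \<open>Up to a null set Q lies in W k, which E k avoids.\<close>
      case True
      have [measurable]: "Q \<in> sets lebesgue" using Q MD dcubes_sets by blast
      have "AE x in lebesgue. x \<notin> E k \<inter> Q" using True by eventually_elim (auto simp: E_def W_def)
      then have "emeasure lebesgue (E k \<inter> Q) = 0" by (simp add: AE_iff_null null_sets_def Int_def)
      then show ?thesis by simp
    next
      case False
      have QD: "Q \<in> dcubes" using Q MD by blast
      have [measurable]: "Q \<in> sets lebesgue" by (rule dcubes_sets[OF QD])
      obtain q where q: "emeasure lebesgue Q = ennreal q" "0 < q" using dcube_measure_obtain[OF QD] by blast
      obtain c where c: "emeasure lebesgue {x \<in> Q. 2 powi k / 2 < \<bar>g x - c\<bar>} \<le> ennreal e * emeasure lebesgue Q"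
        using osc[OF QD False] by blast
      let ?H = "{x \<in> Q. 2 powi k / 2 < \<bar>g x - c\<bar>}"
      have "{x. 2 powi k / 2 < \<bar>g x - c\<bar>} \<in> sets lebesgue"
        using superlevel_sets[of "\<lambda>x. \<bar>g x - c\<bar>" lebesgue "2 powi k / 2"] by simp
      then have "Q \<inter> {x. 2 powi k / 2 < \<bar>g x - c\<bar>} \<in> sets lebesgue" by auto
      then have Hs[measurable]: "?H \<in> sets lebesgue" by (simp add: Int_def)
      \<comment> \<open>Both sets together fill at most 1/2 + 1/4 of Q. A point outside them ties c
        to the level: c is at most 3/2 times 2^k, so a value of g above 2^(k + 1) deviates from c by
        more than 2^k / 2.\<close>
      have "\<not> Q \<subseteq> (G k \<inter> Q) \<union> ?H"
      proof
        assume "Q \<subseteq> (G k \<inter> Q) \<union> ?H"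
        then have "emeasure lebesgue Q \<le> emeasure lebesgue ((G k \<inter> Q) \<union> ?H)" by (intro emeasure_mono) auto
        also have "\<dots> \<le> emeasure lebesgue (G k \<inter> Q) + emeasure lebesgue ?H" by (intro emeasure_subadditive) auto
        also have "\<dots> \<le> ennreal (1/2) * emeasure lebesgue Q + ennreal e * emeasure lebesgue Q"
          using cz_beta_upper[OF Gs Q[unfolded \<M>_def]] c by (intro add_mono)
        also have "\<dots> = ennreal (1/2 * q + e * q)"
          unfolding q using q e by (subst (1 2) ennreal_mult'[symmetric]) (auto simp: ennreal_plus)
        finally have "ennreal q \<le> ennreal (1/2 * q + e * q)" unfolding q .
        moreover have "0 \<le> 1/2 * q + e * q" using q e by simp
        ultimately have "q \<le> 1/2 * q + e * q" by (simp only: ennreal_le_iff)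
        moreover have "e * q \<le> 1/4 * q" using e4 q by (intro mult_right_mono) auto
        ultimately show False using q by simp
      qed
      then obtain x where "x \<in> Q" "x \<notin> G k" "x \<notin> ?H" by blast
      then have x: "x \<in> Q" "g x \<le> 2 powi k" "\<bar>g x - c\<bar> \<le> 2 powi k / 2" by (auto simp: G_def)
      have "E k \<inter> Q \<subseteq> ?H"
      proof
        fix y assume "y \<in> E k \<inter> Q"
        then have y: "2 powi (k + 1) < g y" "y \<in> Q" by (auto simp: E_def G_def)
        have "(2::real) powi (k + 1) = 2 * 2 powi k" using power_int_add_1'[of "2::real" k] by simp
        then have "2 powi k / 2 < \<bar>g y - c\<bar>" using y x by (simp add: abs_if split: if_splits)
        then show "y \<in> ?H" using y by simp
      qed
      then have "emeasure lebesgue (E k \<inter> Q) \<le> emeasure lebesgue ?H" by (intro emeasure_mono) auto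
      then show ?thesis using c unfolding e_def by (rule order_trans)
    qed
    have Efin: "emeasure lebesgue (E k) < \<infinity>" for k
      by (rule le_less_trans[OF emeasure_mono Gfin[of "k + 1"]]) (auto simp: E_def)
    have EM: "E k \<subseteq> \<Union>(\<M> k)" for k by (auto simp: E_def)
    have good: "lv K E (l / 12) \<le> 1" if K: "finite K" and l: "0 < l" and 1: "lv K G l \<le> 1" for K l
    proof -
      have b4: "0 < 4 * B / beta * l" using beta B l by auto
      have M1: "lv K (\<lambda>k. \<Union>(\<M> k)) (4 * B / beta * l) \<le> 1"
      proof (rule level_max[OF K Gs beta(1) l _ 1])
        fix k x assume "x \<in> \<Union>(\<M> k)"
        then obtain Q where Q: "Q \<in> \<M> k" "x \<in> Q" by blast
        then have QD: "Q \<in> dcubes" using MD by blast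
        have "ennreal beta * emeasure lebesgue Q \<le> emeasure lebesgue (G k \<inter> Q)"
          using cz_lower[OF Q(1)[unfolded \<M>_def]] Gs[of k] dcubes_sets[OF QD]
          by (simp add: set_nn_integral_indicator)
        then show "\<exists>Q\<in>dcubes. x \<in> Q \<and> ennreal beta * emeasure lebesgue Q \<le> emeasure lebesgue (G k \<inter> Q)"
          using Q QD by blast
      qed
      have E1: "lv K E (theta ^ Suc m * (4 * B / beta * l)) \<le> 1"
        by (rule level_iterate[OF K MD Es Efin EM Edens b4 M1])
      have "lv K E (l / 12) \<le> lv K E (theta ^ Suc m * (4 * B / beta * l))"
      proof (rule lv_antimono[OF Es])
        show "0 < theta ^ Suc m * (4 * B / beta * l)"
          by (rule mult_pos_pos[OF zero_less_power[OF theta(1)] b4])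
        show "theta ^ Suc m * (4 * B / beta * l) \<le> l / 12"
          using mult_right_mono[OF m less_imp_le[OF l]] unfolding mult.assoc by simp
      qed
      then show ?thesis using E1 by (rule order_trans)
    qed
    have Wlv: "lv K W l \<le> ennreal (1/3)" if K: "finite K" and l: "24 / a \<le> l" for K l
    proof -
      have "lv K W (8 / a) \<le> rho P (\<lambda>x. usum K W x / (8 / a))" using K a by (intro lv_le_rho) auto
      also have "\<dots> \<le> rho P (\<lambda>x. w x / 4)"
      proof (rule rho_mono_AE, rule AE_I2)
        fix x
        have "usum K W x \<le> 2 * (w x / a)"
          using K w0[of x] a by (intro usum_le) (auto simp: W_def field_simps)
        then have "usum K W x / (8 / a) \<le> w x / 4" using a by (simp add: field_simps)
        then show "0 \<le> usum K W x / (8 / a) \<and> usum K W x / (8 / a) \<le> w x / 4"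
          using usum_nonneg[of K W x] a by auto
      qed
      finally have 1: "lv K W (8 / a) \<le> 1" using wrho by (rule order_trans)
      have "lv K W l \<le> lv K W (3 * (8 / a))" using a l by (intro lv_antimono[OF Ws]) auto
      also have "\<dots> \<le> ennreal (1/3) * lv K W (8 / a)" using a by (intro lv_scale_down[OF Ws]) auto
      also have "\<dots> \<le> ennreal (1/3) * 1" by (intro mult_left_mono 1) simp
      finally show ?thesis by simp
    qed
    \<comment> \<open>The contribution of the lowest height, for which there is no level below. By
      the weak type it tends to 0 as N grows, because r < pm.\<close>
    define bot where "bot N = lv {- int N} G L" for N
    have bot_bound: "bot N \<le> ennreal (D * (2 powr (r - pm)) ^ N)" for N
    proof -
      have pt: "lvf {- int N} G L x \<le> (2 powr (- pm)) ^ N * indicator (G (- int N)) x" for x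
      proof -
        have p2: "(2::real) powi (- int N) = 2 powr (- real N)"
          by (simp add: powr_minus powr_realpow power_int_minus)
        have "2 powi (- int N) / L \<le> 2 powi (- int N)" using L by (simp add: divide_le_eq)
        then have "(2 powi (- int N) / L) powr P x \<le> (2 powi (- int N)) powr P x"
          using L P_ge_1[of x] by (intro powr_mono2) auto
        also have "\<dots> = 2 powr (- (real N * P x))" unfolding p2 by (simp add: powr_powr)
        also have "\<dots> \<le> 2 powr (- (real N * pm))" using P_low[of x] by (intro powr_mono) (auto intro!: mult_left_mono)
        also have "\<dots> = (2 powr (- pm)) ^ N"
          by (simp add: powr_realpow[symmetric] powr_powr mult.commute)
        finally show ?thesis by (auto simp: lvf_def indicator_def)
      qed
      have "bot N \<le> (\<integral>\<^sup>+x\<in>G (- int N). ennreal ((2 powr (- pm)) ^ N) \<partial>lebesgue)"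
        unfolding bot_def lv_def
      proof (rule nn_integral_mono)
        fix x
        show "ennreal (lvf {- int N} G L x) \<le> ennreal ((2 powr (- pm)) ^ N) * indicator (G (- int N)) x"
          using ennreal_leI[OF pt[of x]] by (cases "x \<in> G (- int N)") simp_all
      qed
      also have "\<dots> = ennreal ((2 powr (- pm)) ^ N) * emeasure lebesgue (G (- int N))"
        by (rule set_nn_integral_cmult_const[OF Gs])
      also have "\<dots> \<le> ennreal ((2 powr (- pm)) ^ N) * ennreal (D / (2 powi (- int N)) powr r)"
        unfolding G_def by (intro mult_left_mono weak) auto
      also have "\<dots> = ennreal ((2 powr (- pm)) ^ N * (D / (2 powi (- int N)) powr r))"
        by (subst ennreal_mult') auto
      also have "(2 powr (- pm)) ^ N * (D / (2 powi (- int N)) powr r) = D * (2 powr (r - pm)) ^ N"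
      proof -
        have p2: "(2::real) powi (- int N) = 2 powr (- real N)"
          by (simp add: powr_minus powr_realpow power_int_minus)
        have q: "(2 powr s) ^ N = (2::real) powr (s * real N)" for s
          by (simp add: powr_realpow[symmetric] powr_powr)
        have i: "D / (2 powr (- real N)) powr r = D * 2 powr (r * real N)"
          unfolding powr_powr by (simp add: powr_minus mult.commute divide_inverse)
        have j: "2 powr (- pm * real N) * 2 powr (r * real N) = (2::real) powr ((r - pm) * real N)"
          by (simp add: powr_add[symmetric] algebra_simps)
        show ?thesis unfolding p2 q i j[symmetric] by simp
      qed
      finally show ?thesis .
    qed
    have "2 powr (r - pm) < 1" using r powr_less_mono[of "r - pm" 0 2] by simp
    then have "(\<lambda>N. D * (2 powr (r - pm)) ^ N) \<longlonglongrightarrow> D * 0"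
      by (intro tendsto_mult tendsto_const LIMSEQ_realpow_zero) simp_all
    then have "eventually (\<lambda>N. D * (2 powr (r - pm)) ^ N < 1/3) sequentially"
      by (rule order_tendstoD) simp
    then obtain N0 where N0: "\<And>N. N0 \<le> N \<Longrightarrow> D * (2 powr (r - pm)) ^ N < 1/3"
      unfolding eventually_sequentially by blast
    have step: "lv {- int N..<int N} G l' \<le> 1"
      if N: "N0 \<le> N" and l: "0 < l" "lv {- int N..<int N} G l \<le> 1" and l': "l / 2 \<le> l'" "L \<le> l'" for N l l'
    proof (cases "N = 0")
      case True then show ?thesis by (simp add: lv_def lvf_def)
    next
      case False
      let ?K = "{- int N..<int N}" and ?K' = "{- int N..<int N - 1}"
      have l'0: "0 < l'" using l' L by simp
      \<comment> \<open>The levels above the lowest are written as k + 1; the height 2^(k + 1)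
        relative to l' is 2^k relative to l' / 2.\<close>
      have K: "?K = insert (- int N) ((\<lambda>k. k + 1) ` ?K')"
        using False by (auto simp: image_iff Bex_def)
      have "lvf ?K G l' x = lvf {- int N} G l' x + lvf ?K' (\<lambda>k. G (k + 1)) (l' / 2) x" for x
      proof -
        let ?t = "(2 powi (- int N) / l') powr P x * indicator (G (- int N)) x"
        have "lvf ?K G l' x = ?t + lvf ((\<lambda>k. k + 1) ` ?K') G l' x"
          unfolding K by (rule lvf_insert) auto
        also have "?t = lvf {- int N} G l' x"
          using lvf_insert[OF finite.emptyI equals0D[OF refl], of "- int N" G l' x] by (simp only: lvf_empty add_0_right)
        also have "lvf ((\<lambda>k. k + 1) ` ?K') G l' x = lvf ?K' (\<lambda>k. G (k + 1)) (l' / 2) x"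
          unfolding lvf_def by (subst sum.reindex) (auto simp: inj_on_def power_int_add_1' ac_simps intro!: sum.cong)
        finally show ?thesis .
      qed
      then have "lv ?K G l' = (\<integral>\<^sup>+x. ennreal (lvf {- int N} G l' x) + ennreal (lvf ?K' (\<lambda>k. G (k + 1)) (l' / 2) x) \<partial>lebesgue)"
        unfolding lv_def by (simp add: lvf_nonneg)
      also have "\<dots> = lv {- int N} G l' + lv ?K' (\<lambda>k. G (k + 1)) (l' / 2)"
        unfolding lv_def using lvf_measurable[OF Gs] by (intro nn_integral_add) (auto intro!: lvf_measurable)
      also have "lv {- int N} G l' \<le> ennreal (1/3)"
      proof -
        have "lv {- int N} G l' \<le> bot N" unfolding bot_def using L l' by (intro lv_antimono[OF Gs]) auto
        also have "\<dots> \<le> ennreal (1/3)"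
          using bot_bound[of N] N0[OF N] by (meson ennreal_leI less_imp_le order_trans)
        finally show ?thesis .
      qed
      also have "lv ?K' (\<lambda>k. G (k + 1)) (l' / 2) \<le> lv ?K (\<lambda>k. G (k + 1)) (l' / 2)"
        by (rule lv_mono_AE) auto
      also have "lv ?K (\<lambda>k. G (k + 1)) (l' / 2) = lv ?K (\<lambda>k. G (k + 1) \<inter> W k) (l' / 2) + lv ?K (\<lambda>k. G (k + 1) - W k) (l' / 2)"
        by (rule lv_split[OF Gs Ws])
      also have "lv ?K (\<lambda>k. G (k + 1) \<inter> W k) (l' / 2) \<le> lv ?K W (l' / 2)"
        by (rule lv_mono_AE) auto
      also have "lv ?K W (l' / 2) \<le> ennreal (1/3)" using l' by (intro Wlv) (auto simp: L_def)
      also have "lv ?K (\<lambda>k. G (k + 1) - W k) (l' / 2) \<le> lv ?K E (l' / 2)"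
      proof (rule lv_mono_AE)
        have "AE x in lebesgue. \<forall>k. x \<in> G k \<longrightarrow> x \<in> \<Union>(\<M> k)"
          unfolding AE_all_countable using GM by blast
        then show "AE x in lebesgue. \<forall>k\<in>?K. x \<in> G (k + 1) - W k \<longrightarrow> x \<in> E k"
        proof eventually_elim
          case (elim x)
          show ?case
          proof (intro ballI impI)
            fix k assume x: "x \<in> G (k + 1) - W k"
            then have "x \<in> \<Union>(\<M> k)" using elim Gsub[of k] by blast
            then show "x \<in> E k" using x by (simp add: E_def)
          qed
        qed
      qed auto
      also have "lv ?K E (l' / 2) \<le> lv ?K E (3 * (l / 12))" using l l' by (intro lv_antimono[OF Es]) auto
      also have "\<dots> \<le> ennreal (1/3) * lv ?K E (l / 12)" using l by (intro lv_scale_down[OF Es]) auto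
      also have "\<dots> \<le> ennreal (1/3) * 1" by (intro mult_left_mono good l) auto
      also have "ennreal (1/3) + (ennreal (1/3) + ennreal (1/3) * 1) = 1"
        unfolding mult_1_right by (subst ennreal_plus[symmetric], simp, simp)+ simp
      finally show ?thesis by (simp add: add_left_mono)
    qed
    have main: "lv {- int N..<int N} G L \<le> 1" if N: "N0 \<le> N" for N
    proof -
      let ?K = "{- int N..<int N}"
      \<comment> \<open>Finitely many sets of finite measure. The bound depends on N but merely
        starts the halving, which ends at L for every large N.\<close>
      have "lv ?K G 1 < \<infinity>"
      proof -
        have "lvf ?K G 1 x \<le> (\<Sum>k\<in>?K. max 1 (2 powi k) powr pp * indicator (G k) x)" for x
          unfolding lvf_def
        proof (intro sum_mono mult_right_mono)
          fix k :: int
          have "(2 powi k / 1) powr P x \<le> max 1 (2 powi k) powr P x" using P_ge_1[of x] by (intro powr_mono2) auto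
          also have "\<dots> \<le> max 1 (2 powi k) powr pp" using P_up by (intro powr_mono) auto
          finally show "(2 powi k / 1) powr P x \<le> max 1 (2 powi k) powr pp" .
        qed simp
        then have "lv ?K G 1 \<le> (\<integral>\<^sup>+x. (\<Sum>k\<in>?K. ennreal (max 1 (2 powi k) powr pp) * indicator (G k) x) \<partial>lebesgue)"
          unfolding lv_def
        proof (intro nn_integral_mono)
          fix x
          have "ennreal (lvf ?K G 1 x) \<le> ennreal (\<Sum>k\<in>?K. max 1 (2 powi k) powr pp * indicator (G k) x)"
            by (intro ennreal_leI) fact
          also have "\<dots> = (\<Sum>k\<in>?K. ennreal (max 1 (2 powi k) powr pp * indicator (G k) x))"
            by (rule sum_ennreal[symmetric]) auto
          also have "\<dots> = (\<Sum>k\<in>?K. ennreal (max 1 (2 powi k) powr pp) * indicator (G k) x)"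
            by (intro sum.cong) (auto simp: indicator_def)
          finally show "ennreal (lvf ?K G 1 x) \<le> \<dots>" .
        qed
        also have "\<dots> = (\<Sum>k\<in>?K. ennreal (max 1 (2 powi k) powr pp) * emeasure lebesgue (G k))"
          by (subst nn_integral_sum) (auto simp: nn_integral_cmult_indicator)
        also have "\<dots> < \<infinity>" using Gfin by (simp add: ennreal_mult_less_top)
        finally show ?thesis .
      qed
      then obtain v where v: "lv ?K G 1 = ennreal v" "0 \<le> v" by (cases "lv ?K G 1") auto
      define l0 where "l0 = max 1 v"
      have l01: "1 \<le> l0" by (simp add: l0_def)
      have "lv ?K G (l0 * 1) \<le> ennreal (1 / l0) * lv ?K G 1" by (rule lv_scale_down[OF Gs l01]) simp
      also have "\<dots> = ennreal (1 / l0 * v)" unfolding v(1) using l01 by (intro ennreal_mult'[symmetric]) simp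
      also have "\<dots> \<le> 1" using l01 by (simp add: l0_def divide_le_eq ennreal_le_1)
      finally have l0: "lv ?K G l0 \<le> 1" by simp
      have "lv ?K G (max (l0 / 2 ^ j) L) \<le> 1" for j
      proof (induction j)
        case 0
        have "lv ?K G (max l0 L) \<le> lv ?K G l0" using l01 by (intro lv_antimono[OF Gs]) auto
        then show ?case using l0 by simp
      next
        case (Suc j)
        show ?case
          by (rule step[OF N _ Suc]) (use L l01 in \<open>auto simp: max_def field_simps\<close>)
      qed
      note all_j = this
      obtain j where "l0 < 2 ^ j" using real_arch_pow[of 2 l0] by auto
      then have "l0 / 2 ^ j \<le> 1" by (simp add: divide_le_eq)
      then have "max (l0 / 2 ^ j) L = L" using L(1) by (intro max_absorb2) linarith
      then show ?thesis using all_j[of j] by (simp only:)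
    qed
    define F where "F N x = ennreal (lvf {- int N..<int N} G L x)" for N x
    have Fm: "F N \<in> borel_measurable lebesgue" for N
      unfolding F_def by (intro measurable_compose[OF lvf_measurable[OF Gs] measurable_ennreal])
    have Finc: "incseq F"
      unfolding F_def incseq_def le_fun_def lvf_def
      by (intro allI impI ennreal_leI sum_mono2) auto
    have "rho P (\<lambda>x. g x / (96 / a)) \<le> (\<integral>\<^sup>+x. (SUP N. F N x) \<partial>lebesgue)"
      unfolding rho_def
    proof (rule nn_integral_mono)
      fix x
      show "ennreal ((g x / (96 / a)) powr P x) \<le> (SUP N. F N x)"
      proof (cases "g x = 0")
        case False
        then have gx: "0 < g x" using g0[of x] by simp
        \<comment> \<open>The level with 2^k < g x \<le> 2^(k + 1), strict below as in G k. The
          upper bound accounts for the factor 2 between L and 96 / a.\<close>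
        define k where "k = \<lceil>log 2 (g x)\<rceil> - 1"
        have "real_of_int k < log 2 (g x)" "log 2 (g x) \<le> real_of_int k + 1" unfolding k_def by linarith+
        then have "2 powr real_of_int k < g x" "g x \<le> 2 powr (real_of_int k + 1)"
          using gx by (auto simp: less_log_iff log_le_iff)
        then have k: "2 powi k < g x" "g x \<le> 2 * 2 powi k"
          by (auto simp: powr_real_of_int' powr_add)
        define N where "N = nat \<bar>k\<bar> + 1"
        have kN: "k \<in> {- int N..<int N}" by (auto simp: N_def)
        have "g x / (96 / a) \<le> 2 powi k / L" using k a by (simp add: L_def field_simps)
        then have "(g x / (96 / a)) powr P x \<le> (2 powi k / L) powr P x"
          using gx a P_ge_1[of x] by (intro powr_mono2) auto
        also have "\<dots> = (2 powi k / L) powr P x * indicator (G k) x" using k by (simp add: G_def)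
        also have "\<dots> \<le> lvf {- int N..<int N} G L x"
          unfolding lvf_def using kN by (intro member_le_sum[of k]) auto
        finally have "ennreal ((g x / (96 / a)) powr P x) \<le> F N x" unfolding F_def by (rule ennreal_leI)
        also have "\<dots> \<le> (SUP N. F N x)" by (rule SUP_upper) simp
        finally show ?thesis .
      qed simp
    qed
    also have "\<dots> = (SUP N. \<integral>\<^sup>+x. F N x \<partial>lebesgue)"
      by (rule nn_integral_monotone_convergence_SUP[OF Finc Fm])
    also have "\<dots> \<le> 1"
    proof (rule SUP_least)
      fix N
      have "F N x \<le> F (max N N0) x" for x using Finc by (auto simp: incseq_def le_fun_def)
      then have "(\<integral>\<^sup>+x. F N x \<partial>lebesgue) \<le> (\<integral>\<^sup>+x. F (max N N0) x \<partial>lebesgue)" by (intro nn_integral_mono)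
      also have "\<dots> \<le> 1" using main[of "max N N0"] unfolding F_def lv_def by simp
      finally show "(\<integral>\<^sup>+x. F N x \<partial>lebesgue) \<le> 1" .
    qed
    finally show "rho P (\<lambda>x. g x / (96 / a)) \<le> 1" .
  qed
qed

end

section \<open>Bounded functions with compact support\<close>

text \<open>Each point off the support lies in a dyadic cube on which f vanishes a.e., and as there
  are only countably many dyadic cubes the null sets can be combined.\<close>

lemma ess_support_AE:
  fixes f :: "'n::finite cfun"
  shows "AE x in lebesgue. x \<notin> ess_support f \<longrightarrow> f x = 0"
proof -
  let ?N = "{R \<in> dcubes. AE y in lebesgue. y \<in> R \<longrightarrow> f y = 0}"
  have "countable ?N" by (rule countable_dcubes_subset) auto
  then have "AE y in lebesgue. \<forall>R\<in>?N. y \<in> R \<longrightarrow> f y = 0"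
    by (subst AE_ball_countable) auto
  then show ?thesis
  proof eventually_elim
    case (elim x)
    show ?case
    proof
      assume "x \<notin> ess_support f"
      then obtain V where V: "open V" "x \<in> V" "AE y in lebesgue. y \<in> V \<longrightarrow> f y = 0"
        by (auto simp: ess_support_def)
      obtain k where k: "dcube k x \<subseteq> V" using small_dcube_in_open[OF V(1,2)] by blast
      have "AE y in lebesgue. y \<in> dcube k x \<longrightarrow> f y = 0"
        using V(3) by eventually_elim (use k in blast)
      then have "dcube k x \<in> ?N" by simp
      from bspec[OF elim this] show "f x = 0" using self_in_dcube[of x k] by simp
    qed
  qed
qed

lemma closed_ess_support: "closed (ess_support f)"
proof -
  have "open (- ess_support f)"
  proof (subst open_subopen, intro ballI)
    fix x assume "x \<in> - ess_support f"
    then obtain V where V: "open V" "x \<in> V" "AE y in lebesgue. y \<in> V \<longrightarrow> f y = 0"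
      by (auto simp: ess_support_def)
    then have "V \<subseteq> - ess_support f" by (auto simp: ess_support_def)
    then show "\<exists>T. open T \<and> x \<in> T \<and> T \<subseteq> - ess_support f" using V by blast
  qed
  then show ?thesis by (simp add: closed_def)
qed

lemma not_in_ess_supportI:
  assumes "open V" "x \<in> V" "\<And>y. y \<in> V \<Longrightarrow> f y = 0" shows "x \<notin> ess_support f"
  using assms by (auto simp: ess_support_def)

text \<open>One natural number bounds both the values and the support, which turns the topological
  condition into a single almost everywhere statement.\<close>

lemma L0inf_iff:
  "f \<in> L0inf \<longleftrightarrow> f \<in> meas_funs \<and> (\<exists>R::nat. AE x in lebesgue. cmod (f x) \<le> real R \<and> (real R < norm x \<longrightarrow> f x = 0))"
proof
  assume f: "f \<in> L0inf"
  then obtain b where b: "AE x in lebesgue. cmod (f x) \<le> b" by (auto simp: L0inf_def)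
  have "bounded (ess_support f)" using f by (simp add: L0inf_def compact_imp_bounded)
  then obtain R where R: "\<forall>x\<in>ess_support f. norm x \<le> R" by (auto simp: bounded_iff)
  obtain N :: nat where N: "max b R \<le> real N" using real_arch_simple by blast
  have "AE x in lebesgue. cmod (f x) \<le> real N \<and> (real N < norm x \<longrightarrow> f x = 0)"
    using b ess_support_AE[of f] by eventually_elim (use N R in force)
  then show "f \<in> meas_funs \<and> (\<exists>R::nat. AE x in lebesgue. cmod (f x) \<le> real R \<and> (real R < norm x \<longrightarrow> f x = 0))"
    using f by (auto simp: L0inf_def)
next
  assume "f \<in> meas_funs \<and> (\<exists>R::nat. AE x in lebesgue. cmod (f x) \<le> real R \<and> (real R < norm x \<longrightarrow> f x = 0))"
  then obtain R :: nat where f: "f \<in> meas_funs" and R: "AE x in lebesgue. cmod (f x) \<le> real R \<and> (real R < norm x \<longrightarrow> f x = 0)"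
    by blast
  have "ess_support f \<subseteq> cball 0 (real R)"
  proof
    fix x assume x: "x \<in> ess_support f"
    show "x \<in> cball 0 (real R)"
    proof (rule ccontr)
      assume "x \<notin> cball 0 (real R)"
      moreover have "AE y in lebesgue. y \<in> - cball 0 (real R) \<longrightarrow> f y = 0"
        using R by eventually_elim auto
      moreover have "open (- cball 0 (real R))" by (simp add: open_Compl)
      ultimately show False using x unfolding ess_support_def by blast
    qed
  qed
  then have "compact (ess_support f)"
    using closed_ess_support[of f] by (metis bounded_cball bounded_subset compact_eq_bounded_closed)
  moreover have "AE x in lebesgue. cmod (f x) \<le> real R" using R by eventually_elim auto
  ultimately show "f \<in> L0inf" using f by (auto simp: L0inf_def)
qed

lemma L0inf_measurable: "f \<in> L0inf \<Longrightarrow> f \<in> borel_measurable lebesgue" by (simp add: L0inf_iff)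

lemma L0inf_dominated:
  assumes "f \<in> L0inf" "g \<in> meas_funs" "AE x in lebesgue. cmod (g x) \<le> c * cmod (f x)"
  shows "g \<in> L0inf"
proof -
  obtain R :: nat where R: "AE x in lebesgue. cmod (f x) \<le> real R \<and> (real R < norm x \<longrightarrow> f x = 0)"
    using assms(1) by (auto simp: L0inf_iff)
  obtain N :: nat where N: "max (real R) (\<bar>c\<bar> * real R) \<le> real N" using real_arch_simple by blast
  have "AE x in lebesgue. cmod (g x) \<le> real N \<and> (real N < norm x \<longrightarrow> g x = 0)"
    using R assms(3)
  proof eventually_elim
    case (elim x)
    have "cmod (g x) \<le> \<bar>c\<bar> * cmod (f x)"
      using elim(2) by (meson abs_ge_self mult_right_mono norm_ge_zero order_trans)
    also have "\<dots> \<le> \<bar>c\<bar> * real R" using elim(1) by (intro mult_left_mono) auto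
    finally show ?case using N elim by auto
  qed
  then show ?thesis using assms(2) by (auto simp: L0inf_iff)
qed

lemma L0inf_add:
  assumes f: "f \<in> L0inf" and g: "g \<in> L0inf" shows "(\<lambda>x. f x + g x) \<in> L0inf"
proof -
  obtain R :: nat where R: "AE x in lebesgue. cmod (f x) \<le> real R \<and> (real R < norm x \<longrightarrow> f x = 0)"
    using f by (auto simp: L0inf_iff)
  obtain R' :: nat where R': "AE x in lebesgue. cmod (g x) \<le> real R' \<and> (real R' < norm x \<longrightarrow> g x = 0)"
    using g by (auto simp: L0inf_iff)
  have "AE x in lebesgue. cmod (f x + g x) \<le> real (R + R') \<and> (real (R + R') < norm x \<longrightarrow> f x + g x = 0)"
    using R R'
  proof eventually_elim
    case (elim x)
    then show ?case using norm_triangle_ineq[of "f x" "g x"] by auto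
  qed
  then show ?thesis using L0inf_measurable[OF f] L0inf_measurable[OF g] unfolding L0inf_iff
    by (intro conjI exI[of _ "R + R'"]) auto
qed

lemma L0inf_scale:
  assumes f: "f \<in> L0inf" shows "(\<lambda>x. c * f x) \<in> L0inf"
proof (rule L0inf_dominated[OF f, of _ "cmod c"])
  show "(\<lambda>x. c * f x) \<in> borel_measurable lebesgue" using L0inf_measurable[OF f] by measurable
qed (simp add: norm_mult)

lemma L0inf_restrict:
  assumes f: "f \<in> L0inf" and S[measurable]: "S \<in> sets lebesgue"
  shows "(\<lambda>x. indicator S x * f x) \<in> L0inf"
proof (rule L0inf_dominated[OF f, of _ 1])
  show "(\<lambda>x. indicator S x * f x) \<in> borel_measurable lebesgue"
    using L0inf_measurable[OF f] by measurable
  show "AE x in lebesgue. cmod (indicator S x * f x) \<le> 1 * cmod (f x)"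
    by (rule AE_I2) (simp add: indicator_def)
qed

lemma L0inf_powr_integral:
  fixes f :: "'n::finite cfun"
  assumes f: "f \<in> L0inf" and r: "0 < r"
  shows "(\<integral>\<^sup>+x. ennreal (cmod (f x) powr r) \<partial>lebesgue) < \<infinity>"
proof -
  obtain R :: nat where R: "AE x in lebesgue. cmod (f x) \<le> real R \<and> (real R < norm x \<longrightarrow> f x = 0)"
    using f by (auto simp: L0inf_iff)
  have "(\<integral>\<^sup>+x. ennreal (cmod (f x) powr r) \<partial>lebesgue) \<le> (\<integral>\<^sup>+x\<in>cball (0::real^'n) (real R). ennreal (real R powr r) \<partial>lebesgue)"
  proof (rule nn_integral_mono_AE)
    show "AE x in lebesgue. ennreal (cmod (f x) powr r) \<le> ennreal (real R powr r) * indicator (cball 0 (real R)) x"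
      using R by eventually_elim (use r in \<open>auto simp: indicator_def intro!: ennreal_leI powr_mono2\<close>)
  qed
  also have "\<dots> = ennreal (real R powr r) * emeasure lebesgue (cball (0::real^'n) (real R))"
    by (rule set_nn_integral_cmult_const) simp
  also have "\<dots> < \<infinity>"
    using lmeasurable_cball[of "0::real^'n" "real R"] by (simp add: fmeasurable_def ennreal_mult_less_top)
  finally show ?thesis .
qed

lemma L0inf_Lspace: "f \<in> L0inf \<Longrightarrow> 0 < r \<Longrightarrow> f \<in> Lspace r"
  using L0inf_powr_integral[of f r] L0inf_measurable[of f] by (simp add: Lspace_def)

section \<open>Neighbourhoods of dyadic cubes\<close>

text \<open>The factor 2 makes the distance from the cube to the complement of its neighbourhood exceed twice
  the diameter of the cube, as the regularity condition of the kernel requires.\<close>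

definition dnbhd :: "int \<Rightarrow> real^'n \<Rightarrow> (real^'n) set"
  where "dnbhd k z = {y. \<forall>i. \<bar>\<lfloor>y $ i / 2 powi k\<rfloor> - \<lfloor>z $ i / 2 powi k\<rfloor>\<bar> \<le> 2 * int CARD('n)}"

lemma dnbhd_Union: "dnbhd k z = \<Union>((\<lambda>y. dcube k y) ` dnbhd k z)"
  by (auto simp: dnbhd_def dcube_def)

lemma dnbhd_cubes: "(\<lambda>y. dcube k y) ` dnbhd k z \<subseteq> dcubes" by auto

lemma dnbhd_sets[measurable]: "dnbhd k z \<in> sets lebesgue"
  by (subst dnbhd_Union) (rule Union_dcubes_sets[OF dnbhd_cubes])

lemma dnbhd_disjoint: "disjoint ((\<lambda>y. dcube k y) ` dnbhd k z)"
  by (auto simp: disjoint_def dcube_def)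

lemma floor_diff_bounds:
  fixes a b :: real
  assumes "0 < l"
  shows "l * (of_int (\<lfloor>a / l\<rfloor> - \<lfloor>b / l\<rfloor>) - 1) < a - b" "a - b < l * (of_int (\<lfloor>a / l\<rfloor> - \<lfloor>b / l\<rfloor>) + 1)"
proof -
  have "of_int (\<lfloor>a / l\<rfloor> - \<lfloor>b / l\<rfloor>) - 1 < a / l - b / l" "a / l - b / l < of_int (\<lfloor>a / l\<rfloor> - \<lfloor>b / l\<rfloor>) + 1"
    unfolding of_int_diff by linarith+
  then show "l * (of_int (\<lfloor>a / l\<rfloor> - \<lfloor>b / l\<rfloor>) - 1) < a - b" "a - b < l * (of_int (\<lfloor>a / l\<rfloor> - \<lfloor>b / l\<rfloor>) + 1)"
    using assms by (simp_all add: field_simps)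
qed

lemma dcube_coord_le: "x \<in> dcube k z \<Longrightarrow> \<bar>x $ i - z $ i\<bar> \<le> 2 powi k"
  using floor_diff_bounds[of "2 powi k" "x $ i" "z $ i"] by (auto simp: dcube_def)

lemma dnbhd_coord_le:
  fixes z :: "real^'n"
  assumes "x \<in> dnbhd k z" shows "\<bar>x $ i - z $ i\<bar> \<le> (2 * real CARD('n) + 1) * 2 powi k"
proof -
  let ?d = "\<lfloor>x $ i / 2 powi k\<rfloor> - \<lfloor>z $ i / 2 powi k\<rfloor>"
  have "\<bar>?d\<bar> \<le> 2 * int CARD('n)" using assms by (simp add: dnbhd_def)
  then have d: "\<bar>real_of_int ?d\<bar> \<le> 2 * real CARD('n)" by linarith
  have "2 powi k * (real_of_int ?d + 1) \<le> 2 powi k * (2 * real CARD('n) + 1)"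
    using d by (intro mult_left_mono) auto
  moreover have "2 powi k * - (2 * real CARD('n) + 1) \<le> 2 powi k * (real_of_int ?d - 1)"
    using d by (intro mult_left_mono) auto
  moreover have "(0::real) < 2 powi k" by simp
  note floor_diff_bounds[OF this, of "x $ i" "z $ i"]
  ultimately show ?thesis unfolding abs_le_iff mult.commute[of _ "2 powi k"] by linarith
qed

lemma not_dnbhd_norm:
  fixes z :: "real^'n"
  assumes x: "x \<in> dcube k z" and y: "y \<notin> dnbhd k z"
  shows "2 * real CARD('n) * 2 powi k < norm (y - x)"
proof -
  obtain i where i: "2 * int CARD('n) < \<bar>\<lfloor>y $ i / 2 powi k\<rfloor> - \<lfloor>z $ i / 2 powi k\<rfloor>\<bar>"
    using y by (auto simp: dnbhd_def not_le)
  let ?d = "\<lfloor>y $ i / 2 powi k\<rfloor> - \<lfloor>x $ i / 2 powi k\<rfloor>"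
  have "2 * int CARD('n) + 1 \<le> \<bar>?d\<bar>" using i x by (simp add: dcube_def)
  then have d: "2 * real CARD('n) + 1 \<le> \<bar>real_of_int ?d\<bar>" by linarith
  have l0: "(0::real) < 2 powi k" by simp
  have "2 * real CARD('n) * 2 powi k < \<bar>y $ i - x $ i\<bar>"
  proof (cases "0 \<le> ?d")
    case True
    then have "2 powi k * (2 * real CARD('n)) \<le> 2 powi k * (real_of_int ?d - 1)"
      using d by (intro mult_left_mono) auto
    then show ?thesis
      using floor_diff_bounds(1)[OF l0, of "y $ i" "x $ i"] unfolding mult.commute[of _ "2 powi k"] by linarith
  next
    case False
    then have "2 powi k * (real_of_int ?d + 1) \<le> 2 powi k * - (2 * real CARD('n))"
      using d by (intro mult_left_mono) auto
    then show ?thesis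
      using floor_diff_bounds(2)[OF l0, of "y $ i" "x $ i"] unfolding mult.commute[of _ "2 powi k"] by linarith
  qed
  also have "\<dots> \<le> norm (y - x)" using component_le_norm_cart[of "y - x" i] by simp
  finally show ?thesis .
qed

lemma dcube_norm_le:
  fixes z :: "real^'n"
  assumes "x \<in> dcube k z" shows "norm (x - z) \<le> real CARD('n) * 2 powi k"
proof -
  have "norm (x - z) \<le> (\<Sum>i\<in>(UNIV::'n set). \<bar>(x - z) $ i\<bar>)" by (rule norm_le_l1_cart)
  also have "\<dots> \<le> (\<Sum>i\<in>(UNIV::'n set). 2 powi k)" using dcube_coord_le[OF assms] by (intro sum_mono) simp
  finally show ?thesis by simp
qed

section \<open>Averages over cubes around a dyadic cube\<close>

definition ccube :: "real^'n \<Rightarrow> real \<Rightarrow> (real^'n) set"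
  where "ccube z r = cbox (z - (\<chi> i. r)) (z + (\<chi> i. r))"

lemma mem_ccube: "x \<in> ccube z r \<longleftrightarrow> (\<forall>i. \<bar>x $ i - z $ i\<bar> \<le> r)"
  by (auto simp: ccube_def mem_box_cart abs_le_iff algebra_simps)

lemma ccube_cubes: "0 < r \<Longrightarrow> ccube z r \<in> cubes"
  unfolding cubes_def ccube_def by (rule CollectI, intro exI conjI, rule refl) (auto intro: exI[of _ "2 * r"])

lemma ccube_sets[measurable]: "ccube z r \<in> sets lebesgue" by (simp add: ccube_def)

lemma emeasure_ccube:
  fixes z :: "real^'n"
  assumes "0 < r" shows "emeasure lebesgue (ccube z r) = ennreal ((2 * r) ^ CARD('n))"
  unfolding ccube_def using content_cube[of "z + (\<chi> i. r)" "z - (\<chi> i. r)" "2 * r"] assms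
  by (simp add: emeasure_completion)

text \<open>The complement of the neighbourhood is cut into shells 2^i l < |y - z| \<le> 2^(i + 1)
  l, where l is the side of the cube. Each lies in a cube centred at z that also contains x, so the
  average of w there is at most s, and the shells contribute a geometric series with ratio
  2^(-t).\<close>

lemma kernel_tail:
  fixes w :: "real^'n \<Rightarrow> real" and t s :: real
  assumes [measurable]: "w \<in> borel_measurable lebesgue" and w0: "\<And>x. 0 \<le> w x" and t: "0 < t" and s: "0 \<le> s"
    and x: "x \<in> dcube k z"
    and avg: "\<And>Q. Q \<in> cubes \<Longrightarrow> x \<in> Q \<Longrightarrow> (\<integral>\<^sup>+y\<in>Q. ennreal (w y) \<partial>lebesgue) \<le> ennreal s * emeasure lebesgue Q"
  shows "(\<integral>\<^sup>+y\<in>- dnbhd k z. ennreal (norm (y - z) powr (- real CARD('n) - t) * w y) \<partial>lebesgue)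
    \<le> ennreal (4 ^ CARD('n) / (1 - 2 powr (- t)) * s * (2 powi k) powr (- t))"
proof -
  define l :: real where "l = 2 powi k"
  have l: "0 < l" by (simp add: l_def)
  define n where "n = CARD('n)"
  have n: "1 \<le> real n" using one_le_card_finite[where 'a='n] by (simp add: n_def Suc_le_eq)
  define c where "c j = (2 ^ j * l) powr (- real n - t)" for j :: nat
  have c0: "0 \<le> c j" for j by (simp add: c_def)
  define S where "S j = ccube z (2 ^ Suc j * l)" for j :: nat
  have [measurable]: "S j \<in> sets lebesgue" for j by (simp add: S_def)
  have pt: "ennreal (norm (y - z) powr (- real n - t) * w y) * indicator (- dnbhd k z) y
      \<le> (\<Sum>j. ennreal (c j) * (ennreal (w y) * indicator (S j) y))" for y
  proof (cases "y \<in> dnbhd k z")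
    case False
    have "2 * real n * l < norm (y - z)" using not_dnbhd_norm[OF self_in_dcube False] by (simp add: n_def l_def)
    moreover have "1 * l \<le> 2 * real n * l" using n l by (intro mult_right_mono) auto
    ultimately have big: "l < norm (y - z)" by simp
    obtain i where "norm (y - z) / l < 2 ^ i" using real_arch_pow[of 2] by auto
    then have ex: "norm (y - z) \<le> 2 ^ i * l" using l by (simp add: divide_less_eq)
    define j where "j = (LEAST j. norm (y - z) \<le> 2 ^ j * l)"
    have j: "norm (y - z) \<le> 2 ^ j * l" "\<And>i. i < j \<Longrightarrow> \<not> norm (y - z) \<le> 2 ^ i * l"
      using LeastI[of "\<lambda>j. norm (y - z) \<le> 2 ^ j * l", OF ex] not_less_Least by (auto simp: j_def)
    have "j \<noteq> 0" using j(1) big by (cases j) auto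
    then obtain i where i: "j = Suc i" by (cases j) auto
    have lo: "2 ^ i * l < norm (y - z)" using j(2)[of i] i by simp
    have "y \<in> S i"
      unfolding S_def mem_ccube
    proof
      fix m
      have "\<bar>y $ m - z $ m\<bar> \<le> norm (y - z)" using component_le_norm_cart[of "y - z" m] by simp
      then show "\<bar>y $ m - z $ m\<bar> \<le> 2 ^ Suc i * l" using j(1) i by simp
    qed
    have "norm (y - z) powr (- real n - t) \<le> c i"
      unfolding c_def using lo l t n by (intro powr_mono2') auto
    then have "ennreal (norm (y - z) powr (- real n - t) * w y) \<le> ennreal (c i * w y)"
      using w0[of y] by (intro ennreal_leI mult_right_mono)
    then have "ennreal (norm (y - z) powr (- real n - t) * w y) * indicator (- dnbhd k z) y
       \<le> ennreal (c i) * (ennreal (w y) * indicator (S i) y)"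
      using False \<open>y \<in> S i\<close> c0[of i] by (simp add: ennreal_mult')
    also have "\<dots> \<le> (\<Sum>j. ennreal (c j) * (ennreal (w y) * indicator (S j) y))"
      using sum_le_suminf[OF summableI, of "{i}" "\<lambda>j. ennreal (c j) * (ennreal (w y) * indicator (S j) y)"] by simp
    finally show ?thesis .
  qed simp
  have p0: "0 < 2 powr (- t)" "2 powr (- t) < 1" using t powr_less_mono[of "- t" 0 2] by auto
  have "(\<integral>\<^sup>+y\<in>- dnbhd k z. ennreal (norm (y - z) powr (- real n - t) * w y) \<partial>lebesgue)
     \<le> (\<integral>\<^sup>+y. (\<Sum>j. ennreal (c j) * (ennreal (w y) * indicator (S j) y)) \<partial>lebesgue)"
    by (intro nn_integral_mono pt)
  also have "\<dots> = (\<Sum>j. ennreal (c j) * (\<integral>\<^sup>+y\<in>S j. ennreal (w y) \<partial>lebesgue))"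
    by (simp add: nn_integral_suminf nn_integral_cmult)
  also have "\<dots> \<le> (\<Sum>j. ennreal (4 ^ n * s * l powr (- t) * (2 powr (- t)) ^ j))"
  proof (intro suminf_le summableI)
    fix j
    have r: "0 < 2 ^ Suc j * l" using l by simp
    have "x \<in> S j"
      unfolding S_def mem_ccube
    proof
      fix i
      have "\<bar>x $ i - z $ i\<bar> \<le> 1 * l" using dcube_coord_le[OF x, of i] by (simp add: l_def)
      also have "\<dots> \<le> 2 ^ Suc j * l" using l by (intro mult_right_mono one_le_power) auto
      finally show "\<bar>x $ i - z $ i\<bar> \<le> 2 ^ Suc j * l" .
    qed
    then have "(\<integral>\<^sup>+y\<in>S j. ennreal (w y) \<partial>lebesgue) \<le> ennreal s * emeasure lebesgue (S j)"
      unfolding S_def by (rule avg[OF ccube_cubes[OF r]])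
    also have "emeasure lebesgue (S j) = ennreal ((2 * (2 ^ Suc j * l)) ^ n)"
      unfolding S_def n_def by (rule emeasure_ccube[OF r])
    finally have "ennreal (c j) * (\<integral>\<^sup>+y\<in>S j. ennreal (w y) \<partial>lebesgue) \<le> ennreal (c j) * (ennreal s * ennreal ((2 * (2 ^ Suc j * l)) ^ n))"
      by (rule mult_left_mono) simp
    also have "\<dots> = ennreal (c j * (s * (2 * (2 ^ Suc j * l)) ^ n))"
      by (simp only: ennreal_mult'[OF c0] ennreal_mult'[OF s])
    also have "c j * (s * (2 * (2 ^ Suc j * l)) ^ n) = 4 ^ n * s * l powr (- t) * (2 powr (- t)) ^ j"
    proof -
      have pos: "0 < 2 ^ j * l" using l by simp
      have "c j * (2 ^ j * l) ^ n = (2 ^ j * l) powr (- t)"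
        unfolding c_def powr_realpow[OF pos, symmetric] powr_add[symmetric] by simp
      also have "(2 ^ j * l) powr (- t) = l powr (- t) * (2 powr (- t)) ^ j"
      proof -
        have "(2 ^ j) powr (- t) = (2 powr real j) powr (- t)" by (simp add: powr_realpow)
        also have "\<dots> = (2 powr (- t)) powr real j" by (simp only: powr_powr mult.commute)
        also have "\<dots> = (2 powr (- t)) ^ j" by (rule powr_realpow) simp
        finally show ?thesis using l by (simp add: powr_mult)
      qed
      finally have 1: "c j * (2 ^ j * l) ^ n = l powr (- t) * (2 powr (- t)) ^ j" .
      have "(2 * (2 ^ Suc j * l)) ^ n = 4 ^ n * (2 ^ j * l) ^ n"
        by (subst power_mult_distrib[symmetric]) simp
      then have "c j * (s * (2 * (2 ^ Suc j * l)) ^ n) = 4 ^ n * s * (c j * (2 ^ j * l) ^ n)"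
        by (simp only: mult_ac)
      then show ?thesis unfolding 1 by (simp only: mult_ac)
    qed
    finally show "ennreal (c j) * (\<integral>\<^sup>+y\<in>S j. ennreal (w y) \<partial>lebesgue) \<le> ennreal (4 ^ n * s * l powr (- t) * (2 powr (- t)) ^ j)" .
  qed
  also have "\<dots> = ennreal (4 ^ n * s * l powr (- t) / (1 - 2 powr (- t)))"
    using p0 s by (intro suminf_ennreal_geometric) auto
  finally show ?thesis by (simp add: n_def l_def)
qed

text \<open>The reverse Hoelder inequality is available on dyadic cubes, and the neighbourhood is a
  disjoint union of such cubes. Each lies in one common cube through x with N times its measure, so
  its average of w is at most N s.\<close>

lemma A1_neighbourhood_power:
  fixes w :: "real^'n \<Rightarrow> real"
  assumes [measurable]: "w \<in> borel_measurable lebesgue" and w0: "\<And>x. 0 \<le> w x" and s: "0 < s" and C: "0 < C"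
    and x: "x \<in> dcube k z"
    and avg: "\<And>Q. Q \<in> cubes \<Longrightarrow> x \<in> Q \<Longrightarrow> (\<integral>\<^sup>+y\<in>Q. ennreal (w y) \<partial>lebesgue) \<le> ennreal s * emeasure lebesgue Q"
    and RH: "\<And>Q s. Q \<in> dcubes \<Longrightarrow> 0 < s \<Longrightarrow>
       (\<integral>\<^sup>+y\<in>Q. ennreal (w y) \<partial>lebesgue) \<le> ennreal s * emeasure lebesgue Q \<Longrightarrow>
       (\<integral>\<^sup>+y\<in>Q. ennreal (w y powr r) \<partial>lebesgue) \<le> ennreal (C * s powr r) * emeasure lebesgue Q"
  defines "N \<equiv> (2 * (2 * real CARD('n) + 1)) ^ CARD('n)"
  shows "(\<integral>\<^sup>+y\<in>dnbhd k z. ennreal (w y powr r) \<partial>lebesgue) \<le> ennreal (C * (N * s) powr r * N) * emeasure lebesgue (dcube k z)"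
proof -
  define l :: real where "l = 2 powi k"
  have l: "0 < l" by (simp add: l_def)
  define \<rho> where "\<rho> = (2 * real CARD('n) + 1) * l"
  have \<rho>: "0 < \<rho>" using l by (simp add: \<rho>_def add_nonneg_pos)
  have N0: "0 < N" unfolding N_def by (simp add: add_nonneg_pos)
  have sub: "dnbhd k z \<subseteq> ccube z \<rho>"
    using dnbhd_coord_le[of _ k z] by (auto simp: mem_ccube \<rho>_def l_def)
  have "x \<in> dnbhd k z" using x by (simp add: dcube_def dnbhd_def)
  then have xc: "x \<in> ccube z \<rho>" using sub by blast
  have ec: "emeasure lebesgue (ccube z \<rho>) = ennreal N * emeasure lebesgue (dcube k y)" for y :: "real^'n"
  proof -
    have "(2 * \<rho>) ^ CARD('n) = N * (2 powi k) ^ CARD('n)"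
    proof -
      have "2 * \<rho> = (2 * (2 * real CARD('n) + 1)) * 2 powi k" by (simp add: \<rho>_def l_def)
      then show ?thesis unfolding N_def by (simp only: power_mult_distrib)
    qed
    then show ?thesis unfolding emeasure_ccube[OF \<rho>] emeasure_dcube
      using N0 by (simp only: ennreal_mult' less_imp_le)
  qed
  let ?M = "(\<lambda>y. dcube k y) ` dnbhd k z"
  have M: "countable ?M" "disjoint ?M" "?M \<subseteq> sets lebesgue"
    using countable_dcubes_subset[OF dnbhd_cubes] dnbhd_disjoint by auto
  have "(\<integral>\<^sup>+y\<in>\<Union>?M. ennreal (w y powr r) \<partial>lebesgue) \<le> (\<integral>\<^sup>+y\<in>\<Union>?M. ennreal (C * (N * s) powr r) \<partial>lebesgue)"
  proof (rule set_nn_integral_Union_mono[OF M])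
    fix R assume R: "R \<in> ?M"
    then obtain y where y: "R = dcube k y" by auto
    have RD: "R \<in> dcubes" using y by simp
    have "R \<subseteq> ccube z \<rho>" using R sub dnbhd_Union[of k z] by blast
    then have "(\<integral>\<^sup>+y\<in>R. ennreal (w y) \<partial>lebesgue) \<le> (\<integral>\<^sup>+y\<in>ccube z \<rho>. ennreal (w y) \<partial>lebesgue)"
      by (rule set_nn_integral_mono_set)
    also have "\<dots> \<le> ennreal s * emeasure lebesgue (ccube z \<rho>)" by (rule avg[OF ccube_cubes[OF \<rho>] xc])
    also have "\<dots> = ennreal (N * s) * emeasure lebesgue R"
      unfolding ec[of y] y using N0 s by (simp add: ennreal_mult' ac_simps)
    finally have "(\<integral>\<^sup>+y\<in>R. ennreal (w y powr r) \<partial>lebesgue) \<le> ennreal (C * (N * s) powr r) * emeasure lebesgue R"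
      using N0 s by (intro RH[OF RD]) auto
    then show "(\<integral>\<^sup>+y\<in>R. ennreal (w y powr r) \<partial>lebesgue) \<le> (\<integral>\<^sup>+y\<in>R. ennreal (C * (N * s) powr r) \<partial>lebesgue)"
      by (subst set_nn_integral_cmult_const[OF dcubes_sets[OF RD]])
  qed simp_all
  also have "\<dots> = ennreal (C * (N * s) powr r) * emeasure lebesgue (dnbhd k z)"
    unfolding dnbhd_Union[symmetric] by (rule set_nn_integral_cmult_const) simp
  also have "\<dots> \<le> ennreal (C * (N * s) powr r) * (ennreal N * emeasure lebesgue (dcube k z))"
    unfolding ec[symmetric] by (intro mult_left_mono emeasure_mono sub) auto
  also have "\<dots> = ennreal (C * (N * s) powr r * N) * emeasure lebesgue (dcube k z)"
    using C N0 by (simp add: ennreal_mult' mult.assoc)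
  finally show ?thesis unfolding dnbhd_Union[symmetric] .
qed

section \<open>Operators of weak type with small oscillation\<close>

text \<open>The properties of the modulated operator that the argument uses, with nonnegative real
  values. \<open>U_osc\<close> is the regularity of the kernel: if f vanishes near a cube, then U f
  is almost constant on the cube.\<close>

locale modulated_operator = maximal_exponent P pm pp B
  for P :: "real^'n \<Rightarrow> real" and pm pp B +
  fixes U :: "'n cfun \<Rightarrow> real^'n \<Rightarrow> real"
  assumes U_meas: "f \<in> L0inf \<Longrightarrow> U f \<in> borel_measurable lebesgue"
    and U_nonneg: "0 \<le> U f x"
    and U_cong: "f \<in> L0inf \<Longrightarrow> g \<in> L0inf \<Longrightarrow> AE x in lebesgue. f x = g x \<Longrightarrow> AE x in lebesgue. U f x = U g x"
    and U_add: "f \<in> L0inf \<Longrightarrow> g \<in> L0inf \<Longrightarrow> AE x in lebesgue. U (\<lambda>y. f y + g y) x \<le> U f x + U g x"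
    and U_scale: "f \<in> L0inf \<Longrightarrow> AE x in lebesgue. U (\<lambda>y. c * f y) x = cmod c * U f x"
    and U_weak: "1 < r \<Longrightarrow> \<exists>C>0. \<forall>f\<in>L0inf. \<forall>t>0. emeasure lebesgue {x. t < U f x} \<le>
       ennreal (C powr r / t powr r) * (\<integral>\<^sup>+y. ennreal (cmod (f y) powr r) \<partial>lebesgue)"
    and U_osc: "\<exists>\<tau>>0. \<exists>A\<ge>0. \<forall>f\<in>L0inf. \<forall>k z. (\<forall>y\<in>dnbhd k z. f y = 0) \<longrightarrow>
       (\<exists>c. AE x in lebesgue. x \<in> dcube k z \<longrightarrow> ennreal \<bar>U f x - c\<bar> \<le>
         ennreal (A * (2 powi k) powr \<tau>) *
         (\<integral>\<^sup>+y\<in>- dnbhd k z. ennreal (norm (y - z) powr (- real CARD('n) - \<tau>) * cmod (f y)) \<partial>lebesgue))"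
begin

text \<open>Subadditivity in both directions, together with invariance under a change of
  sign.\<close>

lemma U_diff:
  assumes f: "f \<in> L0inf" and g: "g \<in> L0inf"
  shows "AE x in lebesgue. \<bar>U f x - U g x\<bar> \<le> U (\<lambda>y. f y - g y) x"
proof -
  have d: "(\<lambda>y. f y - g y) \<in> L0inf" "(\<lambda>y. - 1 * (f y - g y)) \<in> L0inf"
    using L0inf_add[OF f L0inf_scale[OF g, of "- 1"]] L0inf_scale[of "\<lambda>y. f y - g y" "- 1"] by simp_all
  have "AE x in lebesgue. U f x \<le> U (\<lambda>y. f y - g y) x + U g x"
    using U_add[OF d(1) g] by simp
  moreover have "AE x in lebesgue. U g x \<le> U (\<lambda>y. - 1 * (f y - g y)) x + U f x"
    using U_add[OF d(2) f] by simp
  moreover note U_scale[OF d(1), of "- 1"]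
  ultimately show ?thesis by eventually_elim auto
qed

text \<open>Around a dyadic cube f is split into a local part f1 and a far part f2. With t the level
  under consideration, U f2 is within t / 4 of a constant on the cube, so U f can deviate from that
  constant by more than t / 2 only where U f1 > t / 4. The weak type estimates this set by the mean
  of w^r near the cube.\<close>

theorem U_bounded:
  obtains L where "0 < L"
    "\<And>f. f \<in> L0inf \<Longrightarrow> rho P (\<lambda>x. cmod (f x)) \<le> 1 \<Longrightarrow> rho P (\<lambda>x. U f x / L) \<le> 1"
proof -
  have B4: "1 \<le> 4 * B" using B by simp
  obtain \<delta> C :: real where dC: "0 < \<delta>" "0 < C" and
    RH: "\<And>(w :: real^'n \<Rightarrow> real) Q s. A1 (4 * B) w \<Longrightarrow> Q \<in> dcubes \<Longrightarrow> 0 < s \<Longrightarrow>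
       (\<integral>\<^sup>+y\<in>Q. ennreal (w y) \<partial>lebesgue) \<le> ennreal s * emeasure lebesgue Q \<Longrightarrow>
       (\<integral>\<^sup>+y\<in>Q. ennreal (w y powr (1 + \<delta>)) \<partial>lebesgue) \<le> ennreal (C * s powr (1 + \<delta>)) * emeasure lebesgue Q"
    by (rule A1_reverse_Hoelder[where 'n = 'n, OF B4]) (rule that; (assumption | blast))
  define r where "r = 1 + \<delta>"
  have r: "1 < r" using dC by (simp add: r_def)
  obtain Cr where Cr: "0 < Cr" "\<And>f t. f \<in> L0inf \<Longrightarrow> 0 < t \<Longrightarrow> emeasure lebesgue {x. t < U f x} \<le>
       ennreal (Cr powr r / t powr r) * (\<integral>\<^sup>+y. ennreal (cmod (f y) powr r) \<partial>lebesgue)"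
    using U_weak[OF r] by blast
  \<comment> \<open>A second exponent, independent of 1 + \<delta> from the reverse Hoelder
    inequality: below pm, it supplies the global decay of level sets for the good-lambda
    inequality.\<close>
  define r0 where "r0 = (1 + pm) / 2"
  have r0: "1 < r0" "r0 < pm" using pm by (auto simp: r0_def)
  obtain C0 where C0: "0 < C0" "\<And>f t. f \<in> L0inf \<Longrightarrow> 0 < t \<Longrightarrow> emeasure lebesgue {x. t < U f x} \<le>
       ennreal (C0 powr r0 / t powr r0) * (\<integral>\<^sup>+y. ennreal (cmod (f y) powr r0) \<partial>lebesgue)"
    using U_weak[OF r0(1)] by blast
  obtain \<tau> A where tA: "0 < \<tau>" "0 \<le> A" and osc: "\<And>f k z. f \<in> L0inf \<Longrightarrow> (\<forall>y\<in>dnbhd k z. f y = 0) \<Longrightarrow>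
       \<exists>c. AE x in lebesgue. x \<in> dcube k z \<longrightarrow> ennreal \<bar>U f x - c\<bar> \<le>
         ennreal (A * (2 powi k) powr \<tau>) *
         (\<integral>\<^sup>+y\<in>- dnbhd k z. ennreal (norm (y - z) powr (- real CARD('n) - \<tau>) * cmod (f y)) \<partial>lebesgue)"
    using U_osc by blast
  obtain e where e: "0 < e" and
    gl: "\<And>g w :: real^'n \<Rightarrow> real. \<And>a r D. g \<in> borel_measurable lebesgue \<Longrightarrow> (\<And>x. 0 \<le> g x) \<Longrightarrow>
       w \<in> borel_measurable lebesgue \<Longrightarrow> (\<And>x. 0 \<le> w x) \<Longrightarrow> rho P (\<lambda>x. w x / 4) \<le> 1 \<Longrightarrow>
       0 < a \<Longrightarrow> a \<le> 1 \<Longrightarrow> 0 \<le> D \<Longrightarrow> r < pm \<Longrightarrow>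
       (\<And>t. 0 < t \<Longrightarrow> emeasure lebesgue {x. t < g x} \<le> ennreal (D / t powr r)) \<Longrightarrow>
       (\<And>k Q. Q \<in> dcubes \<Longrightarrow> \<not> (AE x in lebesgue. x \<in> Q \<longrightarrow> a * 2 powi k < w x) \<Longrightarrow>
          \<exists>c. emeasure lebesgue {x \<in> Q. 2 powi k / 2 < \<bar>g x - c\<bar>} \<le> ennreal e * emeasure lebesgue Q) \<Longrightarrow>
       rho P (\<lambda>x. g x / (96 / a)) \<le> 1"
    by (rule good_lambda) (rule that; (assumption | blast))
  define N where "N = (2 * (2 * real CARD('n) + 1)) ^ CARD('n)"
  have N: "0 < N" unfolding N_def by (simp add: add_nonneg_pos)
  define T where "T = 4 ^ CARD('n) / (1 - 2 powr (- \<tau>))"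
  have "2 powr (- \<tau>) < 1" using tA powr_less_mono[of "- \<tau>" 0 2] by simp
  then have T: "0 < T" by (simp add: T_def)
  define CA where "CA = A * T"
  have CA: "0 \<le> CA" using tA T by (simp add: CA_def)
  define H where "H = Cr powr r * C * N * (16 * B * N) powr r"
  have H: "0 \<le> H" using dC N by (simp add: H_def)
  \<comment> \<open>The first bound keeps the oscillation of the far part below t / 4, the second
    keeps the exceptional set of the local part below the proportion e.\<close>
  define a where "a = min (1 / (16 * B * (CA + 1))) (e / (H + 1))"
  have a0: "0 < a" using B CA e H by (simp add: a_def)
  have "1 * 1 \<le> (16 * B) * (CA + 1)" using B CA by (intro mult_mono) auto
  then have "1 / (16 * B * (CA + 1)) \<le> 1" by (simp add: divide_le_eq_1)
  then have a1: "a \<le> 1" by (simp add: a_def)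
  have aCA: "CA * (4 * B * a) \<le> 1 / 4"
  proof -
    have "CA * (4 * B * a) \<le> (CA + 1) * (4 * B * (1 / (16 * B * (CA + 1))))"
      using CA B a0 by (intro mult_mono) (auto simp: a_def)
    also have "\<dots> = 1 / 4" using CA B by (simp add: divide_simps)
    finally show ?thesis .
  qed
  have aH: "H * a powr r \<le> e"
  proof -
    have "H * a powr r \<le> H * a" using powr_le_one_le[OF a0 a1, of r] r H by (intro mult_left_mono) auto
    also have "\<dots> \<le> (H + 1) * (e / (H + 1))" using H a0 by (intro mult_mono) (auto simp: a_def)
    also have "\<dots> = e" using H by simp
    finally show ?thesis .
  qed
  show thesis
  proof (rule that)
    show "0 < 96 / a" using a0 by simp
    fix f assume f: "f \<in> L0inf" and frho: "rho P (\<lambda>x. cmod (f x)) \<le> 1"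
    have fm[measurable]: "f \<in> borel_measurable lebesgue" by (rule L0inf_measurable[OF f])
    obtain w where A1w: "A1 (4 * B) w" and fw: "AE x in lebesgue. cmod (f x) \<le> w x" and wrho: "rho P (\<lambda>x. w x / 4) \<le> 1"
      by (rule Rubio_de_Francia[of "\<lambda>x. cmod (f x)"]) (use frho in \<open>simp_all\<close>)
    have wm[measurable]: "w \<in> borel_measurable lebesgue" and w0: "\<And>x. 0 \<le> w x" using A1w by (auto simp: A1_def)
    define I where "I = enn2real (\<integral>\<^sup>+y. ennreal (cmod (f y) powr r0) \<partial>lebesgue)"
    have I: "(\<integral>\<^sup>+y. ennreal (cmod (f y) powr r0) \<partial>lebesgue) = ennreal I" "0 \<le> I"
      using L0inf_powr_integral[OF f, of r0] r0 by (auto simp: I_def)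
    show "rho P (\<lambda>x. U f x / (96 / a)) \<le> 1"
    proof (rule gl[OF U_meas[OF f] U_nonneg wm w0 wrho a0 a1 _ r0(2), of "C0 powr r0 * I"])
      show "0 \<le> C0 powr r0 * I" using I by simp
      fix t :: real assume t: "0 < t"
      show "emeasure lebesgue {x. t < U f x} \<le> ennreal (C0 powr r0 * I / t powr r0)"
        using C0(2)[OF f t] I by (simp add: ennreal_mult'[symmetric])
    next
      fix j :: int and Q :: "(real^'n) set"
      assume Q: "Q \<in> dcubes" and nAE: "\<not> (AE x in lebesgue. x \<in> Q \<longrightarrow> a * 2 powi j < w x)"
      define t :: real where "t = 2 powi j"
      have t: "0 < t" by (simp add: t_def)
      obtain k z where kz: "Q = dcube k z" using Q by auto
      \<comment> \<open>The points of the cube with w \<le> a t do not form a null set, whereas the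
        A1 condition holds a.e.; hence some point satisfies both.\<close>
      obtain x where x: "x \<in> dcube k z" "w x \<le> a * t" and xavg: "\<forall>Q\<in>cubes. x \<in> Q \<longrightarrow>
          (\<integral>\<^sup>+y\<in>Q. ennreal (w y) \<partial>lebesgue) \<le> ennreal (4 * B * w x) * emeasure lebesgue Q"
      proof (rule ccontr)
        assume "\<not> thesis"
        then have no: "\<And>x. x \<in> dcube k z \<Longrightarrow> (\<forall>Q\<in>cubes. x \<in> Q \<longrightarrow>
          (\<integral>\<^sup>+y\<in>Q. ennreal (w y) \<partial>lebesgue) \<le> ennreal (4 * B * w x) * emeasure lebesgue Q) \<Longrightarrow> a * t < w x"
          using that by (meson not_le)
        have "AE x in lebesgue. \<forall>Q\<in>cubes. x \<in> Q \<longrightarrow>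
          (\<integral>\<^sup>+y\<in>Q. ennreal (w y) \<partial>lebesgue) \<le> ennreal (4 * B * w x) * emeasure lebesgue Q"
          using A1w by (simp add: A1_def)
        then have "AE x in lebesgue. x \<in> Q \<longrightarrow> a * 2 powi j < w x"
          unfolding kz t_def[symmetric] by eventually_elim (use no in blast)
        then show False using nAE by simp
      qed
      define s where "s = 4 * B * (a * t)"
      have s: "0 < s" using B a0 t by (simp add: s_def)
      have avg: "(\<integral>\<^sup>+y\<in>R. ennreal (w y) \<partial>lebesgue) \<le> ennreal s * emeasure lebesgue R" if "R \<in> cubes" "x \<in> R" for R
      proof -
        have "ennreal (4 * B * w x) * emeasure lebesgue R \<le> ennreal s * emeasure lebesgue R"
          unfolding s_def using x(2) B by (intro mult_right_mono ennreal_leI mult_left_mono) auto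
        then show ?thesis using xavg that by (meson order_trans)
      qed
      let ?D = "dnbhd k z"
      define f1 where "f1 y = indicator ?D y * f y" for y
      define f2 where "f2 y = indicator (- ?D) y * f y" for y
      have f1: "f1 \<in> L0inf" unfolding f1_def[abs_def] by (rule L0inf_restrict[OF f]) simp
      have f2: "f2 \<in> L0inf" unfolding f2_def[abs_def]
        by (rule L0inf_restrict[OF f]) (simp add: Compl_in_sets_lebesgue)
      have f12: "(\<lambda>y. f1 y + f2 y) = f" by (auto simp: f1_def f2_def indicator_def)
      have f21: "(\<lambda>y. f y - f2 y) = f1" by (auto simp: f1_def f2_def indicator_def)
      have f20: "\<forall>y\<in>?D. f2 y = 0" by (simp add: f2_def)
      obtain c where c: "AE y in lebesgue. y \<in> dcube k z \<longrightarrow> ennreal \<bar>U f2 y - c\<bar> \<le>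
         ennreal (A * (2 powi k) powr \<tau>) *
         (\<integral>\<^sup>+y\<in>- ?D. ennreal (norm (y - z) powr (- real CARD('n) - \<tau>) * cmod (f2 y)) \<partial>lebesgue)"
        using osc[OF f2 f20] by blast
      have "(\<integral>\<^sup>+y\<in>- ?D. ennreal (norm (y - z) powr (- real CARD('n) - \<tau>) * cmod (f2 y)) \<partial>lebesgue)
        \<le> (\<integral>\<^sup>+y\<in>- ?D. ennreal (norm (y - z) powr (- real CARD('n) - \<tau>) * w y) \<partial>lebesgue)"
      proof (rule nn_integral_mono_AE)
        show "AE y in lebesgue. ennreal (norm (y - z) powr (- real CARD('n) - \<tau>) * cmod (f2 y)) * indicator (- ?D) y
          \<le> ennreal (norm (y - z) powr (- real CARD('n) - \<tau>) * w y) * indicator (- ?D) y"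
          using fw
        proof eventually_elim
          case (elim y)
          have "cmod (f2 y) \<le> w y" using elim w0[of y] by (simp add: f2_def indicator_def)
          then show ?case by (intro mult_right_mono ennreal_leI mult_left_mono) auto
        qed
      qed
      also have "\<dots> \<le> ennreal (T * s * (2 powi k) powr (- \<tau>))"
        unfolding T_def by (rule kernel_tail[OF wm w0 tA(1) less_imp_le[OF s] x(1) avg])
      finally have tail: "(\<integral>\<^sup>+y\<in>- ?D. ennreal (norm (y - z) powr (- real CARD('n) - \<tau>) * cmod (f2 y)) \<partial>lebesgue)
        \<le> ennreal (T * s * (2 powi k) powr (- \<tau>))" .
      have "ennreal (A * (2 powi k) powr \<tau>) *
         (\<integral>\<^sup>+y\<in>- ?D. ennreal (norm (y - z) powr (- real CARD('n) - \<tau>) * cmod (f2 y)) \<partial>lebesgue)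
         \<le> ennreal (A * (2 powi k) powr \<tau>) * ennreal (T * s * (2 powi k) powr (- \<tau>))"
        by (intro mult_left_mono tail) simp
      also have "\<dots> = ennreal (A * (2 powi k) powr \<tau> * (T * s * (2 powi k) powr (- \<tau>)))"
        using tA by (intro ennreal_mult'[symmetric]) simp
      also have "A * (2 powi k) powr \<tau> * (T * s * (2 powi k) powr (- \<tau>)) = CA * s"
        by (simp add: CA_def powr_minus)
      also have "CA * s = (CA * (4 * B * a)) * t" by (simp add: s_def)
      also have "ennreal \<dots> \<le> ennreal (1 / 4 * t)" using aCA t by (intro ennreal_leI mult_right_mono) auto
      finally have small: "ennreal (A * (2 powi k) powr \<tau>) *
         (\<integral>\<^sup>+y\<in>- ?D. ennreal (norm (y - z) powr (- real CARD('n) - \<tau>) * cmod (f2 y)) \<partial>lebesgue) \<le> ennreal (t / 4)" by simp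
      have "AE y in lebesgue. y \<in> {y \<in> Q. 2 powi j / 2 < \<bar>U f y - c\<bar>} \<longrightarrow> y \<in> {y. t / 4 < U f1 y}"
        using c U_diff[OF f f2] unfolding f21 
      proof eventually_elim
        case (elim y)
        show ?case
        proof
          assume y: "y \<in> {y \<in> Q. 2 powi j / 2 < \<bar>U f y - c\<bar>}"
          then have "ennreal \<bar>U f2 y - c\<bar> \<le> ennreal (t / 4)" using elim(1) small kz by (auto intro: order_trans)
          then have "\<bar>U f2 y - c\<bar> \<le> t / 4" using t by (simp add: ennreal_le_iff)
          moreover have "t / 2 < \<bar>U f y - c\<bar>" using y by (simp add: t_def)
          ultimately show "y \<in> {y. t / 4 < U f1 y}" using elim(2) by (simp only: mem_Collect_eq)
        qed
      qed
      moreover have "{y. t / 4 < U f1 y} \<in> sets lebesgue"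
        using superlevel_sets[OF U_meas[OF f1], of "t / 4"] by simp
      ultimately have "emeasure lebesgue {y \<in> Q. 2 powi j / 2 < \<bar>U f y - c\<bar>} \<le> emeasure lebesgue {y. t / 4 < U f1 y}"
        by (rule emeasure_mono_AE)
      also have "\<dots> \<le> ennreal (Cr powr r / (t / 4) powr r) * (\<integral>\<^sup>+y. ennreal (cmod (f1 y) powr r) \<partial>lebesgue)"
        using t by (intro Cr(2) f1) simp
      also have "(\<integral>\<^sup>+y. ennreal (cmod (f1 y) powr r) \<partial>lebesgue) \<le> (\<integral>\<^sup>+y\<in>?D. ennreal (w y powr r) \<partial>lebesgue)"
      proof (rule nn_integral_mono_AE)
        show "AE y in lebesgue. ennreal (cmod (f1 y) powr r) \<le> ennreal (w y powr r) * indicator ?D y"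
          using fw
        proof eventually_elim
          case (elim y)
          show ?case
          proof (cases "y \<in> ?D")
            case True
            then have "cmod (f1 y) powr r \<le> w y powr r" using elim r by (intro powr_mono2) (auto simp: f1_def)
            then show ?thesis using True by (simp add: ennreal_leI)
          qed (simp add: f1_def)
        qed
      qed
      also have "\<dots> \<le> ennreal (C * (N * s) powr r * N) * emeasure lebesgue (dcube k z)"
        unfolding N_def r_def
        by (rule A1_neighbourhood_power[OF wm w0 s dC(2) x(1) avg RH[OF A1w]])
      finally have "emeasure lebesgue {y \<in> Q. 2 powi j / 2 < \<bar>U f y - c\<bar>} \<le>
         ennreal (Cr powr r / (t / 4) powr r) * (ennreal (C * (N * s) powr r * N) * emeasure lebesgue (dcube k z))"
        by (simp add: mult_left_mono)
      also have "\<dots> = ennreal (Cr powr r / (t / 4) powr r * (C * (N * s) powr r * N)) * emeasure lebesgue Q"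
      proof -
        have "0 \<le> Cr powr r / (t / 4) powr r" by simp
        from ennreal_mult'[OF this] show ?thesis unfolding kz by (simp only: mult.assoc)
      qed
      also have "Cr powr r / (t / 4) powr r * (C * (N * s) powr r * N) = H * a powr r"
      proof -
        have "N * s = (16 * B * N) * a * (t / 4)" by (simp add: s_def)
        then have "(N * s) powr r = (16 * B * N) powr r * a powr r * (t / 4) powr r"
          using B N a0 t by (simp only: powr_mult)
        then show ?thesis using t by (simp add: H_def)
      qed
      also have "ennreal (H * a powr r) * emeasure lebesgue Q \<le> ennreal e * emeasure lebesgue Q"
        by (intro mult_right_mono ennreal_leI aH) simp
      finally show "\<exists>c. emeasure lebesgue {y \<in> Q. 2 powi j / 2 < \<bar>U f y - c\<bar>} \<le> ennreal e * emeasure lebesgue Q" by blast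
    qed
  qed
qed

end

section \<open>Extension by density\<close>

definition rho_space :: "(real^'n \<Rightarrow> real) \<Rightarrow> 'n cfun set"
  where "rho_space P = {f \<in> meas_funs. \<exists>l>0. rho P (\<lambda>x. cmod (f x) / l) < \<infinity>}"

context bounded_exponent begin

text \<open>Replaces the triangle inequality. Since (a + b) / 4 is at most half the maximum of a and
  b, a factor 1/2 comes out of the power and compensates the sum of two modulars.\<close>

lemma rho_quasi_add:
  assumes [measurable]: "a \<in> borel_measurable lebesgue" "b \<in> borel_measurable lebesgue"
    and nn: "\<And>x. 0 \<le> a x" "\<And>x. 0 \<le> b x" and a: "rho P a \<le> 1" and b: "rho P b \<le> 1"
    and c: "AE x in lebesgue. 0 \<le> c x \<and> c x \<le> a x + b x"
  shows "rho P (\<lambda>x. c x / 4) \<le> 1"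
proof -
  have "rho P (\<lambda>x. c x / 4) \<le> (\<integral>\<^sup>+x. ennreal (1/2) * (ennreal (a x powr P x) + ennreal (b x powr P x)) \<partial>lebesgue)"
    unfolding rho_def
  proof (rule nn_integral_mono_AE)
    show "AE x in lebesgue. ennreal ((c x / 4) powr P x) \<le> ennreal (1/2) * (ennreal (a x powr P x) + ennreal (b x powr P x))"
      using c
    proof eventually_elim
      case (elim x)
      define m where "m = max (a x) (b x)"
      have m: "0 \<le> m" using nn[of x] by (simp add: m_def)
      have "(c x / 4) powr P x \<le> (1/2 * m) powr P x"
        using elim P_ge_1[of x] by (intro powr_mono2) (auto simp: m_def)
      also have "\<dots> \<le> 1/2 * m powr P x" using m by (intro powr_P_scale_le) auto
      also have "\<dots> \<le> 1/2 * (a x powr P x + b x powr P x)" by (auto simp: m_def max_def)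
      finally have "ennreal ((c x / 4) powr P x) \<le> ennreal (1/2 * (a x powr P x + b x powr P x))"
        by (rule ennreal_leI)
      also have "\<dots> = ennreal (1/2) * (ennreal (a x powr P x) + ennreal (b x powr P x))"
        unfolding ennreal_plus[OF powr_ge_zero powr_ge_zero, symmetric] by (rule ennreal_mult') simp
      finally show ?case .
    qed
  qed
  also have "\<dots> = ennreal (1/2) * (rho P a + rho P b)"
    unfolding rho_def by (subst nn_integral_cmult; (subst nn_integral_add)?; simp)
  also have "\<dots> \<le> ennreal (1/2) * (1 + 1)" by (intro mult_left_mono add_mono a b) simp
  also have "\<dots> = ennreal (1/2) * ennreal 2" by simp
  also have "\<dots> = ennreal (1/2 * 2)" by (rule ennreal_mult'[symmetric]) simp
  finally show ?thesis by simp
qed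

lemma rho_null: "AE x in lebesgue. f x = 0 \<Longrightarrow> rho P f = 0"
proof -
  assume "AE x in lebesgue. f x = 0"
  then have "rho P f = (\<integral>\<^sup>+x. 0 \<partial>(lebesgue :: (real^'n) measure))"
    unfolding rho_def by (intro nn_integral_cong_AE, eventually_elim) simp
  then show ?thesis by simp
qed

text \<open>Approximation at a geometric rate is what makes the images converge almost everywhere.\<close>

definition appr :: "'n cfun \<Rightarrow> (nat \<Rightarrow> 'n cfun) \<Rightarrow> real \<Rightarrow> bool"
  where "appr f s C \<longleftrightarrow> 0 < C \<and> (\<forall>j. s j \<in> L0inf \<and> rho P (\<lambda>x. cmod (f x - s j x) * 4 ^ j / C) \<le> 1)"

lemma apprI:
  assumes "0 < C" "\<And>j. s j \<in> L0inf" "\<And>j. rho P (\<lambda>x. cmod (f x - s j x) * 4 ^ j / C) \<le> 1"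
  shows "appr f s C"
  using assms by (simp add: appr_def)

lemma appr_weaken:
  assumes s: "appr f s C" and C: "0 < C'" and t: "\<And>j. t j \<in> L0inf"
    and le: "\<And>j. AE x in lebesgue. cmod (g x - t j x) / C' \<le> cmod (f x - s j x) / C"
  shows "appr g t C'"
proof (rule apprI[OF C t])
  fix j
  have "rho P (\<lambda>x. cmod (g x - t j x) * 4 ^ j / C') \<le> rho P (\<lambda>x. cmod (f x - s j x) * 4 ^ j / C)"
  proof (rule rho_mono_AE)
    show "AE x in lebesgue. 0 \<le> cmod (g x - t j x) * 4 ^ j / C' \<and> cmod (g x - t j x) * 4 ^ j / C' \<le> cmod (f x - s j x) * 4 ^ j / C"
      using le[of j]
    proof eventually_elim
      case (elim x)
      then have "cmod (g x - t j x) / C' * 4 ^ j \<le> cmod (f x - s j x) / C * 4 ^ j" by (rule mult_right_mono) simp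
      then show ?case using C by simp
    qed
  qed
  then show "rho P (\<lambda>x. cmod (g x - t j x) * 4 ^ j / C') \<le> 1" using s unfolding appr_def by (meson order_trans)
qed

text \<open>Truncation in value and in space, with dominated convergence in the modular. The bound
  by |f| is recorded so that the truncations inherit modular bounds of f.\<close>

lemma appr_exists:
  fixes f :: "'n cfun"
  assumes "f \<in> rho_space P"
  obtains s where "appr f s 1" "\<And>j x. cmod (s j x) \<le> cmod (f x)"
proof -
  have fm[measurable]: "f \<in> borel_measurable lebesgue" using assms by (simp add: rho_space_def)
  obtain l where l: "0 < l" "rho P (\<lambda>x. cmod (f x) / l) < \<infinity>" using assms by (auto simp: rho_space_def)
  define T where "T N x = indicator {x. cmod (f x) \<le> real N \<and> norm x \<le> real N} x * f x" for N :: nat and x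
  have Ts[measurable]: "{x. cmod (f x) \<le> real N \<and> norm x \<le> real N} \<in> sets lebesgue" for N :: nat
  proof -
    have "{x. cmod (f x) \<le> real N} \<in> sets lebesgue"
      using measurable_sets[of "\<lambda>x. cmod (f x)" lebesgue borel "{..real N}"] by (simp add: vimage_def)
    moreover have "cball 0 (real N) \<in> sets lebesgue" by simp
    ultimately have "{x. cmod (f x) \<le> real N} \<inter> cball 0 (real N) \<in> sets lebesgue" by (rule sets.Int)
    then show ?thesis by (simp add: Int_def)
  qed
  have Tm[measurable]: "T N \<in> borel_measurable lebesgue" for N unfolding T_def[abs_def] by measurable
  have TL: "T N \<in> L0inf" for N
  proof -
    have "AE x in lebesgue. cmod (T N x) \<le> real N \<and> (real N < norm x \<longrightarrow> T N x = 0)"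
      by (rule AE_I2) (auto simp: T_def indicator_def)
    then show ?thesis unfolding L0inf_iff using Tm by blast
  qed
  have Tle: "cmod (T N x) \<le> cmod (f x)" for N x by (simp add: T_def indicator_def)
  have "\<exists>N. rho P (\<lambda>x. cmod (f x - T N x) * 4 ^ j / 1) \<le> 1" for j
  proof -
    have lim: "(\<lambda>N. rho P (\<lambda>x. cmod (f x - T N x) * 4 ^ j / 1)) \<longlonglongrightarrow> (\<integral>\<^sup>+x. 0 \<partial>(lebesgue :: (real^'n) measure))"
      unfolding rho_def
    proof (rule nn_integral_dominated_convergence)
      show "(\<integral>\<^sup>+x. ennreal ((cmod (f x) * 4 ^ j) powr P x) \<partial>lebesgue) < \<infinity>"
      proof -
        \<comment> \<open>The factor is raised to at least 1, where \<open>powr_P_scale_ge\<close>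
          applies.\<close>
        have "(\<integral>\<^sup>+x. ennreal ((cmod (f x) * 4 ^ j) powr P x) \<partial>lebesgue)
           \<le> (\<integral>\<^sup>+x. ennreal (max 1 (4 ^ j * l) powr pp) * ennreal ((cmod (f x) / l) powr P x) \<partial>lebesgue)"
        proof (rule nn_integral_mono)
          fix x
          have "(cmod (f x) * 4 ^ j) powr P x \<le> (max 1 (4 ^ j * l) * (cmod (f x) / l)) powr P x"
          proof (rule powr_mono2)
            have "4 ^ j * l * (cmod (f x) / l) \<le> max 1 (4 ^ j * l) * (cmod (f x) / l)"
              using l by (intro mult_right_mono) auto
            then show "cmod (f x) * 4 ^ j \<le> max 1 (4 ^ j * l) * (cmod (f x) / l)" using l by (simp add: mult.commute)
          qed (use P_ge_1[of x] in auto)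
          also have "\<dots> \<le> max 1 (4 ^ j * l) powr pp * (cmod (f x) / l) powr P x"
            using l by (intro powr_P_scale_ge) auto
          finally show "ennreal ((cmod (f x) * 4 ^ j) powr P x) \<le> ennreal (max 1 (4 ^ j * l) powr pp) * ennreal ((cmod (f x) / l) powr P x)"
            by (subst ennreal_mult'[symmetric]) (auto intro: ennreal_leI)
        qed
        also have "\<dots> = ennreal (max 1 (4 ^ j * l) powr pp) * rho P (\<lambda>x. cmod (f x) / l)"
          unfolding rho_def by (rule nn_integral_cmult) measurable
        also have "\<dots> < \<infinity>" using l by (simp add: ennreal_mult_less_top)
        finally show ?thesis .
      qed
      fix N
      have "(\<lambda>x. f x - T N x) \<in> borel_measurable lebesgue" by (intro borel_measurable_diff fm Tm)
      then show "(\<lambda>x. ennreal ((cmod (f x - T N x) * 4 ^ j / 1) powr P x)) \<in> borel_measurable lebesgue" by measurable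
      show "AE x in lebesgue. ennreal ((cmod (f x - T N x) * 4 ^ j / 1) powr P x) \<le> ennreal ((cmod (f x) * 4 ^ j) powr P x)"
      proof (rule AE_I2)
        fix x
        have "cmod (f x - T N x) \<le> cmod (f x)" by (simp add: T_def indicator_def)
        then show "ennreal ((cmod (f x - T N x) * 4 ^ j / 1) powr P x) \<le> ennreal ((cmod (f x) * 4 ^ j) powr P x)"
          using P_ge_1[of x] by (intro ennreal_leI powr_mono2) (auto intro: mult_right_mono)
      qed
    next
      show "AE x in lebesgue. (\<lambda>N. ennreal ((cmod (f x - T N x) * 4 ^ j / 1) powr P x)) \<longlonglongrightarrow> 0"
      proof (rule AE_I2)
        fix x
        obtain N0 :: nat where N0: "max (cmod (f x)) (norm x) \<le> real N0" using real_arch_simple by blast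
        have "ennreal ((cmod (f x - T N x) * 4 ^ j / 1) powr P x) = 0" if "N0 \<le> N" for N
        proof -
          have "real N0 \<le> real N" using that by simp
          then have "T N x = f x" using N0 by (simp add: T_def)
          then show ?thesis by simp
        qed
        then show "(\<lambda>N. ennreal ((cmod (f x - T N x) * 4 ^ j / 1) powr P x)) \<longlonglongrightarrow> 0"
          by (intro tendsto_eventually) (auto simp: eventually_sequentially)
      qed
    qed simp_all
    then have "eventually (\<lambda>N. rho P (\<lambda>x. cmod (f x - T N x) * 4 ^ j / 1) < 1) sequentially"
      by (intro order_tendstoD(2)[OF lim]) simp
    then obtain N where "rho P (\<lambda>x. cmod (f x - T N x) * 4 ^ j / 1) < 1"
      unfolding eventually_sequentially by blast
    then show ?thesis by (intro exI[of _ N] less_imp_le)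
  qed
  then have "\<forall>j. \<exists>N. rho P (\<lambda>x. cmod (f x - T N x) * 4 ^ j / 1) \<le> 1" by (rule allI)
  from choice[OF this] obtain \<nu> where \<nu>: "\<And>j. rho P (\<lambda>x. cmod (f x - T (\<nu> j) x) * 4 ^ j / 1) \<le> 1" by blast
  have "appr f (\<lambda>j. T (\<nu> j)) 1" by (rule apprI) (use TL \<nu> in auto)
  then show thesis using that[of "\<lambda>j. T (\<nu> j)"] Tle by blast
qed

lemma appr_add:
  assumes f: "f \<in> meas_funs" "appr f s C" and g: "g \<in> meas_funs" "appr g t D"
  shows "appr (\<lambda>x. f x + g x) (\<lambda>j x. s j x + t j x) (4 * (C + D))"
proof (rule apprI)
  have CD: "0 < C" "0 < D" using f g by (auto simp: appr_def)
  then show "0 < 4 * (C + D)" by simp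
  fix j
  have sj: "s j \<in> L0inf" "t j \<in> L0inf" using f g by (auto simp: appr_def)
  then show "(\<lambda>x. s j x + t j x) \<in> L0inf" by (rule L0inf_add)
  note [measurable] = L0inf_measurable[OF sj(1)] L0inf_measurable[OF sj(2)] f(1) g(1)
  have "rho P (\<lambda>x. (cmod (f x + g x - (s j x + t j x)) * 4 ^ j / (C + D)) / 4) \<le> 1"
  proof (rule rho_quasi_add)
    show "rho P (\<lambda>x. cmod (f x - s j x) * 4 ^ j / C) \<le> 1" "rho P (\<lambda>x. cmod (g x - t j x) * 4 ^ j / D) \<le> 1"
      using f g by (auto simp: appr_def)
    show "AE x in lebesgue. 0 \<le> cmod (f x + g x - (s j x + t j x)) * 4 ^ j / (C + D) \<and>
       cmod (f x + g x - (s j x + t j x)) * 4 ^ j / (C + D) \<le> cmod (f x - s j x) * 4 ^ j / C + cmod (g x - t j x) * 4 ^ j / D"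
    proof (rule AE_I2)
      fix x
      have "cmod (f x + g x - (s j x + t j x)) \<le> cmod (f x - s j x) + cmod (g x - t j x)"
        using norm_triangle_ineq[of "f x - s j x" "g x - t j x"] by (simp add: algebra_simps)
      then have "cmod (f x + g x - (s j x + t j x)) * 4 ^ j / (C + D) \<le> (cmod (f x - s j x) + cmod (g x - t j x)) * 4 ^ j / (C + D)"
        using CD by (intro divide_right_mono mult_right_mono) auto
      also have "\<dots> = cmod (f x - s j x) * 4 ^ j / (C + D) + cmod (g x - t j x) * 4 ^ j / (C + D)"
        by (simp add: distrib_right add_divide_distrib)
      also have "\<dots> \<le> cmod (f x - s j x) * 4 ^ j / C + cmod (g x - t j x) * 4 ^ j / D"
        using CD by (intro add_mono divide_left_mono) auto
      finally show "0 \<le> cmod (f x + g x - (s j x + t j x)) * 4 ^ j / (C + D) \<and>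
       cmod (f x + g x - (s j x + t j x)) * 4 ^ j / (C + D) \<le> cmod (f x - s j x) * 4 ^ j / C + cmod (g x - t j x) * 4 ^ j / D"
        using CD by simp
    qed
    show "(\<lambda>x. cmod (f x - s j x) * 4 ^ j / C) \<in> borel_measurable lebesgue" by measurable
    show "(\<lambda>x. cmod (g x - t j x) * 4 ^ j / D) \<in> borel_measurable lebesgue" by measurable
  qed (use CD in auto)
  then show "rho P (\<lambda>x. cmod (f x + g x - (s j x + t j x)) * 4 ^ j / (4 * (C + D))) \<le> 1"
    by (simp add: mult.commute)
qed

lemma appr_scale:
  assumes "appr f s C" shows "appr (\<lambda>x. c * f x) (\<lambda>j x. c * s j x) (C * max 1 (cmod c))"
proof (rule appr_weaken[OF assms])
  have C: "0 < C" using assms by (simp add: appr_def)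
  then show "0 < C * max 1 (cmod c)" by simp
  fix j
  show "(\<lambda>x. c * s j x) \<in> L0inf" using assms by (intro L0inf_scale) (simp add: appr_def)
  show "AE x in lebesgue. cmod (c * f x - c * s j x) / (C * max 1 (cmod c)) \<le> cmod (f x - s j x) / C"
  proof (rule AE_I2)
    fix x
    have "cmod (c * f x - c * s j x) = cmod c * cmod (f x - s j x)"
      by (simp add: norm_mult[symmetric] algebra_simps)
    also have "\<dots> / (C * max 1 (cmod c)) \<le> max 1 (cmod c) * cmod (f x - s j x) / (C * max 1 (cmod c))"
      using C by (intro divide_right_mono mult_right_mono) auto
    also have "\<dots> = cmod (f x - s j x) / C" by simp
    finally show "cmod (c * f x - c * s j x) / (C * max 1 (cmod c)) \<le> cmod (f x - s j x) / C" .
  qed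
qed

lemma rho_space_iff:
  "f \<in> rho_space P \<longleftrightarrow> f \<in> meas_funs \<and> (\<exists>l>0. rho P (\<lambda>x. cmod (f x) / l) \<le> 1)"
proof
  assume f: "f \<in> rho_space P"
  then have [measurable]: "f \<in> borel_measurable lebesgue" by (simp add: rho_space_def)
  obtain l where l: "0 < l" "rho P (\<lambda>x. cmod (f x) / l) < \<infinity>" using f by (auto simp: rho_space_def)
  then obtain v where v: "rho P (\<lambda>x. cmod (f x) / l) = ennreal v" "0 \<le> v"
    by (cases "rho P (\<lambda>x. cmod (f x) / l)") auto
  define t where "t = 1 / max 1 v"
  have t: "0 < t" "t \<le> 1" by (auto simp: t_def)
  have "rho P (\<lambda>x. t * (cmod (f x) / l)) \<le> ennreal t * ennreal v"
    using rho_scale_le[of "\<lambda>x. cmod (f x) / l" t] t l unfolding v(1)[symmetric] by simp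
  also have "\<dots> = ennreal (t * v)" using t by (intro ennreal_mult'[symmetric]) simp
  also have "\<dots> \<le> 1"
  proof -
    have "0 < max 1 v" by (simp add: less_max_iff_disj)
    then have "t * v \<le> 1" by (simp add: t_def divide_le_eq_1_pos)
    then show ?thesis by (simp add: ennreal_le_1)
  qed
  finally have "rho P (\<lambda>x. cmod (f x) / (l / t)) \<le> 1" by (simp add: mult.commute)
  then show "f \<in> meas_funs \<and> (\<exists>l>0. rho P (\<lambda>x. cmod (f x) / l) \<le> 1)" using t l by (intro conjI exI[of _ "l / t"]) auto
next
  assume "f \<in> meas_funs \<and> (\<exists>l>0. rho P (\<lambda>x. cmod (f x) / l) \<le> 1)"
  then obtain l where "f \<in> meas_funs" "0 < l" "rho P (\<lambda>x. cmod (f x) / l) \<le> 1" by blast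
  then show "f \<in> rho_space P"
    unfolding rho_space_def by (intro CollectI conjI exI[of _ l]) (auto intro: le_less_trans[of _ 1])
qed

lemma rho_space_add:
  assumes f: "f \<in> rho_space P" and g: "g \<in> rho_space P" shows "(\<lambda>x. f x + g x) \<in> rho_space P"
proof -
  have [measurable]: "f \<in> borel_measurable lebesgue" "g \<in> borel_measurable lebesgue"
    using f g by (auto simp: rho_space_def)
  obtain l m where l: "0 < l" "rho P (\<lambda>x. cmod (f x) / l) \<le> 1" and m: "0 < m" "rho P (\<lambda>x. cmod (g x) / m) \<le> 1"
    using f g unfolding rho_space_iff by blast
  have "rho P (\<lambda>x. (cmod (f x + g x) / (l + m)) / 4) \<le> 1"
  proof (rule rho_quasi_add[OF _ _ _ _ l(2) m(2)])
    show "AE x in lebesgue. 0 \<le> cmod (f x + g x) / (l + m) \<and> cmod (f x + g x) / (l + m) \<le> cmod (f x) / l + cmod (g x) / m"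
    proof (rule AE_I2)
      fix x
      have "cmod (f x + g x) / (l + m) \<le> (cmod (f x) + cmod (g x)) / (l + m)"
        using l m by (intro divide_right_mono norm_triangle_ineq) auto
      also have "\<dots> = cmod (f x) / (l + m) + cmod (g x) / (l + m)" by (rule add_divide_distrib)
      also have "\<dots> \<le> cmod (f x) / l + cmod (g x) / m"
        using l m by (intro add_mono divide_left_mono) auto
      finally show "0 \<le> cmod (f x + g x) / (l + m) \<and> cmod (f x + g x) / (l + m) \<le> cmod (f x) / l + cmod (g x) / m"
        using l m by simp
    qed
  qed (use l m in \<open>simp_all\<close>)
  then show ?thesis unfolding rho_space_iff using l m by (intro conjI exI[of _ "(l + m) * 4"]) auto
qed

lemma rho_space_scale:
  assumes f: "f \<in> rho_space P" shows "(\<lambda>x. c * f x) \<in> rho_space P"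
proof -
  have [measurable]: "f \<in> borel_measurable lebesgue" using f by (auto simp: rho_space_def)
  obtain l where l: "0 < l" "rho P (\<lambda>x. cmod (f x) / l) \<le> 1" using f unfolding rho_space_iff by blast
  have "rho P (\<lambda>x. cmod (c * f x) / (l * max 1 (cmod c))) \<le> rho P (\<lambda>x. cmod (f x) / l)"
  proof (rule rho_mono_AE, rule AE_I2)
    fix x
    have "cmod (c * f x) / (l * max 1 (cmod c)) \<le> max 1 (cmod c) * cmod (f x) / (l * max 1 (cmod c))"
      unfolding norm_mult using l by (intro divide_right_mono mult_right_mono) auto
    then show "0 \<le> cmod (c * f x) / (l * max 1 (cmod c)) \<and> cmod (c * f x) / (l * max 1 (cmod c)) \<le> cmod (f x) / l"
      using l by simp
  qed
  then have "rho P (\<lambda>x. cmod (c * f x) / (l * max 1 (cmod c))) \<le> 1" using l(2) by (rule order_trans)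
  then show ?thesis unfolding rho_space_iff using l by (intro conjI exI[of _ "l * max 1 (cmod c)"]) auto
qed

lemma appr_cong:
  assumes "appr f s C" "AE x in lebesgue. f x = g x" shows "appr g s C"
proof (rule appr_weaken[OF assms(1)])
  show "AE x in lebesgue. cmod (g x - s j x) / C \<le> cmod (f x - s j x) / C" for j
    using assms(2) by eventually_elim simp
qed (use assms(1) in \<open>auto simp: appr_def\<close>)

text \<open>A sequence and its shift are thus two approximations of the same function, and comparing
  their images controls consecutive differences.\<close>

lemma appr_Suc:
  assumes "appr f s C" shows "appr f (\<lambda>j. s (Suc j)) C"
proof (rule apprI)
  show "0 < C" using assms by (simp add: appr_def)
  fix j
  show "s (Suc j) \<in> L0inf" using assms by (simp add: appr_def)
  have "rho P (\<lambda>x. cmod (f x - s (Suc j) x) * 4 ^ j / C) \<le> rho P (\<lambda>x. cmod (f x - s (Suc j) x) * 4 ^ Suc j / C)"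
    using assms by (intro rho_mono_AE AE_I2) (auto simp: appr_def intro!: divide_right_mono mult_left_mono)
  then show "rho P (\<lambda>x. cmod (f x - s (Suc j) x) * 4 ^ j / C) \<le> 1"
    using assms unfolding appr_def by (meson order_trans)
qed

end

section \<open>Almost everywhere convergence of the images\<close>

context modulated_operator begin

lemma U_bound_scaled:
  assumes L: "0 < L" and bd: "\<forall>f\<in>L0inf. rho P (\<lambda>x. cmod (f x)) \<le> 1 \<longrightarrow> rho P (\<lambda>x. U f x / L) \<le> 1"
    and h: "h \<in> L0inf" and t: "0 < t" and rh: "rho P (\<lambda>x. cmod (h x) / t) \<le> 1"
  shows "rho P (\<lambda>x. U h x / (L * t)) \<le> 1"
proof -
  let ?h = "\<lambda>x. of_real (1 / t) * h x"
  have hL: "?h \<in> L0inf" by (rule L0inf_scale[OF h])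
  have "(\<lambda>x. cmod (?h x)) = (\<lambda>x. cmod (h x) / t)" using t by (auto simp: norm_mult norm_divide)
  then have "rho P (\<lambda>x. U ?h x / L) \<le> 1" using bd[rule_format, OF hL] rh by simp
  moreover have "rho P (\<lambda>x. U h x / (L * t)) \<le> rho P (\<lambda>x. U ?h x / L)"
  proof (rule rho_mono_AE)
    show "AE x in lebesgue. 0 \<le> U h x / (L * t) \<and> U h x / (L * t) \<le> U ?h x / L"
      using U_scale[OF h, of "of_real (1 / t)"]
      by eventually_elim (use L t U_nonneg in \<open>auto simp: norm_divide field_simps\<close>)
  qed
  ultimately show ?thesis by (rule order_trans[rotated])
qed

text \<open>The functions h j have size 4^(-j), and so have their images. Enlarged by 2^j, and
  normalised by L K, the images still have modulars at most 2^(-j); these are summable, so the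
  powers tend to 0 a.e.\<close>

lemma U_small:
  assumes L: "0 < L" and bd: "\<forall>f\<in>L0inf. rho P (\<lambda>x. cmod (f x)) \<le> 1 \<longrightarrow> rho P (\<lambda>x. U f x / L) \<le> 1"
    and h: "appr (\<lambda>_. 0) h K"
  shows "AE x in lebesgue. \<forall>\<^sub>F j in sequentially. U (h j) x \<le> K * L * (1/2) ^ j"
proof -
  have K: "0 < K" and hL: "\<And>j. h j \<in> L0inf" and rh: "\<And>j. rho P (\<lambda>x. cmod (h j x) * 4 ^ j / K) \<le> 1"
    using h by (auto simp: appr_def)
  note [measurable] = U_meas[OF hL]
  define u where "u j x = U (h j) x * 4 ^ j / (L * K)" for j x
  have um[measurable]: "u j \<in> borel_measurable lebesgue" for j unfolding u_def[abs_def] by measurable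
  have u0: "0 \<le> u j x" for j x using U_nonneg L K by (simp add: u_def)
  have u1: "rho P (u j) \<le> 1" for j
  proof -
    have "rho P (\<lambda>x. U (h j) x / (L * (K / 4 ^ j))) \<le> 1"
      using rh[of j] K by (intro U_bound_scaled[OF L bd hL]) auto
    then show ?thesis by (simp add: u_def[abs_def])
  qed
  define q :: real where "q = 1 / 2"
  have q: "0 \<le> q" "q < 1" by (auto simp: q_def)
  have ru: "rho P (\<lambda>x. q ^ j * u j x) \<le> ennreal (1 * q ^ j)" for j
  proof -
    have "rho P (\<lambda>x. q ^ j * u j x) \<le> ennreal (q ^ j) * rho P (u j)"
      using q u0 by (intro rho_scale_le) (auto intro: power_le_one)
    also have "\<dots> \<le> ennreal (q ^ j) * 1" by (intro mult_left_mono u1) simp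
    finally show ?thesis by simp
  qed
  define V where "V x = (\<Sum>j. ennreal ((q ^ j * u j x) powr P x))" for x
  have Vm: "V \<in> borel_measurable lebesgue" unfolding V_def[abs_def] by measurable
  have "(\<integral>\<^sup>+x. V x \<partial>lebesgue) = (\<Sum>j. rho P (\<lambda>x. q ^ j * u j x))"
    unfolding V_def rho_def by (rule nn_integral_suminf) measurable
  also have "\<dots> \<le> (\<Sum>j. ennreal (1 * q ^ j))" by (intro suminf_le ru summableI)
  also have "\<dots> = ennreal (1 / (1 - q))" using q by (intro suminf_ennreal_geometric) auto
  finally have "(\<integral>\<^sup>+x. V x \<partial>lebesgue) \<noteq> \<infinity>" by (auto simp: top_unique)
  then have "AE x in lebesgue. V x \<noteq> \<infinity>" by (rule nn_integral_noteq_infinite[OF Vm])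
  then show ?thesis
  proof eventually_elim
    case (elim x)
    have "summable (\<lambda>j. (q ^ j * u j x) powr P x)"
      using elim unfolding V_def by (intro summable_suminf_not_top) auto
    then have "(\<lambda>j. (q ^ j * u j x) powr P x) \<longlonglongrightarrow> 0" by (rule summable_LIMSEQ_zero)
    then have "\<forall>\<^sub>F j in sequentially. (q ^ j * u j x) powr P x < 1" by (rule order_tendstoD) simp
    then show ?case
    proof eventually_elim
      case (elim j)
      have "q ^ j * u j x < 1"
      proof (rule ccontr)
        assume "\<not> ?thesis"
        then have "1 \<le> (q ^ j * u j x) powr P x" using P_ge_1[of x] by (intro ge_one_powr_ge_zero) auto
        then show False using elim by simp
      qed
      moreover have "q ^ j * u j x = U (h j) x * 2 ^ j / (L * K)"
      proof -
        have "q ^ j * 4 ^ j = (2::real) ^ j" unfolding power_mult_distrib[symmetric] by (simp add: q_def)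
        then show ?thesis unfolding u_def by (simp add: ac_simps)
      qed
      ultimately have "U (h j) x * 2 ^ j < K * L" using L K by (simp add: divide_less_eq mult.commute)
      then have "U (h j) x < K * L / 2 ^ j" by (simp add: less_divide_eq)
      then show "U (h j) x \<le> K * L * (1/2) ^ j" by (simp add: power_one_over)
    qed
  qed
qed

text \<open>The difference of two approximations of f approximates 0 at the same rate.\<close>

lemma appr_U_diff:
  assumes L: "0 < L" and bd: "\<forall>f\<in>L0inf. rho P (\<lambda>x. cmod (f x)) \<le> 1 \<longrightarrow> rho P (\<lambda>x. U f x / L) \<le> 1"
    and f: "f \<in> meas_funs" and s: "appr f s C" and t: "appr f t D"
  obtains K where "AE x in lebesgue. \<forall>\<^sub>F j in sequentially. \<bar>U (s j) x - U (t j) x\<bar> \<le> K * (1/2) ^ j"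
proof -
  have sL: "s j \<in> L0inf" "t j \<in> L0inf" for j using s t by (auto simp: appr_def)
  have fm: "(\<lambda>x. - 1 * f x) \<in> meas_funs" using f by simp
  have "appr (\<lambda>x. f x + - 1 * f x) (\<lambda>j x. s j x + - 1 * t j x) (4 * (C + D * max 1 (cmod (- 1))))"
    by (rule appr_add[OF f s fm appr_scale[OF t]])
  then have h: "appr (\<lambda>_. 0) (\<lambda>j x. s j x - t j x) (4 * (C + D))" by simp
  have "AE x in lebesgue. \<forall>j. \<bar>U (s j) x - U (t j) x\<bar> \<le> U (\<lambda>x. s j x - t j x) x"
    unfolding AE_all_countable using U_diff[OF sL] by blast
  then have "AE x in lebesgue. \<forall>\<^sub>F j in sequentially. \<bar>U (s j) x - U (t j) x\<bar> \<le> 4 * (C + D) * L * (1/2) ^ j"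
    using U_small[OF L bd h]
  proof eventually_elim
    case (elim x)
    show ?case using elim(2) by eventually_elim (use elim(1) in \<open>meson order_trans\<close>)
  qed
  then show thesis by (rule that)
qed

lemma appr_U_convergent:
  assumes L: "0 < L" and bd: "\<forall>f\<in>L0inf. rho P (\<lambda>x. cmod (f x)) \<le> 1 \<longrightarrow> rho P (\<lambda>x. U f x / L) \<le> 1"
    and f: "f \<in> meas_funs" and s: "appr f s C"
  shows "AE x in lebesgue. convergent (\<lambda>j. U (s j) x)"
proof -
  obtain K where "AE x in lebesgue. \<forall>\<^sub>F j in sequentially. \<bar>U (s (Suc j)) x - U (s j) x\<bar> \<le> K * (1/2) ^ j"
    by (rule appr_U_diff[OF L bd f appr_Suc[OF s] s])
  then show ?thesis
  proof eventually_elim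
    case (elim x)
    have "summable (\<lambda>j. K * (1/2 :: real) ^ j)" by (intro summable_mult summable_geometric) simp
    then have "summable (\<lambda>j. U (s (Suc j)) x - U (s j) x)"
      by (rule summable_comparison_test_ev[rotated]) (use elim in simp)
    then have "convergent (\<lambda>n. U (s n) x - U (s 0) x)"
      by (simp only: summable_iff_convergent sum_lessThan_telescope[of "\<lambda>j. U (s j) x"])
    then have "convergent (\<lambda>n. (U (s n) x - U (s 0) x) + U (s 0) x)"
      by (intro convergent_add convergent_const)
    then show ?case by simp
  qed
qed

text \<open>S f is the a.e. limit of U along a chosen approximation of f. By \<open>Slim\<close>
  every approximation gives the same limit, so each property follows from an adapted one: the
  constant sequence on \<open>L0inf\<close>, sums and multiples of sequences for sublinearity.
  Dominated approximations and Fatou's lemma give the bound.\<close>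

lemma U_extension:
  "\<exists>S L. 0 < L \<and> (\<forall>f x. 0 \<le> S f x) \<and>
     (\<forall>f\<in>rho_space P. S f \<in> borel_measurable lebesgue) \<and>
     (\<forall>f\<in>L0inf. AE x in lebesgue. S f x = U f x) \<and>
     (\<forall>f\<in>rho_space P. \<forall>g\<in>rho_space P. (AE x in lebesgue. f x = g x) \<longrightarrow> (AE x in lebesgue. S f x = S g x)) \<and>
     (\<forall>f\<in>rho_space P. \<forall>g\<in>rho_space P. AE x in lebesgue. S (\<lambda>y. f y + g y) x \<le> S f x + S g x) \<and>
     (\<forall>f\<in>rho_space P. \<forall>c. AE x in lebesgue. S (\<lambda>y. c * f y) x = cmod c * S f x) \<and>
     (\<forall>f\<in>rho_space P. \<forall>l>0. rho P (\<lambda>x. cmod (f x) / l) \<le> 1 \<longrightarrow> rho P (\<lambda>x. S f x / (L * l)) \<le> 1)"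
proof -
  obtain L where L: "0 < L" and bd: "\<forall>f\<in>L0inf. rho P (\<lambda>x. cmod (f x)) \<le> 1 \<longrightarrow> rho P (\<lambda>x. U f x / L) \<le> 1"
    by (rule U_bounded) blast
  let ?ok = "\<lambda>f s. appr f s 1 \<and> (\<forall>j x. cmod (s j x) \<le> cmod (f x))"
  have "\<forall>f\<in>rho_space P. \<exists>s. ?ok f s"
  proof
    fix f assume "f \<in> rho_space P"
    then show "\<exists>s. ?ok f s" by (rule appr_exists) blast
  qed
  from bchoice[OF this] obtain \<sigma> where \<sigma>: "\<And>f. f \<in> rho_space P \<Longrightarrow> ?ok f (\<sigma> f)" by blast
  \<comment> \<open>Taking the maximum with 0 makes S nonnegative also on the null set where the
    limit may fail to exist.\<close>
  define S where "S f x = max 0 (lim (\<lambda>j. U (\<sigma> f j) x))" for f x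
  have Xm: "f \<in> meas_funs" if "f \<in> rho_space P" for f using that by (simp add: rho_space_def)
  have L0X: "f \<in> rho_space P" if f: "f \<in> L0inf" for f
  proof -
    obtain R :: nat where R: "AE x in lebesgue. cmod (f x) \<le> real R \<and> (real R < norm x \<longrightarrow> f x = 0)"
      using f by (auto simp: L0inf_iff)
    have "rho P (\<lambda>x. cmod (f x) / real (Suc R)) \<le> (\<integral>\<^sup>+x. indicator (cball (0::real^'n) (real R)) x \<partial>lebesgue)"
      unfolding rho_def
    proof (rule nn_integral_mono_AE)
      show "AE x in lebesgue. ennreal ((cmod (f x) / real (Suc R)) powr P x) \<le> indicator (cball 0 (real R)) x"
        using R
      proof eventually_elim
        case (elim x)
        have "cmod (f x) / real (Suc R) \<le> 1" using elim by (simp add: divide_le_eq)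
        then have "(cmod (f x) / real (Suc R)) powr P x \<le> 1" using P_ge_1[of x] by (intro powr_le1) auto
        then show ?case using elim by (auto simp: indicator_def ennreal_le_1)
      qed
    qed
    also have "\<dots> < \<infinity>"
      using lmeasurable_cball[of "0::real^'n" "real R"] by (simp add: fmeasurable_def)
    finally show ?thesis using L0inf_measurable[OF f] unfolding rho_space_def by (auto intro!: exI[of _ "real (Suc R)"] simp del: of_nat_Suc)
  qed
  have Slim: "AE x in lebesgue. (\<lambda>j. U (s j) x) \<longlonglongrightarrow> S f x" if f: "f \<in> rho_space P" and s: "appr f s C" for f s C
  proof -
    have \<sigma>f: "appr f (\<sigma> f) 1" using \<sigma>[OF f] by blast
    obtain K where "AE x in lebesgue. \<forall>\<^sub>F j in sequentially. \<bar>U (s j) x - U (\<sigma> f j) x\<bar> \<le> K * (1/2) ^ j"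
      by (rule appr_U_diff[OF L bd Xm[OF f] s \<sigma>f])
    then show ?thesis using appr_U_convergent[OF L bd Xm[OF f] \<sigma>f]
    proof eventually_elim
      case (elim x)
      have l: "(\<lambda>j. U (\<sigma> f j) x) \<longlonglongrightarrow> lim (\<lambda>j. U (\<sigma> f j) x)" using elim(2) by (simp add: convergent_LIMSEQ_iff)
      then have "0 \<le> lim (\<lambda>j. U (\<sigma> f j) x)" by (rule LIMSEQ_le_const) (use U_nonneg in blast)
      then have l': "(\<lambda>j. U (\<sigma> f j) x) \<longlonglongrightarrow> S f x" using l by (simp add: S_def)
      have "(\<lambda>j. K * (1/2 :: real) ^ j) \<longlonglongrightarrow> K * 0"
        by (intro tendsto_mult tendsto_const LIMSEQ_realpow_zero) auto
      then have "(\<lambda>j. U (s j) x - U (\<sigma> f j) x) \<longlonglongrightarrow> 0"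
        by (intro Lim_null_comparison[OF _ tendsto_eq_rhs]) (use elim(1) in auto)
      from tendsto_add[OF this l'] show ?case by simp
    qed
  qed
  have S0: "0 \<le> S f x" for f x by (simp add: S_def)
  have Sm: "S f \<in> borel_measurable lebesgue" if f: "f \<in> rho_space P" for f
  proof -
    have "\<sigma> f j \<in> L0inf" for j using \<sigma>[OF f] by (auto simp: appr_def)
    then have "(\<lambda>x. lim (\<lambda>j. U (\<sigma> f j) x)) \<in> borel_measurable lebesgue"
      by (intro borel_measurable_lim_metric U_meas)
    then show ?thesis unfolding S_def[abs_def] by measurable
  qed
  have SU: "AE x in lebesgue. S f x = U f x" if f: "f \<in> L0inf" for f
  proof -
    have "appr f (\<lambda>_. f) 1"
      by (rule apprI) (use f in \<open>simp_all add: rho_null\<close>)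
    from Slim[OF L0X[OF f] this] show ?thesis
      by eventually_elim (rule LIMSEQ_unique[symmetric, OF tendsto_const])
  qed
  have Scong: "AE x in lebesgue. S f x = S g x" if f: "f \<in> rho_space P" and g: "g \<in> rho_space P" and fg: "AE x in lebesgue. f x = g x" for f g
  proof -
    have \<sigma>f: "appr f (\<sigma> f) 1" using \<sigma>[OF f] by blast
    show ?thesis using Slim[OF f \<sigma>f] Slim[OF g appr_cong[OF \<sigma>f fg]]
      by eventually_elim (rule LIMSEQ_unique)
  qed
  have Sadd: "AE x in lebesgue. S (\<lambda>y. f y + g y) x \<le> S f x + S g x" if f: "f \<in> rho_space P" and g: "g \<in> rho_space P" for f g
  proof -
    have \<sigma>f: "appr f (\<sigma> f) 1" and \<sigma>g: "appr g (\<sigma> g) 1" using \<sigma>[OF f] \<sigma>[OF g] by blast+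
    have sL: "\<sigma> f j \<in> L0inf" "\<sigma> g j \<in> L0inf" for j using \<sigma>f \<sigma>g by (auto simp: appr_def)
    have "AE x in lebesgue. \<forall>j. U (\<lambda>y. \<sigma> f j y + \<sigma> g j y) x \<le> U (\<sigma> f j) x + U (\<sigma> g j) x"
      unfolding AE_all_countable using U_add[OF sL] by blast
    then show ?thesis
      using Slim[OF f \<sigma>f] Slim[OF g \<sigma>g] Slim[OF rho_space_add[OF f g] appr_add[OF Xm[OF f] \<sigma>f Xm[OF g] \<sigma>g]]
    proof eventually_elim
      case (elim x)
      show ?case by (rule LIMSEQ_le[OF elim(4) tendsto_add[OF elim(2,3)]]) (use elim(1) in blast)
    qed
  qed
  have Sscale: "AE x in lebesgue. S (\<lambda>y. c * f y) x = cmod c * S f x" if f: "f \<in> rho_space P" for f c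
  proof -
    have \<sigma>f: "appr f (\<sigma> f) 1" using \<sigma>[OF f] by blast
    have sL: "\<sigma> f j \<in> L0inf" for j using \<sigma>f by (auto simp: appr_def)
    have "AE x in lebesgue. \<forall>j. U (\<lambda>y. c * \<sigma> f j y) x = cmod c * U (\<sigma> f j) x"
      unfolding AE_all_countable using U_scale[OF sL] by blast
    then show ?thesis using Slim[OF f \<sigma>f] Slim[OF rho_space_scale[OF f] appr_scale[OF \<sigma>f], of c]
    proof eventually_elim
      case (elim x)
      have "(\<lambda>j. cmod c * U (\<sigma> f j) x) \<longlonglongrightarrow> S (\<lambda>y. c * f y) x" using elim(3) unfolding elim(1)[rule_format] .
      then show ?case using tendsto_mult_left[OF elim(2)] by (rule LIMSEQ_unique)
    qed
  qed
  have Sbd: "rho P (\<lambda>x. S f x / (L * l)) \<le> 1" if f: "f \<in> rho_space P" and l: "0 < l" and fl: "rho P (\<lambda>x. cmod (f x) / l) \<le> 1" for f l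
  proof -
    have \<sigma>f: "appr f (\<sigma> f) 1" and dom: "\<And>j x. cmod (\<sigma> f j x) \<le> cmod (f x)" using \<sigma>[OF f] by blast+
    have sL: "\<sigma> f j \<in> L0inf" for j using \<sigma>f by (auto simp: appr_def)
    note [measurable] = U_meas[OF sL]
    have 1: "rho P (\<lambda>x. U (\<sigma> f j) x / (L * l)) \<le> 1" for j
    proof (rule U_bound_scaled[OF L bd sL l])
      have "rho P (\<lambda>x. cmod (\<sigma> f j x) / l) \<le> rho P (\<lambda>x. cmod (f x) / l)"
        using l dom by (intro rho_mono_AE AE_I2 conjI divide_right_mono) auto
      then show "rho P (\<lambda>x. cmod (\<sigma> f j x) / l) \<le> 1" using fl by (rule order_trans)
    qed
    have "rho P (\<lambda>x. S f x / (L * l)) = (\<integral>\<^sup>+x. liminf (\<lambda>j. ennreal ((U (\<sigma> f j) x / (L * l)) powr P x)) \<partial>lebesgue)"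
      unfolding rho_def
    proof (rule nn_integral_cong_AE)
      show "AE x in lebesgue. ennreal ((S f x / (L * l)) powr P x) = liminf (\<lambda>j. ennreal ((U (\<sigma> f j) x / (L * l)) powr P x))"
        using Slim[OF f \<sigma>f]
      proof eventually_elim
        case (elim x)
        have "(\<lambda>j. U (\<sigma> f j) x / (L * l)) \<longlonglongrightarrow> S f x / (L * l)"
          using elim L l by (intro tendsto_divide tendsto_const) auto
        then have "(\<lambda>j. (U (\<sigma> f j) x / (L * l)) powr P x) \<longlonglongrightarrow> (S f x / (L * l)) powr P x"
          using P_ge_1(2)[of x] U_nonneg L l by (intro tendsto_powr' tendsto_const) auto
        then have "(\<lambda>j. ennreal ((U (\<sigma> f j) x / (L * l)) powr P x)) \<longlonglongrightarrow> ennreal ((S f x / (L * l)) powr P x)"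
          by (rule tendsto_ennrealI)
        then show ?case by (intro lim_imp_Liminf[symmetric]) auto
      qed
    qed
    also have "\<dots> \<le> liminf (\<lambda>j. \<integral>\<^sup>+x. ennreal ((U (\<sigma> f j) x / (L * l)) powr P x) \<partial>lebesgue)"
      by (rule nn_integral_liminf) measurable
    also have "\<dots> \<le> liminf (\<lambda>j::nat. 1)"
      using 1 by (intro Liminf_mono always_eventually) (simp add: rho_def)
    also have "\<dots> = 1" by (rule Liminf_const) simp
    finally show ?thesis .
  qed
  show ?thesis
    by (rule exI[of _ S], rule exI[of _ L]) (intro conjI ballI allI impI L S0 Sm SU Scong Sadd Sscale Sbd)
qed

end

section \<open>Maximally modulated singular integrals\<close>

text \<open>The kernel conditions do not mention measurability; it comes from this continuity in the
  second variable.\<close>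

lemma CZ_kernel_continuous:
  fixes K :: "real^'n \<Rightarrow> real^'n \<Rightarrow> complex"
  assumes \<tau>: "0 < \<tau>" and reg: "\<And>x y y'. norm (x - y) > 2 * norm (y - y') \<Longrightarrow>
       cmod (K x y - K x y') + cmod (K y x - K y' x)
         \<le> c0 * norm (y - y') powr \<tau> * norm (x - y) powr (- real CARD('n) - \<tau>)"
  shows "continuous_on (- {x}) (K x)"
proof (intro continuous_at_imp_continuous_on ballI)
  fix y assume "y \<in> - {x}"
  then have xy: "0 < norm (x - y)" by simp
  show "isCont (K x) y"
    unfolding isCont_def
  proof (rule LIM_zero_cancel, rule Lim_null_comparison)
    have "\<forall>\<^sub>F y' in at y. dist y' y < norm (x - y) / 2"
      using xy by (auto simp: eventually_at intro!: exI[of _ "norm (x - y) / 2"])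
    then show "\<forall>\<^sub>F y' in at y. cmod (K x y' - K x y) \<le> c0 * norm (y - y') powr \<tau> * norm (x - y) powr (- real CARD('n) - \<tau>)"
    proof eventually_elim
      case (elim y')
      then have "norm (x - y) > 2 * norm (y - y')" by (simp add: dist_norm norm_minus_commute)
      from reg[OF this] show ?case
        using norm_ge_zero[of "K y x - K y' x"] unfolding norm_minus_commute[of "K x y'"] by linarith
    qed
    have "((\<lambda>y'. norm (y - y')) \<longlongrightarrow> norm (y - y)) (at y)" by (intro tendsto_intros)
    then have "((\<lambda>y'. norm (y - y') powr \<tau>) \<longlongrightarrow> 0 powr \<tau>) (at y)"
      using \<tau> by (intro tendsto_powr' tendsto_const) auto
    then have "((\<lambda>y'. c0 * norm (y - y') powr \<tau> * norm (x - y) powr (- real CARD('n) - \<tau>)) \<longlongrightarrow> c0 * 0 powr \<tau> * norm (x - y) powr (- real CARD('n) - \<tau>)) (at y)"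
      by (intro tendsto_mult tendsto_const)
    then show "((\<lambda>y'. c0 * norm (y - y') powr \<tau> * norm (x - y) powr (- real CARD('n) - \<tau>)) \<longlongrightarrow> 0) (at y)"
      by simp
  qed
qed

text \<open>Replacing k by 0 at x makes it Borel measurable and leaves the product unchanged, since
  h x = 0.\<close>

lemma kernel_mult_measurable:
  fixes k h :: "real^'n \<Rightarrow> complex"
  assumes k: "continuous_on (- {x}) k" and h: "h \<in> borel_measurable lebesgue" and hx: "h x = 0"
  shows "(\<lambda>y. k y * h y) \<in> borel_measurable lebesgue"
proof -
  have "(\<lambda>y. indicator (- {x}) y *\<^sub>R k y) \<in> borel_measurable borel"
    by (rule borel_measurable_continuous_on_indicator[OF _ k]) simp
  then have "(\<lambda>y. indicator (- {x}) y *\<^sub>R k y) \<in> borel_measurable lebesgue"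
    by (intro measurable_completion) simp
  then have "(\<lambda>y. (indicator (- {x}) y *\<^sub>R k y) * h y) \<in> borel_measurable lebesgue" using h by measurable
  also have "(\<lambda>y. (indicator (- {x}) y *\<^sub>R k y) * h y) = (\<lambda>y. k y * h y)"
    using hx by (auto simp: indicator_def)
  finally show ?thesis .
qed

text \<open>Moving x by less than 2^k in each coordinate changes an index by at most 1, so an open
  box around x stays in the neighbourhood. The kernel representation is thus available a.e. on the
  whole cube.\<close>

lemma dcube_not_in_ess_support:
  fixes h :: "real^'n \<Rightarrow> complex"
  assumes x: "x \<in> dcube k z" and h: "\<And>y. y \<in> dnbhd k z \<Longrightarrow> h y = 0"
  shows "x \<notin> ess_support h"
proof (rule not_in_ess_supportI)
  let ?V = "box (x - (\<chi> i. 2 powi k)) (x + (\<chi> i. 2 powi k))"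
  show "open ?V" by (rule open_box)
  show "x \<in> ?V" by (simp add: mem_box_cart)
  fix y assume y: "y \<in> ?V"
  have l0: "(0::real) < 2 powi k" by simp
  have n: "1 \<le> int CARD('n)" using one_le_card_finite[where 'a='n] by simp
  have "\<bar>\<lfloor>y $ i / 2 powi k\<rfloor> - \<lfloor>z $ i / 2 powi k\<rfloor>\<bar> \<le> 2 * int CARD('n)" for i
  proof -
    let ?d = "\<lfloor>y $ i / 2 powi k\<rfloor> - \<lfloor>x $ i / 2 powi k\<rfloor>"
    have "x $ i - 2 powi k < y $ i" "y $ i < x $ i + 2 powi k" using y by (auto simp: mem_box_cart)
    then have "2 powi k * (real_of_int ?d - 1) < 2 powi k * 1" "2 powi k * (- 1) < 2 powi k * (real_of_int ?d + 1)"
      using floor_diff_bounds[OF l0, of "y $ i" "x $ i"] by linarith+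
    then have "real_of_int ?d - 1 < 1" "- 1 < real_of_int ?d + 1"
      using l0 by (simp_all only: mult_less_cancel_left_pos)
    then have "\<bar>?d\<bar> \<le> 1" by linarith
    moreover have "\<lfloor>x $ i / 2 powi k\<rfloor> = \<lfloor>z $ i / 2 powi k\<rfloor>" using x by (simp add: dcube_def)
    ultimately show ?thesis using n by linarith
  qed
  then show "h y = 0" by (intro h) (simp add: dnbhd_def)
qed

text \<open>The points x and z are at distance at most n 2^k, while y is farther than 2 n 2^k from
  z, so regularity applies. The bound sees h only through its modulus and is therefore common to all
  modulations of one function.\<close>

lemma CZ_oscillation:
  fixes K :: "real^'n \<Rightarrow> real^'n \<Rightarrow> complex"
  assumes c0: "0 < c0" and \<tau>: "0 < \<tau>"
    and size: "\<And>x y. x \<noteq> y \<Longrightarrow> cmod (K x y) \<le> c0 * norm (x - y) powr (- real CARD('n))"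
    and reg: "\<And>x y y'. norm (x - y) > 2 * norm (y - y') \<Longrightarrow>
       cmod (K x y - K x y') + cmod (K y x - K y' x)
         \<le> c0 * norm (y - y') powr \<tau> * norm (x - y) powr (- real CARD('n) - \<tau>)"
    and h: "h \<in> L0inf" and h0: "\<And>y. y \<in> dnbhd k z \<Longrightarrow> h y = 0" and x: "x \<in> dcube k z"
  shows "ennreal \<bar>cmod (\<integral>y. K x y * h y \<partial>lebesgue) - cmod (\<integral>y. K z y * h y \<partial>lebesgue)\<bar>
     \<le> ennreal (c0 * real CARD('n) powr \<tau> * (2 powi k) powr \<tau>) *
       (\<integral>\<^sup>+y\<in>- dnbhd k z. ennreal (norm (y - z) powr (- real CARD('n) - \<tau>) * cmod (h y)) \<partial>lebesgue)"
proof -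
  define n where "n = real CARD('n)"
  have n: "1 \<le> n" using one_le_card_finite[where 'a='n] by (simp add: n_def)
  define l :: real where "l = 2 powi k"
  have l: "0 < l" by (simp add: l_def)
  have hm[measurable]: "h \<in> borel_measurable lebesgue" by (rule L0inf_measurable[OF h])
  have far: "2 * n * l < norm (y - x)" if "x \<in> dcube k z" "y \<notin> dnbhd k z" for x y
    using not_dnbhd_norm[OF that] by (simp add: n_def l_def)
  have far1: "l < norm (y - x)" if "x \<in> dcube k z" "y \<notin> dnbhd k z" for x y
  proof -
    have "1 * l \<le> 2 * n * l" using n l by (intro mult_right_mono) auto
    then show ?thesis using far[OF that] by simp
  qed
  have hint: "integrable lebesgue h"
  proof (rule integrableI_bounded[OF hm])
    show "(\<integral>\<^sup>+x. ennreal (cmod (h x)) \<partial>lebesgue) < \<infinity>" using L0inf_powr_integral[OF h, of 1] by simp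
  qed
  have int: "integrable lebesgue (\<lambda>y. K x y * h y)" if x: "x \<in> dcube k z" for x
  proof (rule Bochner_Integration.integrable_bound[of _ "\<lambda>y. of_real (c0 * l powr (- n)) * h y"])
    show "integrable lebesgue (\<lambda>y. of_real (c0 * l powr (- n)) * h y)" using hint by simp
    have "x \<in> dnbhd k z" using x by (simp add: dcube_def dnbhd_def)
    then have "h x = 0" by (rule h0)
    moreover have "continuous_on (- {x}) (K x)"
      by (rule CZ_kernel_continuous[of \<tau> K c0, OF \<tau> reg])
    ultimately show "(\<lambda>y. K x y * h y) \<in> borel_measurable lebesgue"
      by (intro kernel_mult_measurable[OF _ hm])
    show "AE y in lebesgue. norm (K x y * h y) \<le> norm (of_real (c0 * l powr (- n)) * h y)"
    proof (rule AE_I2)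
      fix y
      show "norm (K x y * h y) \<le> norm (of_real (c0 * l powr (- n)) * h y)"
      proof (cases "y \<in> dnbhd k z")
        case True then show ?thesis using h0 by simp
      next
        case False
        have "x \<noteq> y" using far1[OF x False] l by auto
        then have "cmod (K x y) \<le> c0 * norm (x - y) powr (- n)" unfolding n_def by (rule size)
        also have "\<dots> \<le> c0 * l powr (- n)"
          using far1[OF x False] l n c0 by (intro mult_left_mono powr_mono2') (auto simp: norm_minus_commute)
        finally show ?thesis using c0 by (simp add: norm_mult mult_right_mono)
      qed
    qed
  qed
  let ?I = "\<lambda>x. \<integral>y. K x y * h y \<partial>lebesgue"
  have z: "z \<in> dcube k z" by (rule self_in_dcube)
  define c where "c = c0 * n powr \<tau> * l powr \<tau>"
  have c: "0 \<le> c" using c0 by (simp add: c_def)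
  have mz: "(\<lambda>y. ennreal (norm (y - z) powr (- n - \<tau>) * cmod (h y)) * indicator (- dnbhd k z) y) \<in> borel_measurable lebesgue"
  proof -
    have [measurable]: "- dnbhd k z \<in> sets lebesgue" by (simp add: Compl_in_sets_lebesgue)
    have "(\<lambda>y. norm (y - z)) \<in> borel_measurable borel" by measurable
    then have [measurable]: "(\<lambda>y. norm (y - z)) \<in> borel_measurable lebesgue" by (intro measurable_completion) simp
    show ?thesis by measurable
  qed
  have "ennreal \<bar>cmod (?I x) - cmod (?I z)\<bar> \<le> ennreal (cmod (?I x - ?I z))"
    by (intro ennreal_leI norm_triangle_ineq3)
  also have "?I x - ?I z = (\<integral>y. K x y * h y - K z y * h y \<partial>lebesgue)"
    by (rule Bochner_Integration.integral_diff[OF int[OF x] int[OF z], symmetric])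
  also have "ennreal (cmod \<dots>) \<le> (\<integral>\<^sup>+y. ennreal (cmod (K x y * h y - K z y * h y)) \<partial>lebesgue)"
    by (intro integral_norm_bound_ennreal Bochner_Integration.integrable_diff int x z)
  also have "\<dots> \<le> (\<integral>\<^sup>+y. ennreal c * (ennreal (norm (y - z) powr (- n - \<tau>) * cmod (h y)) * indicator (- dnbhd k z) y) \<partial>lebesgue)"
  proof (rule nn_integral_mono)
    fix y
    show "ennreal (cmod (K x y * h y - K z y * h y)) \<le> ennreal c * (ennreal (norm (y - z) powr (- n - \<tau>) * cmod (h y)) * indicator (- dnbhd k z) y)"
    proof (cases "y \<in> dnbhd k z")
      case True then show ?thesis using h0 by simp
    next
      case False
      have zx: "norm (z - x) \<le> n * l" using dcube_norm_le[OF x] by (simp add: n_def l_def norm_minus_commute)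
      have "2 * norm (z - x) < norm (y - z)" using zx far[OF z False] by linarith
      from reg[OF this] have "cmod (K z y - K x y) \<le> c0 * norm (z - x) powr \<tau> * norm (y - z) powr (- n - \<tau>)"
        using norm_ge_zero[of "K y z - K y x"] unfolding n_def by linarith
      also have "\<dots> \<le> c0 * (n * l) powr \<tau> * norm (y - z) powr (- n - \<tau>)"
        using zx c0 \<tau> by (intro mult_right_mono mult_left_mono powr_mono2) auto
      also have "\<dots> = c * norm (y - z) powr (- n - \<tau>)" using n l by (simp add: c_def powr_mult)
      finally have "cmod (K x y - K z y) * cmod (h y) \<le> c * norm (y - z) powr (- n - \<tau>) * cmod (h y)"
        by (intro mult_right_mono) (auto simp: norm_minus_commute)
      then have "cmod (K x y * h y - K z y * h y) \<le> c * (norm (y - z) powr (- n - \<tau>) * cmod (h y))"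
        by (simp add: left_diff_distrib[symmetric] norm_mult mult.assoc)
      then have "ennreal (cmod (K x y * h y - K z y * h y)) \<le> ennreal c * ennreal (norm (y - z) powr (- n - \<tau>) * cmod (h y))"
        unfolding ennreal_mult'[OF c, symmetric] by (rule ennreal_leI)
      then show ?thesis using False by simp
    qed
  qed
  also have "\<dots> = ennreal c * (\<integral>\<^sup>+y\<in>- dnbhd k z. ennreal (norm (y - z) powr (- n - \<tau>) * cmod (h y)) \<partial>lebesgue)"
    by (rule nn_integral_cmult[OF mz])
  finally show ?thesis by (simp add: c_def n_def l_def)
qed

section \<open>From norms in the variable Lebesgue space to modulars\<close>

lemma B_M_exponent:
  fixes p :: "real^'n \<Rightarrow> ereal"
  assumes "p \<in> B_M"
  obtains P pm pp where "bounded_exponent P pm pp" "AE x in lebesgue. P x = real_of_ereal (p x)"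
proof -
  have [measurable]: "p \<in> borel_measurable lebesgue" using assms by (simp add: B_M_def)
  have "1 < Liminf (ae_filter lebesgue) p" using assms by (simp add: B_M_def)
  then obtain a where a: "1 < ereal a" "ereal a < Liminf (ae_filter lebesgue) p" by (rule ereal_dense2[THEN exE]) blast
  have lo: "AE x in lebesgue. ereal a < p x" using less_LiminfD[OF a(2)] .
  have "esssup lebesgue p < \<infinity>" using assms by (simp add: B_M_def)
  then obtain b where b: "esssup lebesgue p < ereal b" by (rule ereal_dense2[THEN exE]) blast
  have up: "AE x in lebesgue. p x \<le> esssup lebesgue p" by (rule esssup_AE)
  \<comment> \<open>Clipping makes the bounds hold at every point; since a < p x < b a.e., it
    changes p only on a null set. The inner \<open>max a b\<close> keeps the interval
    nonempty.\<close>
  define P where "P x = max a (min (max a b) (real_of_ereal (p x)))" for x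
  have "bounded_exponent P a (max a b)"
  proof
    show "P \<in> borel_measurable lebesgue" unfolding P_def by measurable
    show "1 < a" using a by simp
  qed (auto simp: P_def)
  moreover have "AE x in lebesgue. P x = real_of_ereal (p x)"
    using lo up
  proof eventually_elim
    case (elim x)
    then have "ereal a < p x" "p x < ereal b" using b by auto
    then show ?case by (cases "p x") (auto simp: P_def)
  qed
  ultimately show thesis by (rule that)
qed

lemma modular_eq_rho:
  fixes p :: "real^'n \<Rightarrow> ereal"
  assumes "AE x in lebesgue. P x = real_of_ereal (p x)" "0 < l"
  shows "modular p (\<lambda>x. f x / of_real l) = rho P (\<lambda>x. cmod (f x) / l)"
  unfolding modular_def rho_def
proof (rule nn_integral_cong_AE)
  show "AE x in lebesgue. ennreal (cmod (f x / of_real l) powr real_of_ereal (p x)) = ennreal ((cmod (f x) / l) powr P x)"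
    using assms(1) by eventually_elim (use assms(2) in \<open>simp add: norm_divide\<close>)
qed

lemma var_Lspace_eq:
  fixes p :: "real^'n \<Rightarrow> ereal"
  assumes "AE x in lebesgue. P x = real_of_ereal (p x)"
  shows "var_Lspace p = rho_space P"
  unfolding var_Lspace_def rho_space_def using modular_eq_rho[OF assms] by auto

lemma var_norm_eq:
  fixes p :: "real^'n \<Rightarrow> ereal"
  assumes "AE x in lebesgue. P x = real_of_ereal (p x)"
  shows "var_norm p f = Inf {l. 0 < l \<and> rho P (\<lambda>x. cmod (f x) / l) \<le> 1}"
proof -
  have "{l. 0 < l \<and> modular p (\<lambda>x. f x / of_real l) \<le> 1} = {l. 0 < l \<and> rho P (\<lambda>x. cmod (f x) / l) \<le> 1}"
    using modular_eq_rho[OF assms] by auto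
  then show ?thesis by (simp only: var_norm_def)
qed

lemma bdd_below_positive: "bdd_below {l::real. 0 < l \<and> Q l}"
  by (rule bdd_belowI[of _ 0]) auto

lemma cubes_emeasure:
  assumes "Q \<in> cubes" shows "emeasure lebesgue Q \<noteq> 0" "emeasure lebesgue Q \<noteq> top"
proof -
  obtain a b l where Q: "Q = cbox a b" "0 < l" "\<forall>i. b $ i - a $ i = l" using assms by (auto simp: cubes_def)
  then have "emeasure lebesgue Q = ennreal (l ^ CARD('a))"
    using content_cube[of b a l] by (simp add: emeasure_completion)
  then show "emeasure lebesgue Q \<noteq> 0" "emeasure lebesgue Q \<noteq> top" using Q by auto
qed

lemma HL_max_ge:
  assumes Q: "Q \<in> cubes" "x \<in> Q"
  shows "(\<integral>\<^sup>+y\<in>Q. ennreal (cmod (f y)) \<partial>lebesgue) \<le> HL_max f x * emeasure lebesgue Q"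
proof -
  let ?I = "\<integral>\<^sup>+y\<in>Q. ennreal (cmod (f y)) \<partial>lebesgue"
  have "?I / emeasure lebesgue Q \<le> HL_max f x"
    unfolding HL_max_def using Q by (intro SUP_upper2[of Q]) auto
  then have "?I / emeasure lebesgue Q * emeasure lebesgue Q \<le> HL_max f x * emeasure lebesgue Q"
    by (rule mult_right_mono) simp
  moreover have "?I / emeasure lebesgue Q * emeasure lebesgue Q = ?I"
    unfolding ennreal_divide_times using cubes_emeasure[OF Q(1)]
    by (simp add: less_top)
  ultimately show ?thesis by simp
qed

text \<open>The norm is an infimum that need not be attained: if the norm of M f is at most C, a
  modular bound follows only for numbers above C. The choice C + 1 provides this and is at least
  1.\<close>

lemma B_M_maximal_exponent:
  fixes p :: "real^'n \<Rightarrow> ereal"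
  assumes p: "p \<in> B_M" and be: "bounded_exponent P pm pp" and P: "AE x in lebesgue. P x = real_of_ereal (p x)"
  obtains B where "maximal_exponent P pm pp B"
proof -
  interpret bounded_exponent P pm pp by (rule be)
  have fin: "\<forall>f\<in>var_Lspace p. AE x in lebesgue. HL_max f x < \<infinity>"
    and "var_bounded p (\<lambda>f x. complex_of_real (enn2real (HL_max f x)))"
    using p by (auto simp: B_M_def)
  then obtain C where C: "0 < C" "\<forall>f\<in>var_Lspace p. (\<lambda>x. complex_of_real (enn2real (HL_max f x))) \<in> var_Lspace p \<and>
      var_norm p (\<lambda>x. complex_of_real (enn2real (HL_max f x))) \<le> C * var_norm p f"
    unfolding var_bounded_def by blast
  have "maximal_exponent P pm pp (C + 1)"
  proof (unfold_locales)
    show "1 \<le> C + 1" using C by simp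
    fix f :: "real^'n \<Rightarrow> real"
    assume f[measurable]: "f \<in> borel_measurable lebesgue" and f0: "\<And>x. 0 \<le> f x" and f1: "rho P f \<le> 1"
    let ?F = "\<lambda>x. complex_of_real (f x)"
    have cF: "cmod (?F x) = f x" for x using f0 by simp
    have F1: "rho P (\<lambda>x. cmod (?F x) / 1) \<le> 1" using f1 by (simp only: cF div_by_1)
    have FX: "?F \<in> var_Lspace p"
      unfolding var_Lspace_eq[OF P] rho_space_iff using F1 by (intro conjI exI[of _ 1]) auto
    have "var_norm p ?F \<le> 1"
      unfolding var_norm_eq[OF P] using F1 by (intro cInf_lower bdd_below_positive) auto
    define h where "h x = enn2real (HL_max ?F x)" for x
    let ?H = "\<lambda>x. complex_of_real (h x)"
    have h0: "0 \<le> h x" for x by (simp add: h_def)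
    have cH: "cmod (?H x) = h x" for x using h0 by simp
    have HX: "?H \<in> var_Lspace p" and "var_norm p ?H \<le> C * var_norm p ?F"
      using bspec[OF C(2) FX] unfolding h_def by blast+
    moreover have "C * var_norm p ?F \<le> C * 1" using C \<open>var_norm p ?F \<le> 1\<close> by (intro mult_left_mono) auto
    ultimately have nH: "var_norm p ?H < C + 1" by simp
    have "{l. 0 < l \<and> rho P (\<lambda>x. cmod (?H x) / l) \<le> 1} \<noteq> {}"
      using HX unfolding var_Lspace_eq[OF P] rho_space_iff by blast
    from cInf_lessD[OF this nH[unfolded var_norm_eq[OF P]]]
    obtain l where l: "0 < l" "rho P (\<lambda>x. h x / l) \<le> 1" "l < C + 1" unfolding cH by blast
    have "?H \<in> borel_measurable lebesgue" using HX by (simp add: var_Lspace_def)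
    then have "(\<lambda>x. Re (?H x)) \<in> borel_measurable lebesgue" by measurable
    then have hm: "h \<in> borel_measurable lebesgue" by simp
    have "rho P (\<lambda>x. h x / (C + 1)) \<le> rho P (\<lambda>x. h x / l)"
      using l h0 by (intro rho_mono_AE AE_I2 conjI divide_left_mono) auto
    then have h1: "rho P (\<lambda>x. h x / (C + 1)) \<le> 1" using l(2) by (rule order_trans)
    have "AE x in lebesgue. HL_max ?F x < \<infinity>" using fin FX by blast
    then have "AE x in lebesgue. \<forall>Q\<in>cubes. x \<in> Q \<longrightarrow>
           (\<integral>\<^sup>+y\<in>Q. ennreal (f y) \<partial>lebesgue) \<le> ennreal (h x) * emeasure lebesgue Q"
    proof eventually_elim
      case (elim x)
      have "ennreal (h x) = HL_max ?F x" using elim by (simp add: h_def)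
      then show ?case using HL_max_ge[of _ x ?F] unfolding cF by simp
    qed
    then show "\<exists>h\<in>borel_measurable lebesgue. (\<forall>x. 0 \<le> h x) \<and> rho P (\<lambda>x. h x / (C + 1)) \<le> 1 \<and>
        (AE x in lebesgue. \<forall>Q\<in>cubes. x \<in> Q \<longrightarrow>
           (\<integral>\<^sup>+y\<in>Q. ennreal (f y) \<partial>lebesgue) \<le> ennreal (h x) * emeasure lebesgue Q)"
      using hm h0 h1 by blast
  qed
  then show thesis by (rule that)
qed

section \<open>The supremum over the modulations\<close>

lemma modulate_L0inf:
  assumes f: "f \<in> L0inf" and \<phi>: "\<phi> \<in> borel_measurable lebesgue"
  shows "modulate \<phi> f \<in> L0inf"
proof (rule L0inf_dominated[OF f, of _ 1])
  show "modulate \<phi> f \<in> meas_funs"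
    unfolding modulate_def using \<phi> L0inf_measurable[OF f] by measurable
  show "AE x in lebesgue. cmod (modulate \<phi> f x) \<le> 1 * cmod (f x)"
    by (rule AE_I2) (simp add: modulate_def norm_mult)
qed

lemma cmod_modulate: "cmod (modulate \<phi> f x) = cmod (f x)"
  by (simp add: modulate_def norm_mult)

text \<open>The index set may be uncountable, so the null sets of the single estimates cannot be
  collected. The upper bound comes from the minimality of S against a competitor G that is infinite
  off Q, the lower bound from a countable subfamily realising the supremum C of the constants
  \<open>v i\<close>.\<close>

lemma is_ae_Sup_osc:
  fixes v :: "'i \<Rightarrow> real"
  assumes S: "is_ae_Sup M I F S" and Q[measurable]: "Q \<in> sets M"
    and fin: "AE x in M. S x < \<infinity>" and a: "0 \<le> a" and v: "\<And>i. 0 \<le> v i"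
    and osc: "\<And>i. i \<in> I \<Longrightarrow> AE x in M. x \<in> Q \<longrightarrow> F i x \<le> ennreal (v i + a) \<and> ennreal (v i) \<le> F i x + ennreal a"
  shows "\<exists>c. AE x in M. x \<in> Q \<longrightarrow> \<bar>enn2real (S x) - c\<bar> \<le> a"
proof -
  have Sm[measurable]: "S \<in> borel_measurable M" and Sub: "\<And>i. i \<in> I \<Longrightarrow> AE x in M. F i x \<le> S x"
    and Sleast: "\<And>G. G \<in> borel_measurable M \<Longrightarrow> (\<forall>i\<in>I. AE x in M. F i x \<le> G x) \<Longrightarrow> AE x in M. S x \<le> G x"
    using S by (auto simp: is_ae_Sup_def)
  define C where "C = (SUP i\<in>I. ennreal (v i))"
  have vC: "ennreal (v i) \<le> C" if "i \<in> I" for i unfolding C_def using that by (rule SUP_upper)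
  define G where "G x = (if x \<in> Q then C + ennreal a else top)" for x
  have "G \<in> borel_measurable M" unfolding G_def by measurable
  then have "AE x in M. S x \<le> G x"
  proof (rule Sleast, intro ballI)
    fix i assume i: "i \<in> I"
    show "AE x in M. F i x \<le> G x"
      using osc[OF i]
    proof eventually_elim
      case (elim x)
      show ?case
      proof (cases "x \<in> Q")
        case True
        then have "F i x \<le> ennreal (v i) + ennreal a" using elim v a by simp
        also have "\<dots> \<le> C + ennreal a" by (intro add_right_mono vC i)
        finally show ?thesis using True by (simp add: G_def)
      qed (simp add: G_def)
    qed
  qed
  moreover have "AE x in M. x \<in> Q \<longrightarrow> C \<le> S x + ennreal a"
  proof (cases "I = {}")
    case True then show ?thesis by (simp add: C_def bot_ennreal)
  next
    case False
    then have "(\<lambda>i. ennreal (v i)) ` I \<noteq> {}" by simp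
    from ennreal_Sup_countable_SUP[OF this] obtain u :: "nat \<Rightarrow> ennreal"
      where u: "range u \<subseteq> (\<lambda>i. ennreal (v i)) ` I" "C = (SUP n. u n)" unfolding C_def by blast
    have "AE x in M. x \<in> Q \<longrightarrow> u n \<le> S x + ennreal a" for n
    proof -
      obtain i where i: "i \<in> I" "u n = ennreal (v i)" using u(1) by blast
      show ?thesis using osc[OF i(1)] Sub[OF i(1)]
      proof eventually_elim
        case (elim x)
        then show ?case unfolding i(2) by (auto intro: order_trans add_right_mono)
      qed
    qed
    then have "AE x in M. \<forall>n. x \<in> Q \<longrightarrow> u n \<le> S x + ennreal a"
      by (subst AE_all_countable) (rule allI)
    then show ?thesis by eventually_elim (auto simp: u(2) intro: SUP_least)
  qed
  ultimately have "AE x in M. x \<in> Q \<longrightarrow> \<bar>enn2real (S x) - enn2real C\<bar> \<le> a"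
    using fin
  proof eventually_elim
    case (elim x)
    show ?case
    proof
      assume x: "x \<in> Q"
      obtain s where s: "S x = ennreal s" "0 \<le> s" using elim(3) by (cases "S x") auto
      have 1: "C \<le> ennreal s + ennreal a" and 2: "ennreal s \<le> C + ennreal a" using elim x s by (auto simp: G_def)
      then obtain c where c: "C = ennreal c" "0 \<le> c" by (cases C) (auto simp: top_unique simp flip: ennreal_plus)
      have "ennreal c \<le> ennreal (s + a)" "ennreal s \<le> ennreal (c + a)" using 1 2 c s a by simp_all
      then have "c \<le> s + a" "s \<le> c + a" using c s a by (auto simp: ennreal_le_iff simp del: ennreal_plus)
      then show "\<bar>enn2real (S x) - enn2real C\<bar> \<le> a" using s c by simp
    qed
  qed
  then show ?thesis by blast
qed

text \<open>Finiteness, sublinearity and compatibility with a.e. equality are read off from an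
  extension of weak type (2,2), which agrees with U a.e. on \<open>L0inf\<close>. Each r may come
  with its own extension; all of them agree with U there. The oscillation estimate is proved for the
  single modulations and passed to the supremum.\<close>

lemma max_modulated_operator:
  fixes P :: "real^'n \<Rightarrow> real" and T :: "'n cfun \<Rightarrow> 'n cfun" and A :: "'i set" and \<Phi> :: "'i \<Rightarrow> real^'n \<Rightarrow> real"
  assumes P: "maximal_exponent P pm pp B" and T: "CZ_operator T"
    and \<Phi>: "\<And>\<alpha>. \<alpha> \<in> A \<Longrightarrow> \<Phi> \<alpha> \<in> borel_measurable lebesgue"
    and weak: "\<And>r. 1 < r \<Longrightarrow> \<exists>S. extends_max_modulated T A \<Phi> S \<and> weak_type r S"
  shows "modulated_operator P pm pp B (\<lambda>f x. enn2real (max_modulated T A \<Phi> f x))"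
proof -
  interpret maximal_exponent P pm pp B by (rule P)
  define U where "U f x = enn2real (max_modulated T A \<Phi> f x)" for f x
  have mod_L0: "modulate (\<Phi> \<alpha>) f \<in> L0inf" if "\<alpha> \<in> A" "f \<in> L0inf" for \<alpha> f
    by (rule modulate_L0inf[OF that(2) \<Phi>[OF that(1)]])
  have Tm: "T f \<in> meas_funs" if "f \<in> L0inf" for f
    using T L0inf_Lspace[OF that, of 2] by (simp add: CZ_operator_def linear_operator_def ae_operator_def)
  have sup: "is_ae_Sup lebesgue A (\<lambda>\<alpha> x. ennreal (cmod (T (modulate (\<Phi> \<alpha>) f) x))) (max_modulated T A \<Phi> f)"
    if f: "f \<in> L0inf" for f
    unfolding max_modulated_def
  proof (rule is_ae_Sup_ae_Sup)
    fix \<alpha> assume "\<alpha> \<in> A"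
    note [measurable] = Tm[OF mod_L0[OF this f]]
    show "(\<lambda>x. ennreal (cmod (T (modulate (\<Phi> \<alpha>) f) x))) \<in> borel_measurable lebesgue" by measurable
  qed
  have mm[measurable]: "max_modulated T A \<Phi> f \<in> borel_measurable lebesgue" if f: "f \<in> L0inf" for f
    using sup[OF f] by (simp add: is_ae_Sup_def)
  have Um[measurable]: "U f \<in> borel_measurable lebesgue" if f: "f \<in> L0inf" for f
    unfolding U_def using mm[OF f] by measurable
  have U0: "0 \<le> U f x" for f x by (simp add: U_def)
  obtain S where S: "extends_max_modulated T A \<Phi> S" "weak_type 2 S" using weak[of 2] by auto
  have SU: "AE x in lebesgue. S f x = of_real (U f x)" if "extends_max_modulated T A \<Phi> S" "f \<in> L0inf" for S f
    using that unfolding extends_max_modulated_def U_def by auto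
  have fin: "AE x in lebesgue. max_modulated T A \<Phi> f x < \<infinity>" if "f \<in> L0inf" for f
    using S(1) that unfolding extends_max_modulated_def by auto
  have sub: "sublinear_operator (Lspace 2) S" using S(2) by (simp add: weak_type_def)
  have L2: "f \<in> Lspace 2" if "f \<in> L0inf" for f using L0inf_Lspace[OF that] by simp
  have "modulated_operator P pm pp B U"
  proof (unfold_locales)
    show "f \<in> L0inf \<Longrightarrow> U f \<in> borel_measurable lebesgue" for f by (rule Um)
    show "0 \<le> U f x" for f x by (rule U0)
    show "AE x in lebesgue. U f x = U g x"
      if f: "f \<in> L0inf" and g: "g \<in> L0inf" and fg: "AE x in lebesgue. f x = g x" for f g
    proof -
      have "AE x in lebesgue. S f x = S g x"
        using sub L2[OF f] L2[OF g] fg unfolding sublinear_operator_def ae_operator_def by blast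
      then show ?thesis using SU[OF S(1) f] SU[OF S(1) g] by eventually_elim simp
    qed
    show "AE x in lebesgue. U (\<lambda>y. f y + g y) x \<le> U f x + U g x"
      if f: "f \<in> L0inf" and g: "g \<in> L0inf" for f g
    proof -
      have "AE x in lebesgue. cmod (S (\<lambda>y. f y + g y) x) \<le> cmod (S f x) + cmod (S g x)"
        using sub L2[OF f] L2[OF g] unfolding sublinear_operator_def by blast
      then show ?thesis using SU[OF S(1) f] SU[OF S(1) g] SU[OF S(1) L0inf_add[OF f g]]
        by eventually_elim (simp add: U0)
    qed
    show "AE x in lebesgue. U (\<lambda>y. c * f y) x = cmod c * U f x"
      if f: "f \<in> L0inf" for f c
    proof -
      have "AE x in lebesgue. cmod (S (\<lambda>y. c * f y) x) = cmod c * cmod (S f x)"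
        using sub L2[OF f] unfolding sublinear_operator_def by blast
      then show ?thesis using SU[OF S(1) f] SU[OF S(1) L0inf_scale[OF f, of c]]
        by eventually_elim (simp add: U0)
    qed
    show "\<exists>C>0. \<forall>f\<in>L0inf. \<forall>t>0. emeasure lebesgue {x. t < U f x} \<le>
       ennreal (C powr r / t powr r) * (\<integral>\<^sup>+y. ennreal (cmod (f y) powr r) \<partial>lebesgue)" if r: "1 < r" for r
    proof -
      obtain R where R: "extends_max_modulated T A \<Phi> R" "weak_type r R" using weak[OF r] by blast
      then obtain C where C: "0 < C" "\<forall>f\<in>Lspace r. \<forall>l>0. emeasure lebesgue {x. cmod (R f x) > l}
          \<le> ennreal (C powr r / l powr r) * (\<integral>\<^sup>+y. ennreal (cmod (f y) powr r) \<partial>lebesgue)"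
        by (auto simp: weak_type_def)
      have "emeasure lebesgue {x. t < U f x} \<le> ennreal (C powr r / t powr r) * (\<integral>\<^sup>+y. ennreal (cmod (f y) powr r) \<partial>lebesgue)"
        if f: "f \<in> L0inf" and t: "0 < t" for f t
      proof -
        have fr: "f \<in> Lspace r" using L0inf_Lspace[OF f] r by simp
        have "R f \<in> meas_funs" using R(2) fr by (simp add: weak_type_def sublinear_operator_def ae_operator_def)
        then have "(\<lambda>x. cmod (R f x)) \<in> borel_measurable lebesgue" by measurable
        then have m: "{x. t < cmod (R f x)} \<in> sets lebesgue"
          using superlevel_sets[of "\<lambda>x. cmod (R f x)" lebesgue] by simp
        have "emeasure lebesgue {x. t < U f x} \<le> emeasure lebesgue {x. t < cmod (R f x)}"
        proof (rule emeasure_mono_AE[OF _ m])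
          show "AE x in lebesgue. x \<in> {x. t < U f x} \<longrightarrow> x \<in> {x. t < cmod (R f x)}"
            using SU[OF R(1) f] by eventually_elim (simp add: U0)
        qed
        also have "\<dots> \<le> ennreal (C powr r / t powr r) * (\<integral>\<^sup>+y. ennreal (cmod (f y) powr r) \<partial>lebesgue)"
          using C(2) fr t by blast
        finally show ?thesis .
      qed
      then show ?thesis using C(1) by blast
    qed
    obtain K where "CZ_kernel K" and rep: "\<And>f. f \<in> L0inf \<Longrightarrow> AE x in lebesgue. x \<notin> ess_support f \<longrightarrow>
          T f x = (\<integral>y. K x y * f y \<partial>lebesgue)"
      using T unfolding CZ_operator_def by blast
    then obtain c0 \<tau> where c0: "0 < c0" and \<tau>: "0 < \<tau>"
      and size: "\<And>x y. x \<noteq> y \<Longrightarrow> cmod (K x y) \<le> c0 * norm (x - y) powr (- real CARD('n))"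
      and reg: "\<And>x y y'. norm (x - y) > 2 * norm (y - y') \<Longrightarrow>
       cmod (K x y - K x y') + cmod (K y x - K y' x)
         \<le> c0 * norm (y - y') powr \<tau> * norm (x - y) powr (- real CARD('n) - \<tau>)"
      unfolding CZ_kernel_def by blast
    have "\<exists>c. AE x in lebesgue. x \<in> dcube k z \<longrightarrow> ennreal \<bar>U f x - c\<bar> \<le>
         ennreal (c0 * real CARD('n) powr \<tau> * (2 powi k) powr \<tau>) *
         (\<integral>\<^sup>+y\<in>- dnbhd k z. ennreal (norm (y - z) powr (- real CARD('n) - \<tau>) * cmod (f y)) \<partial>lebesgue)"
      if f: "f \<in> L0inf" and f0: "\<forall>y\<in>dnbhd k z. f y = 0" for f k z
    proof -
      define a' where "a' = ennreal (c0 * real CARD('n) powr \<tau> * (2 powi k) powr \<tau>) *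
         (\<integral>\<^sup>+y\<in>- dnbhd k z. ennreal (norm (y - z) powr (- real CARD('n) - \<tau>) * cmod (f y)) \<partial>lebesgue)"
      show ?thesis
      proof (cases "a' = \<infinity>")
        case True then show ?thesis unfolding a'_def[symmetric] by simp
      next
        case False
        then obtain a where a: "a' = ennreal a" "0 \<le> a" by (cases a') auto
        \<comment> \<open>The kernel integral at the base point z serves as the constant for the
          modulation \<alpha>, in place of a value of T at z, which is not defined for
          classes.\<close>
        define v where "v \<alpha> = cmod (\<integral>y. K z y * modulate (\<Phi> \<alpha>) f y \<partial>lebesgue)" for \<alpha>
        have "\<exists>c. AE x in lebesgue. x \<in> dcube k z \<longrightarrow> \<bar>enn2real (max_modulated T A \<Phi> f x) - c\<bar> \<le> a"
        proof (rule is_ae_Sup_osc[OF sup[OF f] dcube_sets fin[OF f] a(2)])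
          show "0 \<le> v \<alpha>" for \<alpha> by (simp add: v_def)
          fix \<alpha> assume \<alpha>: "\<alpha> \<in> A"
          let ?h = "modulate (\<Phi> \<alpha>) f"
          have h: "?h \<in> L0inf" by (rule mod_L0[OF \<alpha> f])
          have h0: "?h y = 0" if "y \<in> dnbhd k z" for y using f0 that by (simp add: modulate_def)
          show "AE x in lebesgue. x \<in> dcube k z \<longrightarrow>
             ennreal (cmod (T ?h x)) \<le> ennreal (v \<alpha> + a) \<and> ennreal (v \<alpha>) \<le> ennreal (cmod (T ?h x)) + ennreal a"
            using rep[OF h]
          proof eventually_elim
            case (elim x)
            show ?case
            proof
              assume x: "x \<in> dcube k z"
              have Tx: "T ?h x = (\<integral>y. K x y * ?h y \<partial>lebesgue)"
                by (rule elim[rule_format, OF dcube_not_in_ess_support[OF x]]) (rule h0)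
              have "a' = ennreal (c0 * real CARD('n) powr \<tau> * (2 powi k) powr \<tau>) *
                (\<integral>\<^sup>+y\<in>- dnbhd k z. ennreal (norm (y - z) powr (- real CARD('n) - \<tau>) * cmod (?h y)) \<partial>lebesgue)"
                by (simp only: a'_def cmod_modulate)
              then have "ennreal \<bar>cmod (T ?h x) - v \<alpha>\<bar> \<le> a'"
                unfolding Tx v_def
                by (simp only:) (rule CZ_oscillation[of c0 \<tau> K ?h k z x, OF c0 \<tau> size reg h h0 x])
              then have "\<bar>cmod (T ?h x) - v \<alpha>\<bar> \<le> a" using a by (simp add: ennreal_le_iff)
              then have "cmod (T ?h x) \<le> v \<alpha> + a" "v \<alpha> \<le> cmod (T ?h x) + a" by linarith+
              then show "ennreal (cmod (T ?h x)) \<le> ennreal (v \<alpha> + a) \<and> ennreal (v \<alpha>) \<le> ennreal (cmod (T ?h x)) + ennreal a"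
                using ennreal_leI[of "v \<alpha>" "cmod (T ?h x) + a"] a(2) by (simp add: ennreal_leI)
            qed
          qed
        qed
        then obtain c where "AE x in lebesgue. x \<in> dcube k z \<longrightarrow> \<bar>U f x - c\<bar> \<le> a" unfolding U_def by blast
        then have "AE x in lebesgue. x \<in> dcube k z \<longrightarrow> ennreal \<bar>U f x - c\<bar> \<le> a'"
          unfolding a by eventually_elim (auto intro: ennreal_leI)
        then show ?thesis unfolding a'_def by blast
      qed
    qed
    note osc = this
    show "\<exists>\<tau>>0. \<exists>A\<ge>0. \<forall>f\<in>L0inf. \<forall>k z. (\<forall>y\<in>dnbhd k z. f y = 0) \<longrightarrow>
       (\<exists>c. AE x in lebesgue. x \<in> dcube k z \<longrightarrow> ennreal \<bar>U f x - c\<bar> \<le>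
         ennreal (A * (2 powi k) powr \<tau>) *
         (\<integral>\<^sup>+y\<in>- dnbhd k z. ennreal (norm (y - z) powr (- real CARD('n) - \<tau>) * cmod (f y)) \<partial>lebesgue))"
    proof (rule exI[of _ \<tau>], rule conjI[OF \<tau>], rule exI[of _ "c0 * real CARD('n) powr \<tau>"], rule conjI)
      show "0 \<le> c0 * real CARD('n) powr \<tau>" using c0 by simp
    qed (intro ballI allI impI, erule (1) osc)
  qed
  then show ?thesis by (simp only: U_def[abs_def])
qed

theorem corollary5p3:
  fixes p :: "real^'n \<Rightarrow> ereal"
    and T :: "'n cfun \<Rightarrow> 'n cfun"
    and A :: "'i set"
    and \<Phi> :: "'i \<Rightarrow> real^'n \<Rightarrow> real"
  assumes "p \<in> B_M"
    and "CZ_operator T"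
    and "\<And>\<alpha>. \<alpha> \<in> A \<Longrightarrow> \<Phi> \<alpha> \<in> borel_measurable lebesgue"
    and "\<And>r. 1 < r \<Longrightarrow> \<exists>S. extends_max_modulated T A \<Phi> S \<and> weak_type r S"
  shows "\<exists>S. extends_max_modulated T A \<Phi> S \<and>
             nonneg_sublinear_operator (var_Lspace p) S \<and>
             var_bounded p S"
proof -
  obtain P pm pp where be: "bounded_exponent P pm pp" and P: "AE x in lebesgue. P x = real_of_ereal (p x)"
    by (rule B_M_exponent[OF assms(1)])
  obtain B where "maximal_exponent P pm pp B" by (rule B_M_maximal_exponent[OF assms(1) be P])
  then interpret modulated_operator P pm pp B "\<lambda>f x. enn2real (max_modulated T A \<Phi> f x)"
    by (rule max_modulated_operator[OF _ assms(2-4)])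
  obtain S L where L: "0 < L" and S0: "\<forall>f x. 0 \<le> S f x"
    and Sm: "\<forall>f\<in>rho_space P. S f \<in> borel_measurable lebesgue"
    and SU: "\<forall>f\<in>L0inf. AE x in lebesgue. S f x = enn2real (max_modulated T A \<Phi> f x)"
    and Scong: "\<forall>f\<in>rho_space P. \<forall>g\<in>rho_space P. (AE x in lebesgue. f x = g x) \<longrightarrow> (AE x in lebesgue. S f x = S g x)"
    and Sadd: "\<forall>f\<in>rho_space P. \<forall>g\<in>rho_space P. AE x in lebesgue. S (\<lambda>y. f y + g y) x \<le> S f x + S g x"
    and Sscale: "\<forall>f\<in>rho_space P. \<forall>c. AE x in lebesgue. S (\<lambda>y. c * f y) x = cmod c * S f x"
    and Sbd: "\<forall>f\<in>rho_space P. \<forall>l>0. rho P (\<lambda>x. cmod (f x) / l) \<le> 1 \<longrightarrow> rho P (\<lambda>x. S f x / (L * l)) \<le> 1"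
    using U_extension by blast
  let ?S = "\<lambda>f x. complex_of_real (S f x)"
  note V = var_Lspace_eq[OF P]
  obtain S2 where S2: "extends_max_modulated T A \<Phi> S2" using assms(4)[of 2] by auto
  have "extends_max_modulated T A \<Phi> ?S"
    unfolding extends_max_modulated_def
  proof
    fix f :: "'n cfun" assume f: "f \<in> L0inf"
    have "AE x in lebesgue. max_modulated T A \<Phi> f x < \<infinity>"
      using S2 f unfolding extends_max_modulated_def by auto
    then show "AE x in lebesgue. max_modulated T A \<Phi> f x < \<infinity> \<and> ?S f x = of_real (enn2real (max_modulated T A \<Phi> f x))"
      using bspec[OF SU f] by eventually_elim simp
  qed
  moreover have "nonneg_sublinear_operator (var_Lspace p) ?S"
    unfolding nonneg_sublinear_operator_def ae_operator_def V
  proof (intro conjI ballI allI impI)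
    fix f assume f: "f \<in> rho_space P"
    show "?S f \<in> meas_funs" using bspec[OF Sm f] by measurable
    fix c :: complex
    show "AE x in lebesgue. ?S (\<lambda>y. c * f y) x = of_real (cmod c) * ?S f x"
      using Sscale[rule_format, OF f, of c] by eventually_elim simp
  next
    fix f g assume fg: "f \<in> rho_space P" "g \<in> rho_space P"
    show "AE x in lebesgue. ?S f x = ?S g x" if "AE x in lebesgue. f x = g x"
      using Scong[rule_format, OF fg that] by eventually_elim simp
    show "AE x in lebesgue. 0 \<le> ?S (\<lambda>y. f y + g y) x \<and> ?S (\<lambda>y. f y + g y) x \<le> ?S f x + ?S g x"
      using Sadd[rule_format, OF fg] by eventually_elim (simp add: less_eq_complex_def S0)
  qed
  moreover have "var_bounded p ?S"
    unfolding var_bounded_def V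
  proof (intro exI[of _ L] conjI ballI L)
    fix f assume f: "f \<in> rho_space P"
    have cS: "cmod (?S f x) = S f x" for x using S0 by simp
    have S_le: "rho P (\<lambda>x. cmod (?S f x) / (L * l)) \<le> 1" if "0 < l" "rho P (\<lambda>x. cmod (f x) / l) \<le> 1" for l
      unfolding cS using Sbd[rule_format, OF f that] .
    obtain l where l: "0 < l" "rho P (\<lambda>x. cmod (f x) / l) \<le> 1" using f unfolding rho_space_iff by blast
    have "?S f \<in> meas_funs" using bspec[OF Sm f] by measurable
    then show "?S f \<in> rho_space P"
      unfolding rho_space_iff using S_le[OF l] L l by (intro conjI exI[of _ "L * l"]) auto
    \<comment> \<open>Each m admissible in the infimum for f makes L m admissible in the infimum for
      its image.\<close>
    have "var_norm p (?S f) / L \<le> var_norm p f"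
      unfolding var_norm_eq[OF P, of f]
    proof (rule cInf_greatest)
      show "{l. 0 < l \<and> rho P (\<lambda>x. cmod (f x) / l) \<le> 1} \<noteq> {}" using l by blast
      fix m assume "m \<in> {l. 0 < l \<and> rho P (\<lambda>x. cmod (f x) / l) \<le> 1}"
      then have m: "0 < m" "rho P (\<lambda>x. cmod (f x) / m) \<le> 1" by auto
      have "var_norm p (?S f) \<le> L * m"
        unfolding var_norm_eq[OF P] using S_le[OF m] L m by (intro cInf_lower bdd_below_positive) auto
      then show "var_norm p (?S f) / L \<le> m" using L by (simp add: divide_le_eq mult.commute)
    qed
    then show "var_norm p (?S f) \<le> L * var_norm p f" using L by (simp add: divide_le_eq mult.commute)
  qed
  ultimately show ?thesis by blast
qed

end
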